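(* Let $P(z),q(z)\in\mathbb{C}[z]$, $q\neq 0$, $a,b\in\mathbb{C}$, $a\neq b$, and let $Q(z)=\int q(z)\,dz$. Suppose that $\deg P=p^r$, where $p$ is a prime number and $r\ge 1$ is an integer. Then the following two conditions are equivalent: (i) $\int_a^b P^i(z)q(z)\,dz=0$ for all integers $i\ge 0$; (ii) there exist polynomials $\tilde P,\tilde Q,W\in\mathbb{C}[z]$ such that $P(z)=\tilde P(W(z))$, $Q(z)=\tilde Q(W(z))$ and $W(a)=W(b)$.
   Context: $Q$ denotes any antiderivative of $q$ (condition (ii) does not depend on the choice of constant). *)

theory Defs
  imports "HOL-Complex_Analysis.Complex_Analysis"
    "HOL-Computational_Algebra.Polynomial"
    "HOL-Computational_Algebra.Primes"
begin

end

theory Submission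
  imports Defs "HOL-Computational_Algebra.Computational_Algebra"
begin

text \<open>
  Let \<open>n = deg P\<close>. The Cauchy transform of \<open>q dz\<close> along \<open>P\<close>, i.e. the integral of \<open>q / (P - t)\<close> over
  the segment, vanishes for large \<open>t\<close>; by partial fractions this is a linear relation, with
  coefficients algebraic in \<open>t\<close>, between the functions \<open>log ((w - b) / (w - a))\<close> of the branches \<open>w\<close>
  of \<open>P\<^sup>-\<^sup>1\<close>. Its monodromy around \<open>t = P b\<close> gives a relation with integer coefficients between
  the derivatives of the branches of \<open>Q \<circ> P\<^sup>-\<^sup>1\<close>, in which precisely the branches ending in \<open>b\<close>
  have positive coefficients (and likewise for \<open>a\<close>).

  At infinity the branches are permuted cyclically. By a finite Fourier transform, and since
  the powers of a primitive root of unity of prime power order satisfy only the obvious rational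
  relations, either \<open>Q \<circ> P\<^sup>-\<^sup>1\<close> is invariant under the rotation by \<open>n / p\<close> steps, or all integer
  relations have coefficients that are periodic with period \<open>n / p\<close>. In both cases one obtains an
  equivalence relation on the fibres of \<open>P\<close> that is locally constant and not trivial: ``\<open>Q\<close> has the same
  germ'' resp. ``all integer relations have the same coefficient''. The product of the elements of a
  class is a polynomial \<open>W\<close> whose fibres are the classes. In the first case \<open>P\<close> and \<open>Q\<close> are
  polynomials in \<open>W\<close>, and one concludes by induction on the degree. In the second case, the integer
  relations at the endpoints show that \<open>W\<close> is totally ramified both at \<open>a\<close> and at \<open>b\<close>, which is
  impossible.
\<close>

section \<open>Charts of the fibres\<close>

text \<open>Nothing is continued along paths. A relation between germs is stated at the points of a
  single fibre, as the vanishing of all its \<open>t\<close>-derivatives there. In this form it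
  spreads over a connected chart by the identity theorem, and over the plane minus finitely many
  points by connectedness. Monodromy is left only as a change of parameter: a translation by a
  multiple of 2 pi i on the half-plane covering a punctured disc, a multiplication by a root of
  unity near infinity.

  The degree being a prime power matters twice. A vanishing integer combination of powers of a
  primitive \<open>n\<close>-th root of unity has coefficients of period \<open>n / p\<close>, a
  divisor of \<open>n\<close> that does not depend on the relation. And a left factor of
  \<open>P\<close> under composition has again a power of \<open>p\<close> as its degree, so that
  the induction stays inside the hypotheses.

  The final contradiction rests on the fact that a polynomial totally ramified at \<open>c\<close>
  is a constant plus a multiple of a power of \<open>x - c\<close>, so its derivative has no zero
  other than \<open>c\<close>.\<close>

lemma jet_vanishing:
  fixes F :: "nat \<Rightarrow> complex \<Rightarrow> complex"
  assumes C: "open C" "connected C" "x0 \<in> C"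
    and \<tau>: "\<tau> holomorphic_on C"
    and der: "\<And>k x. x \<in> C \<Longrightarrow> (F k has_field_derivative deriv \<tau> x * F (Suc k) x) (at x)"
    and zero: "\<And>k. F k x0 = 0"
    and x: "x \<in> C"
  shows "F k x = 0"
proof -
  have hF: "F k holomorphic_on C" for k
    using der C(1) by (meson holomorphic_on_open)
  have h\<tau>: "deriv \<tau> holomorphic_on C"
    using \<tau> C(1) by (rule holomorphic_deriv)
  \<comment> \<open>Products with an arbitrary holomorphic \<open>h\<close> are needed for the
    induction: differentiating \<open>F k\<close> brings out the factor \<open>deriv \<tau>\<close>,
    which the next derivative meets again.\<close>
  have *: "(deriv ^^ m) (\<lambda>x. h x * F k x) x0 = 0" if "h holomorphic_on C" for m h k
    using that
  proof (induction m arbitrary: h k)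
    case 0
    then show ?case by (simp add: zero)
  next
    case (Suc m)
    have hh: "deriv h holomorphic_on C" using Suc.prems C(1) by (rule holomorphic_deriv)
    have d: "deriv (\<lambda>x. h x * F k x) x = deriv h x * F k x + (h x * deriv \<tau> x) * F (Suc k) x"
      if "x \<in> C" for x
    proof -
      have "(h has_field_derivative deriv h x) (at x)"
        using Suc.prems C(1) that by (meson holomorphic_derivI)
      from DERIV_mult[OF this der[OF that, of k]] show ?thesis
        by (simp add: DERIV_imp_deriv algebra_simps)
    qed
    have "(deriv ^^ Suc m) (\<lambda>x. h x * F k x) x0 = (deriv ^^ m) (deriv (\<lambda>x. h x * F k x)) x0"
      by (simp add: funpow_Suc_right del: funpow.simps)
    also have "\<dots> = (deriv ^^ m) (\<lambda>x. deriv h x * F k x + (h x * deriv \<tau> x) * F (Suc k) x) x0"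
    proof (rule higher_deriv_transform_within_open[where S = C])
      show "deriv (\<lambda>x. h x * F k x) holomorphic_on C"
        by (intro holomorphic_deriv holomorphic_on_mult Suc.prems hF C(1))
    qed (use C d in \<open>auto intro!: holomorphic_intros hF h\<tau> hh Suc.prems\<close>)
    also have "\<dots> = (deriv ^^ m) (\<lambda>x. deriv h x * F k x) x0
        + (deriv ^^ m) (\<lambda>x. (h x * deriv \<tau> x) * F (Suc k) x) x0"
      by (rule higher_deriv_add[where S = C])
         (use C in \<open>auto intro!: holomorphic_intros hF h\<tau> hh Suc.prems\<close>)
    also have "\<dots> = 0"
      using Suc.IH[OF hh, of k] Suc.IH[of "\<lambda>x. h x * deriv \<tau> x" "Suc k"] h\<tau> Suc.prems
      by (auto intro: holomorphic_intros)
    finally show ?case .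
  qed
  have "(deriv ^^ m) (F k) x0 = 0" for m
    using *[of "\<lambda>_. 1" m k] by simp
  then show ?thesis
    using holomorphic_fun_eq_0_on_connected[OF hF C(1,2) _ C(3) x] by blast
qed

locale branched =
  fixes P Q :: "complex poly"
  assumes degP: "degree P > 0"
begin

definition fiber :: "complex \<Rightarrow> complex set" where
  "fiber t = {w. poly P w = t}"

definition regular :: "complex \<Rightarrow> bool" where
  "regular t \<longleftrightarrow> (\<forall>w. poly P w = t \<longrightarrow> poly (pderiv P) w \<noteq> 0)"

text \<open>\<open>dt k\<close> is the \<open>k\<close>-th derivative of \<open>Q\<close> with respect to the variable \<open>t = P w\<close>, as a function of \<open>w\<close>.\<close>

primrec dt :: "nat \<Rightarrow> complex \<Rightarrow> complex" where
  "dt 0 = poly Q"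
| "dt (Suc k) = (\<lambda>w. deriv (dt k) w / poly (pderiv P) w)"

text \<open>\<open>\<tau>\<close> need not be injective, so one notion covers discs in the
  \<open>t\<close>-plane (\<open>\<tau>\<close> the identity), the half-plane mapped to a punctured
  disc by an exponential, and \<open>1 / u ^ n\<close> around infinity. A chart lists the whole
  fibre, which turns sums over varying fibres into sums over the fixed set \<open>J\<close>.\<close>

definition chart ::
  "complex set \<Rightarrow> (complex \<Rightarrow> complex) \<Rightarrow> 'j set \<Rightarrow> ('j \<Rightarrow> complex \<Rightarrow> complex) \<Rightarrow> bool" where
  "chart C \<tau> J g \<longleftrightarrow> open C \<and> connected C \<and> \<tau> holomorphic_on C \<and>
    (\<forall>j\<in>J. g j holomorphic_on C) \<and>
    (\<forall>x\<in>C. regular (\<tau> x) \<and> bij_betw (\<lambda>j. g j x) J (fiber (\<tau> x)))"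

lemma P_nonzero: "P \<noteq> 0"
  using degP by auto

lemma pderiv_P_nonzero: "pderiv P \<noteq> 0"
  using degP by (simp add: pderiv_eq_0_iff)

lemma finite_fiber: "finite (fiber t)"
proof -
  have "fiber t = {w. poly (P - [:t:]) w = 0}" by (auto simp: fiber_def)
  moreover have "P - [:t:] \<noteq> 0" using degP by auto
  ultimately show ?thesis using poly_roots_finite by metis
qed

lemma finite_irregular: "finite {t. \<not> regular t}"
proof -
  have "{t. \<not> regular t} = poly P ` {w. poly (pderiv P) w = 0}"
    by (auto simp: regular_def)
  then show ?thesis using poly_roots_finite[OF pderiv_P_nonzero] by simp
qed

lemma card_fiber_regular:
  assumes "regular t"
  shows "card (fiber t) = degree P"
proof -
  have ne: "P - [:t:] \<noteq> 0" using degP by auto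
  have fib: "fiber t = {w. poly (P - [:t:]) w = 0}" by (auto simp: fiber_def)
  have "rsquarefree (P - [:t:])"
    unfolding rsquarefree_roots using assms
    by (auto simp: regular_def pderiv_diff pderiv_pCons)
  then have "order w (P - [:t:]) = 1" if "w \<in> fiber t" for w
  proof -
    have "order w (P - [:t:]) \<noteq> 0"
      using that ne unfolding fib order_root by simp
    with \<open>rsquarefree (P - [:t:])\<close> show ?thesis unfolding rsquarefree_def by metis
  qed
  then have "(\<Sum>w\<in>fiber t. order w (P - [:t:])) = card (fiber t)" by simp
  moreover have "size (proots (P - [:t:])) = (\<Sum>w\<in>fiber t. order w (P - [:t:]))"
    unfolding size_multiset_overloaded_eq set_count_proots[OF ne] fib
    by (rule sum.cong) (use ne in auto)
  moreover have "degree (P + [:-t:]) = degree P"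
    by (rule degree_add_eq_left) (use degP in simp)
  then have "degree (P - [:t:]) = degree P"
    by (metis diff_conv_add_uminus minus_pCons minus_zero)
  ultimately show ?thesis using size_proots_complex[of "P - [:t:]"] by simp
qed

lemma open_noncritical: "open {w. poly (pderiv P) w \<noteq> 0}"
  by (intro open_Collect_neq continuous_intros)

lemma dt_holomorphic: "dt k holomorphic_on {w. poly (pderiv P) w \<noteq> 0}"
proof (induction k)
  case 0
  show ?case by (auto intro: holomorphic_intros)
next
  case (Suc k)
  then show ?case
    by (auto intro!: holomorphic_intros holomorphic_deriv open_noncritical)
qed

lemma dt_1: "dt (Suc 0) w = poly (pderiv Q) w / poly (pderiv P) w"
  by (simp add: DERIV_imp_deriv poly_DERIV)

lemma chartD:
  assumes "chart C \<tau> J g"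
  shows "open C" "connected C" "\<tau> holomorphic_on C" "\<And>j. j \<in> J \<Longrightarrow> g j holomorphic_on C"
    "\<And>x. x \<in> C \<Longrightarrow> regular (\<tau> x)" "\<And>x. x \<in> C \<Longrightarrow> bij_betw (\<lambda>j. g j x) J (fiber (\<tau> x))"
    "\<And>x j. x \<in> C \<Longrightarrow> j \<in> J \<Longrightarrow> poly P (g j x) = \<tau> x"
    "\<And>x j. x \<in> C \<Longrightarrow> j \<in> J \<Longrightarrow> poly (pderiv P) (g j x) \<noteq> 0"
    "\<And>x. x \<in> C \<Longrightarrow> inj_on (\<lambda>j. g j x) J"
  using assms by (auto simp: chart_def regular_def fiber_def bij_betw_def)

lemma chart_subset:
  assumes "chart C \<tau> J g" "open C'" "connected C'" "C' \<subseteq> C"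
  shows "chart C' \<tau> J g"
  using assms unfolding chart_def by (meson holomorphic_on_subset subsetD)

lemma chart_sum:
  assumes "chart C \<tau> J g" "x \<in> C"
  shows "(\<Sum>v\<in>fiber (\<tau> x). h v) = (\<Sum>j\<in>J. h (g j x))"
  using sum.reindex_bij_betw[OF chartD(6)[OF assms]] by metis

lemma chart_derivative:
  assumes c: "chart C \<tau> J g" and x: "x \<in> C" and j: "j \<in> J"
  shows "(g j has_field_derivative deriv \<tau> x / poly (pderiv P) (g j x)) (at x)"
proof -
  note cD = chartD[OF c]
  have g: "(g j has_field_derivative deriv (g j) x) (at x)"
    using cD(1,4) x j by (meson holomorphic_derivI)
  have "((\<lambda>y. poly P (g j y)) has_field_derivative poly (pderiv P) (g j x) * deriv (g j) x) (at x)"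
    using DERIV_chain2[OF poly_DERIV g] .
  moreover have "((\<lambda>y. poly P (g j y)) has_field_derivative deriv \<tau> x) (at x)"
  proof (rule has_field_derivative_transform_within_open[where f = \<tau> and S = C])
    show "(\<tau> has_field_derivative deriv \<tau> x) (at x)"
      using cD(1,3) x by (meson holomorphic_derivI)
  qed (use cD x j in auto)
  ultimately have "poly (pderiv P) (g j x) * deriv (g j) x = deriv \<tau> x"
    by (rule DERIV_unique)
  then have "deriv (g j) x = deriv \<tau> x / poly (pderiv P) (g j x)"
    using cD(8)[OF x j] by (auto simp: field_simps)
  with g show ?thesis by simp
qed

lemma chart_derivative_compose:
  assumes c: "chart C \<tau> J g" and x: "x \<in> C" and j: "j \<in> J"
    and h: "h holomorphic_on S" "open S" "g j x \<in> S"
  shows "((\<lambda>y. h (g j y)) has_field_derivative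
           deriv \<tau> x * (deriv h (g j x) / poly (pderiv P) (g j x))) (at x)"
proof -
  have "(h has_field_derivative deriv h (g j x)) (at (g j x))"
    using h by (meson holomorphic_derivI)
  from DERIV_chain2[OF this chart_derivative[OF c x j]] show ?thesis by (simp add: mult_ac)
qed

lemma chart_dt_derivative:
  assumes "chart C \<tau> J g" "x \<in> C" "j \<in> J"
  shows "((\<lambda>y. dt k (g j y)) has_field_derivative deriv \<tau> x * dt (Suc k) (g j x)) (at x)"
  using chart_derivative_compose[OF assms dt_holomorphic open_noncritical, of k] chartD(8)[OF assms]
  by simp

text \<open>With constant coefficients \<open>f j\<close>, the sums for the successive orders are
  \<open>t\<close>-derivatives of each other, so their vanishing at one point is a vanishing jet.
  The bound \<open>m\<close> is needed because integer relations hold for derivatives of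
  \<open>Q\<close>, from order 1 on, and not for \<open>Q\<close> itself.\<close>

lemma chart_relation_transport:
  assumes c: "chart C \<tau> J g" and x: "x \<in> C" "y \<in> C"
    and rel: "\<And>k. m \<le> k \<Longrightarrow> (\<Sum>j\<in>J. f j * dt k (g j x)) = 0"
    and k: "m \<le> k"
  shows "(\<Sum>j\<in>J. f j * dt k (g j y)) = 0"
proof -
  define F where "F i y = (\<Sum>j\<in>J. f j * dt (m + i) (g j y))" for i y
  have "F (k - m) y = 0"
  proof (rule jet_vanishing[where F = F and C = C and \<tau> = \<tau> and ?x0.0 = x])
    fix i z assume z: "z \<in> C"
    show "(F i has_field_derivative deriv \<tau> z * F (Suc i) z) (at z)"
      unfolding F_def
      by (auto intro!: derivative_eq_intros chart_dt_derivative[OF c z]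
          simp: sum_distrib_left mult_ac)
  qed (use chartD[OF c] x rel in \<open>auto simp: F_def\<close>)
  then show ?thesis using k by (simp add: F_def)
qed

end

section \<open>Ramified local coordinates on the fibres\<close>

lemma local_inverse_at_simple_zero:
  fixes \<phi> :: "complex \<Rightarrow> complex"
  assumes h: "\<phi> holomorphic_on S" "open S" "z \<in> S" and z: "\<phi> z = 0" "deriv \<phi> z \<noteq> 0"
    and \<delta>: "0 < \<delta>"
  obtains r \<psi> where "0 < r" "\<psi> holomorphic_on ball 0 r" "inj_on \<psi> (ball 0 r)" "\<psi> 0 = z"
    "\<And>s. s \<in> ball 0 r \<Longrightarrow> \<psi> s \<in> S \<and> \<psi> s \<in> ball z \<delta> \<and> \<phi> (\<psi> s) = s"
proof -
  obtain r0 where r0: "r0 > 0" "ball z r0 \<subseteq> S" "inj_on \<phi> (ball z r0)"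
    using has_complex_derivative_locally_invertible[OF h(1) h(3) h(2) z(2)] by metis
  define B where "B = ball z (min r0 \<delta>)"
  have sub: "B \<subseteq> ball z r0" "B \<subseteq> ball z \<delta>" by (auto simp: B_def)
  with r0 have "B \<subseteq> S" by blast
  with sub have B: "open B" "z \<in> B" "B \<subseteq> S" "inj_on \<phi> B" "\<phi> holomorphic_on B" "B \<subseteq> ball z \<delta>"
    using r0 \<delta> holomorphic_on_subset[OF h(1)] inj_on_subset[OF r0(3)]
    by (auto simp: B_def)
  obtain \<psi> where \<psi>: "\<psi> holomorphic_on \<phi> ` B" "\<And>w. w \<in> B \<Longrightarrow> \<psi> (\<phi> w) = w"
    using holomorphic_has_inverse[OF B(5,1,4)] by metis
  have "open (\<phi> ` B)" using open_mapping_thm3[OF B(5,1,4)] .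
  moreover have "0 \<in> \<phi> ` B" using B(2) z(1) by (metis imageI)
  ultimately obtain r where r: "r > 0" "ball 0 r \<subseteq> \<phi> ` B"
    by (meson open_contains_ball)
  have *: "\<psi> s \<in> B \<and> \<phi> (\<psi> s) = s" if "s \<in> ball 0 r" for s
    using r(2) that \<psi>(2) by auto
  show ?thesis
  proof (rule that[OF r(1)])
    show "\<psi> holomorphic_on ball 0 r" using \<psi>(1) r(2) holomorphic_on_subset by blast
    show "inj_on \<psi> (ball 0 r)" using * by (metis inj_onI)
    show "\<psi> 0 = z" using \<psi>(2)[OF B(2)] z(1) by simp
  qed (use * B(3,6) in blast)
qed

context branched
begin

text \<open>Near \<open>z\<close>, the difference \<open>P - poly P z\<close> is the
  \<open>d\<close>-th power of a function with a simple zero at \<open>z\<close>; the local inverse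
  of that function is \<open>\<psi>\<close>. Thus \<open>d\<close> is the ramification index of
  \<open>P\<close> at \<open>z\<close>.\<close>

lemma local_coordinate:
  assumes \<delta>: "0 < \<delta>"
  obtains d r \<psi> where "0 < d" "0 < r" "\<psi> holomorphic_on ball 0 r" "inj_on \<psi> (ball 0 r)" "\<psi> 0 = z"
    "\<And>s. s \<in> ball 0 r \<Longrightarrow> \<psi> s \<in> ball z \<delta> \<and> poly P (\<psi> s) = poly P z + s ^ d"
    "poly (pderiv P) z \<noteq> 0 \<Longrightarrow> d = 1"
proof -
  have hP: "poly P holomorphic_on UNIV" by (intro holomorphic_intros)
  have ex: "\<exists>n. 0 < n \<and> (deriv ^^ n) (poly P) z \<noteq> 0"
  proof (rule ccontr)
    assume "\<not> ?thesis"
    then have "\<And>n. 0 < n \<Longrightarrow> (deriv ^^ n) (poly P) z = 0" by blast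
    then have "poly P w = poly P z" for w
      by (rule holomorphic_fun_eq_const_on_connected[OF hP open_UNIV connected_UNIV]) auto
    then have "fiber (poly P z) = UNIV" by (auto simp: fiber_def)
    then show False using finite_fiber infinite_UNIV_char_0 by metis
  qed
  define d where "d = (LEAST n. 0 < n \<and> (deriv ^^ n) (poly P) z \<noteq> 0)"
  have d: "0 < d" "(deriv ^^ d) (poly P) z \<noteq> 0"
    using LeastI_ex[OF ex] by (auto simp: d_def)
  have dmin: "(deriv ^^ i) (poly P) z = 0" if "0 < i" "i < d" for i
    using not_less_Least[of i "\<lambda>n. 0 < n \<and> (deriv ^^ n) (poly P) z \<noteq> 0"] that by (auto simp: d_def)
  obtain g r0 where g: "0 < r0" "g holomorphic_on ball z r0"
      "\<And>w. w \<in> ball z r0 \<Longrightarrow> poly P w - poly P z = ((w - z) * g w) ^ d"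
      "\<And>w. w \<in> ball z r0 \<Longrightarrow> g w \<noteq> 0"
    using holomorphic_factor_order_of_zero_strong[OF hP open_UNIV UNIV_I d dmin] by metis
  define \<phi> where "\<phi> w = (w - z) * g w" for w
  have h\<phi>: "\<phi> holomorphic_on ball z r0"
    unfolding \<phi>_def by (intro holomorphic_intros g(2))
  have "(g has_field_derivative deriv g z) (at z)"
    using g(1,2) by (meson centre_in_ball holomorphic_derivI open_ball)
  then have "(\<phi> has_field_derivative g z) (at z)"
    unfolding \<phi>_def by (auto intro!: derivative_eq_intros)
  then have "deriv \<phi> z \<noteq> 0" using g(1,4) by (simp add: DERIV_imp_deriv)
  moreover have "z \<in> ball z r0" "\<phi> z = 0" using g(1) by (auto simp: \<phi>_def)
  ultimately obtain r \<psi> where \<psi>: "0 < r" "\<psi> holomorphic_on ball 0 r" "inj_on \<psi> (ball 0 r)" "\<psi> 0 = z"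
    "\<And>s. s \<in> ball 0 r \<Longrightarrow> \<psi> s \<in> ball z r0 \<and> \<psi> s \<in> ball z \<delta> \<and> \<phi> (\<psi> s) = s"
    using local_inverse_at_simple_zero[OF h\<phi> open_ball _ _ _ \<delta>] by metis
  show ?thesis
  proof (rule that[OF d(1) \<psi>(1-4)])
    show "\<psi> s \<in> ball z \<delta> \<and> poly P (\<psi> s) = poly P z + s ^ d" if "s \<in> ball 0 r" for s
      using \<psi>(5)[OF that] g(3)[of "\<psi> s"] by (auto simp: \<phi>_def algebra_simps)
    show "d = 1" if "poly (pderiv P) z \<noteq> 0"
      using dmin[of 1] that d(1) by (cases "1 < d") (auto simp: DERIV_imp_deriv[OF poly_DERIV])
  qed
qed

text \<open>Each linear factor of \<open>P - [:t0:]\<close> has modulus at least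
  \<open>\<eta>\<close> at a point that is \<open>\<eta>\<close>-far from the fibre, which bounds
  the product from below by the \<open>\<epsilon>\<close> of the proof.\<close>

lemma near_fiber_if_norm_poly_small:
  assumes \<eta>: "0 < \<eta>"
  obtains \<epsilon> where "0 < \<epsilon>" "\<And>w. norm (poly P w - t0) < \<epsilon> \<Longrightarrow> \<exists>z\<in>fiber t0. norm (w - z) < \<eta>"
proof -
  have ne: "P - [:t0:] \<noteq> 0" using degP by auto
  define R where "R = P - [:t0:]"
  have fac: "R = smult (lead_coeff R) (\<Prod>x\<in>#proots R. [:-x, 1:])"
    using complex_poly_decompose_multiset[of R] by simp
  have lc: "lead_coeff R \<noteq> 0" using ne unfolding R_def by (metis leading_coeff_0_iff)
  define \<epsilon> where "\<epsilon> = norm (lead_coeff R) * \<eta> ^ size (proots R)"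
  have "norm (poly R w) \<ge> \<epsilon>" if w: "\<And>z. z \<in> fiber t0 \<Longrightarrow> \<eta> \<le> norm (w - z)" for w
  proof -
    have *: "norm (\<Prod>x\<in>#M. (w - x)) \<ge> \<eta> ^ size M" if "set_mset M \<subseteq> fiber t0" for M
      using that
    proof (induction M)
      case (add x M)
      then show ?case using w[of x] \<eta> by (auto simp: norm_mult intro!: mult_mono)
    qed auto
    have "set_mset (proots R) \<subseteq> fiber t0"
      using ne by (auto simp: R_def fiber_def)
    from *[OF this] lc have "\<epsilon> \<le> norm (lead_coeff R) * norm (\<Prod>x\<in>#proots R. (w - x))"
      unfolding \<epsilon>_def by (intro mult_left_mono) auto
    also have "\<dots> = norm (poly R w)"
      by (subst (3) fac) (simp add: norm_mult poly_prod_mset image_mset.compositionality o_def)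
    finally show ?thesis .
  qed
  then show ?thesis
    using that[of \<epsilon>] lc \<eta> by (force simp: \<epsilon>_def R_def not_less)
qed

end

section \<open>Local coordinates and ball charts\<close>

lemma root_of_exp:
  fixes s \<zeta> :: complex
  assumes d: "0 < d" and s: "s ^ d = exp \<zeta>"
  obtains k where "k < d" "s = exp ((\<zeta> + 2 * of_real pi * \<i> * of_nat k) / of_nat d)"
proof -
  have "s \<noteq> 0" using s d by (metis exp_not_eq_zero power_0_left less_numeral_extra(3))
  then obtain l where l: "s = exp l" by (metis exp_Ln)
  have "exp (of_nat d * l) = exp \<zeta>" using s l by (simp add: exp_of_nat_mult)
  then obtain m :: int where m: "of_nat d * l = \<zeta> + of_int (2 * m) * pi * \<i>"
    unfolding exp_eq by auto
  define k where "k = nat (m mod int d)"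
  have k: "k < d" "int k = m mod int d" using d by (auto simp: k_def nat_less_iff)
  have "m = int k + int d * (m div int d)" using k by simp
  then have "of_int m = (of_nat k :: complex) + of_nat d * of_int (m div int d)"
    by (metis of_int_add of_int_mult of_int_of_nat_eq)
  then have "l = (\<zeta> + 2 * of_real pi * \<i> * of_nat k) / of_nat d + of_int (2 * (m div int d)) * pi * \<i>"
    using m d by (simp add: field_simps)
  then have "s = exp ((\<zeta> + 2 * of_real pi * \<i> * of_nat k) / of_nat d)"
    unfolding l exp_eq by blast
  with k(1) show ?thesis using that by blast
qed

lemma inj_roots_of_exp:
  fixes \<zeta> :: complex
  shows "inj_on (\<lambda>k. exp ((\<zeta> + 2 * of_real pi * \<i> * of_nat k) / of_nat d)) {..<d}"
proof (rule inj_onI)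
  fix k l assume kl: "k \<in> {..<d}" "l \<in> {..<d}"
    "exp ((\<zeta> + 2 * of_real pi * \<i> * of_nat k) / of_nat d) = exp ((\<zeta> + 2 * of_real pi * \<i> * of_nat l) / of_nat d)"
  then have d: "d > 0" by auto
  obtain m :: int where "(\<zeta> + 2 * of_real pi * \<i> * of_nat k) / of_nat d
      = (\<zeta> + 2 * of_real pi * \<i> * of_nat l) / of_nat d + of_int (2 * m) * pi * \<i>"
    using kl(3) unfolding exp_eq by auto
  then have "2 * pi * \<i> * (of_nat k - of_nat l - of_nat d * of_int m) = 0"
    using d by (simp add: field_simps)
  then have "of_nat k - of_nat l - of_nat d * of_int m = (0 :: complex)"
    by (metis complex_i_not_zero mult_eq_0_iff of_real_eq_0_iff pi_neq_zero zero_neq_numeral)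
  then have "of_int (int k) = (of_int (int l + int d * m) :: complex)" by (simp add: algebra_simps)
  then have "int k = int l + int d * m" using of_int_eq_iff by blast
  then have "int k mod int d = int l mod int d" by simp
  then show "k = l" using kl by simp
qed

context branched
begin

text \<open>Simultaneous coordinates at all points of one fibre, with ramification indices
  \<open>d\<close>. Three radii interact: \<open>\<rho>\<close> bounds the coordinate
  \<open>s\<close>, \<open>\<delta>\<close> bounds the images in the plane, and
  \<open>\<epsilon>\<close> bounds \<open>t - t0\<close> such that all \<open>d z\<close>-th roots
  of \<open>t - t0\<close> lie in the coordinate disc and the pairwise disjoint images contain the
  whole fibre over \<open>t\<close>.\<close>

definition coordinates_near ::
  "complex \<Rightarrow> real \<Rightarrow> real \<Rightarrow> real \<Rightarrow> (complex \<Rightarrow> nat) \<Rightarrow> (complex \<Rightarrow> complex \<Rightarrow> complex) \<Rightarrow> bool" where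
  "coordinates_near t0 \<delta> \<rho> \<epsilon> d \<psi> \<longleftrightarrow> 0 < \<rho> \<and> 0 < \<epsilon> \<and>
    (\<forall>z\<in>fiber t0. 0 < d z \<and> \<psi> z holomorphic_on ball 0 \<rho> \<and> inj_on (\<psi> z) (ball 0 \<rho>) \<and> \<psi> z 0 = z \<and>
       (poly (pderiv P) z \<noteq> 0 \<longrightarrow> d z = 1) \<and>
       (\<forall>s\<in>ball 0 \<rho>. \<psi> z s \<in> ball z \<delta> \<and> poly P (\<psi> z s) = t0 + s ^ d z) \<and>
       (\<forall>s::complex. norm s ^ d z < \<epsilon> \<longrightarrow> s \<in> ball 0 \<rho>) \<and>
       (\<forall>z'\<in>fiber t0. \<forall>s\<in>ball 0 \<rho>. \<forall>s'\<in>ball 0 \<rho>. \<psi> z s = \<psi> z' s' \<longrightarrow> z = z')) \<and>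
    (\<forall>w. norm (poly P w - t0) < \<epsilon> \<longrightarrow> (\<exists>z\<in>fiber t0. \<exists>s\<in>ball 0 \<rho>. w = \<psi> z s))"

lemma coordinates_nearD:
  assumes "coordinates_near t0 \<delta> \<rho> \<epsilon> d \<psi>"
  shows "0 < \<rho>" "0 < \<epsilon>"
    "\<And>z. z \<in> fiber t0 \<Longrightarrow> 0 < d z"
    "\<And>z. z \<in> fiber t0 \<Longrightarrow> \<psi> z holomorphic_on ball 0 \<rho>"
    "\<And>z. z \<in> fiber t0 \<Longrightarrow> inj_on (\<psi> z) (ball 0 \<rho>)"
    "\<And>z. z \<in> fiber t0 \<Longrightarrow> \<psi> z 0 = z"
    "\<And>z. z \<in> fiber t0 \<Longrightarrow> poly (pderiv P) z \<noteq> 0 \<Longrightarrow> d z = 1"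
    "\<And>z s. z \<in> fiber t0 \<Longrightarrow> s \<in> ball 0 \<rho> \<Longrightarrow> \<psi> z s \<in> ball z \<delta>"
    "\<And>z s. z \<in> fiber t0 \<Longrightarrow> s \<in> ball 0 \<rho> \<Longrightarrow> poly P (\<psi> z s) = t0 + s ^ d z"
    "\<And>z s. z \<in> fiber t0 \<Longrightarrow> norm (s::complex) ^ d z < \<epsilon> \<Longrightarrow> s \<in> ball 0 \<rho>"
    "\<And>z z' s s'. z \<in> fiber t0 \<Longrightarrow> z' \<in> fiber t0 \<Longrightarrow> s \<in> ball 0 \<rho> \<Longrightarrow> s' \<in> ball 0 \<rho> \<Longrightarrow>
       \<psi> z s = \<psi> z' s' \<Longrightarrow> z = z'"
    "\<And>w. norm (poly P w - t0) < \<epsilon> \<Longrightarrow> \<exists>z\<in>fiber t0. \<exists>s\<in>ball 0 \<rho>. w = \<psi> z s"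
  using assms unfolding coordinates_near_def by blast+

lemma coordinates_near_exist:
  assumes \<delta>: "0 < \<delta>"
  obtains \<rho> \<epsilon> d \<psi> where "coordinates_near t0 \<delta> \<rho> \<epsilon> d \<psi>"
proof -
  obtain \<delta>' where \<delta>': "0 < \<delta>'" "\<delta>' \<le> \<delta>"
    and sep: "\<And>z z' w. z \<in> fiber t0 \<Longrightarrow> z' \<in> fiber t0 \<Longrightarrow> w \<in> ball z \<delta>' \<Longrightarrow> w \<in> ball z' \<delta>' \<Longrightarrow> z = z'"
  proof -
    obtain e where e: "e > 0" "\<And>z z'. z \<in> fiber t0 \<Longrightarrow> z' \<in> fiber t0 \<Longrightarrow> z \<noteq> z' \<Longrightarrow> e \<le> dist z z'"
    proof -
      have "\<exists>e>0. \<forall>z'\<in>fiber t0. z' \<noteq> z \<longrightarrow> e \<le> dist z z'" for z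
        using finite_set_avoid[OF finite_fiber] by blast
      then obtain E where E: "\<And>z. E z > 0" "\<And>z z'. z' \<in> fiber t0 \<Longrightarrow> z' \<noteq> z \<Longrightarrow> E z \<le> dist z z'"
        by metis
      define e where "e = Min (insert 1 (E ` fiber t0))"
      have "e > 0" unfolding e_def using finite_fiber E(1) by (subst Min_gr_iff) auto
      moreover have "e \<le> E z" if "z \<in> fiber t0" for z
        unfolding e_def using finite_fiber that by (intro Min_le) auto
      ultimately show ?thesis using E(2) that by (metis order_trans)
    qed
    show ?thesis
    proof (rule that[of "min \<delta> (e / 2)"])
      fix z z' w assume "z \<in> fiber t0" "z' \<in> fiber t0" "w \<in> ball z (min \<delta> (e / 2))" "w \<in> ball z' (min \<delta> (e / 2))"
      then show "z = z'"
        using e(2)[of z z'] dist_triangle3[of z z' w] by (fastforce simp: dist_commute)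
    qed (use e \<delta> in auto)
  qed
  define coord where "coord z d r \<psi> \<longleftrightarrow> 0 < (d :: nat) \<and> 0 < (r :: real) \<and>
    \<psi> holomorphic_on ball 0 r \<and> inj_on \<psi> (ball 0 r) \<and> \<psi> 0 = z \<and>
    (\<forall>s\<in>ball 0 r. \<psi> s \<in> ball z \<delta>' \<and> poly P (\<psi> s) = poly P z + s ^ d) \<and>
    (poly (pderiv P) z \<noteq> 0 \<longrightarrow> d = 1)" for z d r \<psi>
  have "\<exists>d r \<psi>. coord z d r \<psi>" for z
    unfolding coord_def by (rule local_coordinate[OF \<delta>'(1), of z]) blast
  then obtain d r \<psi> where co: "\<And>z. coord z (d z) (r z) (\<psi> z)" by metis
  then have L: "\<And>z. 0 < d z" "\<And>z. 0 < r z"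
    "\<And>z. \<psi> z holomorphic_on ball 0 (r z)" "\<And>z. inj_on (\<psi> z) (ball 0 (r z))" "\<And>z. \<psi> z 0 = z"
    "\<And>z s. s \<in> ball 0 (r z) \<Longrightarrow> \<psi> z s \<in> ball z \<delta>' \<and> poly P (\<psi> z s) = poly P z + s ^ d z"
    "\<And>z. poly (pderiv P) z \<noteq> 0 \<Longrightarrow> d z = 1"
    unfolding coord_def by simp_all
  define \<rho> where "\<rho> = Min (insert 1 (r ` fiber t0))"
  have \<rho>: "0 < \<rho>" "\<rho> \<le> 1"
    unfolding \<rho>_def using finite_fiber L(2) by (subst Min_gr_iff, auto)
  have \<rho>r: "\<rho> \<le> r z" if "z \<in> fiber t0" for z
    unfolding \<rho>_def using finite_fiber that by (intro Min_le) auto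
  have sub: "ball 0 \<rho> \<subseteq> ball 0 (r z)" if "z \<in> fiber t0" for z
    using \<rho>r[OF that] by auto
  have hol: "\<psi> z holomorphic_on ball 0 \<rho>" and inj: "inj_on (\<psi> z) (ball 0 \<rho>)" if "z \<in> fiber t0" for z
    using L(3,4) sub[OF that] holomorphic_on_subset inj_on_subset by blast+
  have "\<exists>\<eta>>0. ball z \<eta> \<subseteq> \<psi> z ` ball 0 \<rho>" if "z \<in> fiber t0" for z
  proof -
    have "open (\<psi> z ` ball 0 \<rho>)"
      by (rule open_mapping_thm3[OF hol[OF that] open_ball inj[OF that]])
    moreover have "z \<in> \<psi> z ` ball 0 \<rho>"
      using L(5)[of z] \<rho>(1) by (metis centre_in_ball imageI)
    ultimately show ?thesis by (meson open_contains_ball)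
  qed
  then obtain H where H: "\<And>z. z \<in> fiber t0 \<Longrightarrow> H z > 0 \<and> ball z (H z) \<subseteq> \<psi> z ` ball 0 \<rho>" by metis
  define \<eta> where "\<eta> = Min (insert 1 (H ` fiber t0))"
  have \<eta>: "0 < \<eta>" unfolding \<eta>_def using finite_fiber H by (subst Min_gr_iff) auto
  have \<eta>H: "\<eta> \<le> H z" if "z \<in> fiber t0" for z
    unfolding \<eta>_def using finite_fiber that by (intro Min_le) auto
  obtain \<epsilon>0 where \<epsilon>0: "0 < \<epsilon>0" "\<And>w. norm (poly P w - t0) < \<epsilon>0 \<Longrightarrow> \<exists>z\<in>fiber t0. norm (w - z) < \<eta>"
    using near_fiber_if_norm_poly_small[OF \<eta>] by metis
  \<comment> \<open>\<open>D\<close> dominates every ramification index and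
    \<open>\<rho> \<le> 1\<close>, so \<open>\<rho> ^ D\<close> is at most
    \<open>\<rho> ^ d z\<close> for all \<open>z\<close> in the fibre at once. The bound
    \<open>\<rho> \<le> 1\<close> is why 1 was inserted into the minimum.\<close>
  define D where "D = (\<Sum>z\<in>fiber t0. d z)"
  have dD: "d z \<le> D" if "z \<in> fiber t0" for z
    unfolding D_def using finite_fiber that by (intro member_le_sum) auto
  define \<epsilon> where "\<epsilon> = min \<epsilon>0 (\<rho> ^ D)"
  have small: "s \<in> ball 0 \<rho>" if "z \<in> fiber t0" "norm s ^ d z < \<epsilon>" for z and s :: complex
  proof -
    have "norm s ^ d z < \<rho> ^ d z"
      using that(2) power_decreasing[OF dD[OF that(1)], of \<rho>] \<rho> by (simp add: \<epsilon>_def)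
    then have "norm s < \<rho>" using \<rho>(1) power_less_imp_less_base by fastforce
    then show ?thesis by simp
  qed
  have cover: "\<exists>z\<in>fiber t0. \<exists>s\<in>ball 0 \<rho>. w = \<psi> z s" if w: "norm (poly P w - t0) < \<epsilon>" for w
  proof -
    obtain z where z: "z \<in> fiber t0" "norm (w - z) < \<eta>"
      using \<epsilon>0(2)[of w] w by (auto simp: \<epsilon>_def)
    then have "w \<in> ball z (H z)" using \<eta>H[of z] by (simp add: dist_norm norm_minus_commute)
    then show ?thesis using H[OF z(1)] z(1) by blast
  qed
  have "coordinates_near t0 \<delta> \<rho> \<epsilon> d \<psi>"
    unfolding coordinates_near_def
  proof (intro conjI ballI allI impI)
    fix z assume z: "z \<in> fiber t0"
    show "0 < d z" "\<psi> z 0 = z" using L by auto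
    show "d z = 1" if "poly (pderiv P) z \<noteq> 0" using that L(7) by blast
    show "\<psi> z s \<in> ball z \<delta>" "poly P (\<psi> z s) = t0 + s ^ d z" if "s \<in> ball 0 \<rho>" for s
    proof -
      have "s \<in> ball 0 (r z)" using sub[OF z] that by blast
      from L(6)[OF this] show "\<psi> z s \<in> ball z \<delta>" "poly P (\<psi> z s) = t0 + s ^ d z"
        using z \<delta>'(2) by (auto simp: fiber_def)
    qed
    show "z = z'" if "z' \<in> fiber t0" "s \<in> ball 0 \<rho>" "s' \<in> ball 0 \<rho>" "\<psi> z s = \<psi> z' s'" for z' s s'
    proof -
      have "s \<in> ball 0 (r z)" "s' \<in> ball 0 (r z')" using sub z that by blast+
      then have "\<psi> z s \<in> ball z \<delta>'" "\<psi> z s \<in> ball z' \<delta>'" using L(6) that(4) by metis+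
      then show ?thesis using sep[OF z that(1)] by blast
    qed
  qed (use \<rho> \<epsilon>0 hol inj small cover in \<open>auto simp: \<epsilon>_def\<close>)
  then show ?thesis using that by blast
qed

lemma coordinates_noncritical:
  assumes c: "coordinates_near t0 \<delta> \<rho> \<epsilon> d \<psi>" and z: "z \<in> fiber t0" and s: "s \<in> ball 0 \<rho>"
    and ne: "s \<noteq> 0 \<or> d z = 1"
  shows "poly (pderiv P) (\<psi> z s) \<noteq> 0"
proof
  assume 0: "poly (pderiv P) (\<psi> z s) = 0"
  note cD = coordinates_nearD[OF c]
  have "(\<psi> z has_field_derivative deriv (\<psi> z) s) (at s)"
    using cD(4)[OF z] s by (meson holomorphic_derivI open_ball)
  from DERIV_chain2[OF poly_DERIV[of P] this]
  have "((\<lambda>s. poly P (\<psi> z s)) has_field_derivative 0) (at s)" using 0 by simp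
  moreover have "((\<lambda>s. poly P (\<psi> z s)) has_field_derivative of_nat (d z) * s ^ (d z - 1)) (at s)"
  proof (rule has_field_derivative_transform_within_open[where S = "ball 0 \<rho>"])
    show "((\<lambda>s. t0 + s ^ d z) has_field_derivative of_nat (d z) * s ^ (d z - 1)) (at s)"
      by (auto intro!: derivative_eq_intros)
  qed (use s cD(9)[OF z] in auto)
  ultimately have "of_nat (d z) * s ^ (d z - 1) = 0" by (rule DERIV_unique[symmetric])
  then show False using cD(3)[OF z] ne by auto
qed

text \<open>Over a regular value all ramification indices are 1, hence \<open>t - t0\<close> itself
  is the coordinate at every point of the fibre, and the fibre can serve as its own index
  set.\<close>

lemma ball_chart:
  assumes t0: "regular t0"
  obtains \<epsilon> g where "0 < \<epsilon>" "chart (ball t0 \<epsilon>) (\<lambda>t. t) (fiber t0) g" "\<And>z. z \<in> fiber t0 \<Longrightarrow> g z t0 = z"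
proof -
  obtain \<rho> \<epsilon> d \<psi> where c: "coordinates_near t0 1 \<rho> \<epsilon> d \<psi>"
    using coordinates_near_exist[OF zero_less_one] by metis
  note cD = coordinates_nearD[OF c]
  have d1: "d z = 1" if "z \<in> fiber t0" for z
    using cD(7)[OF that] t0 that by (auto simp: regular_def fiber_def)
  define g where "g z t = \<psi> z (t - t0)" for z t
  have sm: "t - t0 \<in> ball 0 \<rho>" if "t \<in> ball t0 \<epsilon>" "z \<in> fiber t0" for t z
    using cD(10)[OF that(2), of "t - t0"] that d1[OF that(2)] by (simp add: dist_norm norm_minus_commute)
  have mem: "w \<in> fiber t \<longleftrightarrow> (\<exists>z\<in>fiber t0. w = g z t)" if t: "t \<in> ball t0 \<epsilon>" for w t
  proof
    assume w: "w \<in> fiber t"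
    then have "norm (poly P w - t0) < \<epsilon>" using t by (simp add: fiber_def dist_norm norm_minus_commute)
    then obtain z s where zs: "z \<in> fiber t0" "s \<in> ball 0 \<rho>" "w = \<psi> z s" using cD(12) by blast
    then have "t = t0 + s" using cD(9)[OF zs(1,2)] d1 w by (simp add: fiber_def)
    then show "\<exists>z\<in>fiber t0. w = g z t" using zs by (auto simp: g_def)
  next
    assume "\<exists>z\<in>fiber t0. w = g z t"
    then show "w \<in> fiber t" using cD(9) sm[OF t] d1 by (auto simp: g_def fiber_def)
  qed
  have "chart (ball t0 \<epsilon>) (\<lambda>t. t) (fiber t0) g"
    unfolding chart_def
  proof (intro conjI ballI)
    show "g z holomorphic_on ball t0 \<epsilon>" if "z \<in> fiber t0" for z
      unfolding g_def
      by (rule holomorphic_on_compose_gen[where g = "\<psi> z" and t = "ball 0 \<rho>", unfolded o_def])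
         (use cD(4) sm that in \<open>auto intro!: holomorphic_intros\<close>)
    fix t assume t: "t \<in> ball t0 \<epsilon>"
    show "regular t"
      unfolding regular_def
    proof (intro allI impI)
      fix w assume "poly P w = t"
      then obtain z where "z \<in> fiber t0" "w = g z t" using mem[OF t, of w] by (auto simp: fiber_def)
      then show "poly (pderiv P) w \<noteq> 0"
        using coordinates_noncritical[OF c, of z "t - t0"] sm[OF t] d1 by (auto simp: g_def)
    qed
    show "bij_betw (\<lambda>z. g z t) (fiber t0) (fiber t)"
    proof -
      have "inj_on (\<lambda>z. g z t) (fiber t0)"
      proof (rule inj_onI)
        fix x y assume "x \<in> fiber t0" "y \<in> fiber t0" "g x t = g y t"
        then show "x = y" using cD(11)[of x y "t - t0" "t - t0"] sm[OF t] by (simp add: g_def)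
      qed
      then show ?thesis unfolding bij_betw_def using mem[OF t] by blast
    qed
  qed auto
  then show ?thesis using that cD(2,6) by (auto simp: g_def)
qed

text \<open>The half-plane is the universal covering of the punctured disc around \<open>t0\<close>.
  On it all the roots of \<open>t - t0\<close> become single-valued, even over a critical value; the
  index \<open>(z, k)\<close> stands for the \<open>k\<close>-th of the \<open>d z\<close> branches
  that end in \<open>z\<close>.\<close>

lemma halfplane_chart:
  assumes c: "coordinates_near t0 \<delta> \<rho> \<epsilon> d \<psi>"
  shows "chart {\<zeta>. Re \<zeta> < ln \<epsilon>} (\<lambda>\<zeta>. t0 + exp \<zeta>) (SIGMA z:fiber t0. {..<d z})
    (\<lambda>(z, k) \<zeta>. \<psi> z (exp ((\<zeta> + 2 * of_real pi * \<i> * of_nat k) / of_nat (d z))))"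
    (is "chart ?C ?\<tau> ?J ?g")
proof -
  note cD = coordinates_nearD[OF c]
  have pw: "exp ((\<zeta> + 2 * of_real pi * \<i> * of_nat k) / of_nat (d z)) ^ d z = exp \<zeta>"
    if "z \<in> fiber t0" for z k \<zeta>
  proof -
    have "exp ((\<zeta> + 2 * of_real pi * \<i> * of_nat k) / of_nat (d z)) ^ d z
        = exp (\<zeta> + 2 * of_real pi * \<i> * of_nat k)"
      using cD(3)[OF that] by (simp flip: exp_of_nat_mult)
    also have "\<dots> = exp \<zeta>" unfolding exp_eq by (rule exI[of _ "int k"]) simp
    finally show ?thesis .
  qed
  have sm: "exp ((\<zeta> + 2 * of_real pi * \<i> * of_nat k) / of_nat (d z)) \<in> ball 0 \<rho>"
    if "\<zeta> \<in> ?C" "z \<in> fiber t0" for \<zeta> z k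
  proof (rule cD(10)[OF that(2)])
    have "norm (exp \<zeta>) < \<epsilon>" using that(1) cD(2) by (simp add: norm_exp_eq_Re) (metis exp_less_mono exp_ln)
    then show "norm (exp ((\<zeta> + 2 * of_real pi * \<i> * of_nat k) / of_nat (d z))) ^ d z < \<epsilon>"
      unfolding norm_power[symmetric] pw[OF that(2)] .
  qed
  have mem: "w \<in> fiber (?\<tau> \<zeta>) \<longleftrightarrow> (\<exists>j\<in>?J. w = ?g j \<zeta>)" if \<zeta>: "\<zeta> \<in> ?C" for w \<zeta>
  proof
    assume w: "w \<in> fiber (?\<tau> \<zeta>)"
    have "norm (exp \<zeta>) < \<epsilon>" using \<zeta> cD(2) by (simp add: norm_exp_eq_Re) (metis exp_less_mono exp_ln)
    then have "norm (poly P w - t0) < \<epsilon>" using w by (simp add: fiber_def)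
    then obtain z s where zs: "z \<in> fiber t0" "s \<in> ball 0 \<rho>" "w = \<psi> z s" using cD(12) by blast
    then have "s ^ d z = exp \<zeta>" using cD(9)[OF zs(1,2)] w by (simp add: fiber_def)
    then obtain k where "k < d z" "s = exp ((\<zeta> + 2 * of_real pi * \<i> * of_nat k) / of_nat (d z))"
      using root_of_exp cD(3)[OF zs(1)] by blast
    then show "\<exists>j\<in>?J. w = ?g j \<zeta>" using zs by (intro bexI[of _ "(z, k)"]) auto
  next
    assume "\<exists>j\<in>?J. w = ?g j \<zeta>"
    then show "w \<in> fiber (?\<tau> \<zeta>)" using cD(9) sm[OF \<zeta>] pw by (auto simp: fiber_def)
  qed
  show ?thesis
    unfolding chart_def
  proof (intro conjI ballI)
    show "open ?C" by (rule open_halfspace_Re_lt)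
    show "connected ?C" by (intro convex_connected convex_halfspace_Re_lt)
    show "?\<tau> holomorphic_on ?C" by (intro holomorphic_intros)
    show "?g j holomorphic_on ?C" if "j \<in> ?J" for j
    proof -
      obtain z k where j: "j = (z, k)" "z \<in> fiber t0" "k < d z" using \<open>j \<in> ?J\<close> by auto
      have "(\<lambda>\<zeta>. \<psi> z (exp ((\<zeta> + 2 * of_real pi * \<i> * of_nat k) / of_nat (d z)))) holomorphic_on ?C"
        by (rule holomorphic_on_compose_gen[where g = "\<psi> z" and t = "ball 0 \<rho>", unfolded o_def])
           (use cD(4) sm j cD(3)[OF j(2)] in \<open>auto intro!: holomorphic_intros\<close>)
      then show ?thesis by (simp add: j)
    qed
    fix \<zeta> assume \<zeta>: "\<zeta> \<in> ?C"
    show "regular (?\<tau> \<zeta>)"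
      unfolding regular_def
    proof (intro allI impI)
      fix w assume "poly P w = ?\<tau> \<zeta>"
      then obtain z k where "z \<in> fiber t0" "w = ?g (z, k) \<zeta>"
        using mem[OF \<zeta>, of w] by (auto simp: fiber_def)
      then show "poly (pderiv P) w \<noteq> 0"
        using coordinates_noncritical[OF c, of z "exp ((\<zeta> + 2 * of_real pi * \<i> * of_nat k) / of_nat (d z))"]
          sm[OF \<zeta>] by auto
    qed
    have "inj_on (\<lambda>j. ?g j \<zeta>) ?J"
    proof (rule inj_onI)
      fix i j assume ij: "i \<in> ?J" "j \<in> ?J" "?g i \<zeta> = ?g j \<zeta>"
      obtain z k z' k' where e: "i = (z, k)" "j = (z', k')" by (metis prod.exhaust)
      let ?s = "exp ((\<zeta> + 2 * of_real pi * \<i> * of_nat k) / of_nat (d z))"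
      let ?s' = "exp ((\<zeta> + 2 * of_real pi * \<i> * of_nat k') / of_nat (d z'))"
      have z: "z \<in> fiber t0" "z' \<in> fiber t0" "k < d z" "k' < d z'" using ij e by auto
      have eq: "\<psi> z ?s = \<psi> z' ?s'" using ij(3) by (simp add: e)
      have "z = z'" using cD(11)[OF z(1,2) sm[OF \<zeta> z(1)] sm[OF \<zeta> z(2)] eq] .
      moreover have "k = k'"
      proof -
        have "?s = ?s'"
          using inj_onD[OF cD(5)[OF z(1)] _ sm[OF \<zeta> z(1)] sm[OF \<zeta> z(1)]] eq \<open>z = z'\<close> by blast
        then show ?thesis
          using inj_onD[OF inj_roots_of_exp, of \<zeta> k "d z" k'] z(3,4) \<open>z = z'\<close> by simp
      qed
      ultimately show "i = j" by (simp add: e)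
    qed
    then show "bij_betw (\<lambda>j. ?g j \<zeta>) ?J (fiber (?\<tau> \<zeta>))"
      unfolding bij_betw_def using mem[OF \<zeta>] by blast
  qed
qed

end

section \<open>The chart at infinity\<close>

lemma periodic_sum_shift:
  fixes H :: "nat \<Rightarrow> 'a::ab_group_add"
  assumes "\<And>m. H (m + n) = H m"
  shows "(\<Sum>i<n. H (i + j)) = (\<Sum>i<n. H i)"
proof (induction j)
  case (Suc j)
  have "(\<Sum>i<n. H (i + Suc j)) + H j = (\<Sum>i<Suc n. H (i + j))"
    by (subst sum.lessThan_Suc_shift) (simp add: add.commute)
  also have "\<dots> = (\<Sum>i<n. H (i + j)) + H j"
    using assms[of j] by (simp add: add.commute)
  finally show ?case using Suc by simp
qed simp

abbreviation root1 :: "nat \<Rightarrow> complex" where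
  "root1 n \<equiv> exp (2 * of_real pi * \<i> / of_nat n)"

lemma root1_power_self: "0 < n \<Longrightarrow> root1 n ^ n = 1"
  by (simp flip: exp_of_nat_mult)

lemma root1_power_eq_1_iff: "0 < n \<Longrightarrow> root1 n ^ k = 1 \<longleftrightarrow> n dvd k"
proof -
  assume n: "0 < n"
  have "root1 n ^ k = exp (2 * of_real pi * \<i> * of_nat k / of_nat n)"
    by (simp flip: exp_of_nat_mult) (simp add: mult_ac)
  then show ?thesis using complex_root_unity_eq_1[of n k] n by (simp add: mult_ac)
qed

lemma inj_on_root1_powers: "0 < n \<Longrightarrow> inj_on (\<lambda>j. root1 n ^ j) {..<n}"
proof (rule inj_onI)
  have *: "j = k" if n: "0 < n" "j < n" "k < n" "j \<le> k" "root1 n ^ j = root1 n ^ k" for j k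
  proof -
    have "root1 n ^ j * root1 n ^ (k - j) = root1 n ^ k"
      by (simp only: power_add[symmetric] le_add_diff_inverse[OF that(4)])
    then have "root1 n ^ j * root1 n ^ (k - j) = root1 n ^ j * 1"
      using that(5) by (simp only: mult_1_right)
    then have "root1 n ^ (k - j) = 1" by (subst (asm) mult_cancel_left) simp
    then have "n dvd k - j" using root1_power_eq_1_iff n(1) by blast
    then show ?thesis using n by (metis diff_is_0_eq dvd_imp_le le_antisym less_imp_diff_less not_less zero_less_diff)
  qed
  fix j k assume "0 < n" "j \<in> {..<n}" "k \<in> {..<n}" "root1 n ^ j = root1 n ^ k"
  then show "j = k" using *[of j k] *[of k j] by (cases "j \<le> k") auto
qed

context branched
begin

text \<open>Puiseux expansion at infinity without series. With \<open>R\<close> the reflected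
  polynomial, \<open>\<phi>\<close> is a branch of \<open>x\<close> times the inverse
  \<open>n\<close>-th root of \<open>R\<close>, so that \<open>\<phi> x ^ n\<close> equals
  \<open>1 / P (1 / x)\<close>. If \<open>\<psi>\<close> inverts \<open>\<phi>\<close>, then
  \<open>pp u = 1 / \<psi> u\<close> solves \<open>P (pp u) = 1 / u ^ n\<close>, and multiplying
  \<open>u\<close> by \<open>n\<close>-th roots of unity gives all solutions.\<close>

lemma infinity_chart:
  fixes M :: real
  obtains \<rho> pp where "0 < \<rho>"
    "chart (ball 0 \<rho> - {0}) (\<lambda>u. 1 / u ^ degree P) {..<degree P} (\<lambda>j u. pp (root1 (degree P) ^ j * u))"
    "\<And>u :: complex. u \<in> ball 0 \<rho> - {0} \<Longrightarrow> M < norm (1 / u ^ degree P)"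
proof -
  define n where "n = degree P"
  have n: "n > 0" using degP by (simp add: n_def)
  define R where "R = reflect_poly P"
  have R0: "poly R 0 \<noteq> 0" using P_nonzero by (simp add: R_def)
  have "open {x. poly R x \<noteq> 0}" by (intro open_Collect_neq continuous_intros)
  then obtain r0 where r0': "r0 > 0" "ball 0 r0 \<subseteq> {x. poly R x \<noteq> 0}"
    using R0 by (metis (mono_tags, lifting) mem_Collect_eq openE)
  then have r0: "r0 > 0" "\<And>x. x \<in> ball 0 r0 \<Longrightarrow> poly R x \<noteq> 0" by blast+
  have hR: "poly R holomorphic_on ball 0 r0" by (intro holomorphic_intros)
  have "0 \<in> ball 0 r0" using r0(1) by simp
  then obtain l where l: "l holomorphic_on ball 0 r0" "\<And>x. x \<in> ball 0 r0 \<Longrightarrow> exp (l x) = poly R x"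
    using holomorphic_logarithm_exists[OF convex_ball open_ball hR r0(2)] by metis
  define \<phi> where "\<phi> x = x * exp (- l x / of_nat n)" for x
  have h\<phi>: "\<phi> holomorphic_on ball 0 r0"
    unfolding \<phi>_def using n by (auto intro!: holomorphic_intros l(1))
  have \<phi>n: "\<phi> x ^ n = x ^ n / poly R x" if "x \<in> ball 0 r0" for x
  proof -
    have "exp (- l x / of_nat n) ^ n = exp (- l x)" using n by (simp flip: exp_of_nat_mult)
    then show ?thesis using l(2)[OF that] by (simp add: \<phi>_def power_mult_distrib exp_minus divide_inverse)
  qed
  have "(l has_field_derivative deriv l 0) (at 0)"
    using l(1) r0(1) by (meson centre_in_ball holomorphic_derivI open_ball)
  then have "(\<phi> has_field_derivative exp (- l 0 / of_nat n)) (at 0)"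
    unfolding \<phi>_def using n by (auto intro!: derivative_eq_intros)
  then have d\<phi>: "deriv \<phi> 0 \<noteq> 0" by (simp add: DERIV_imp_deriv)
  obtain r \<psi> where \<psi>: "0 < r" "\<psi> holomorphic_on ball 0 r" "inj_on \<psi> (ball 0 r)" "\<psi> 0 = 0"
    "\<And>s. s \<in> ball 0 r \<Longrightarrow> \<psi> s \<in> ball 0 r0 \<and> \<psi> s \<in> ball 0 1 \<and> \<phi> (\<psi> s) = s"
    using local_inverse_at_simple_zero[OF h\<phi> open_ball _ _ d\<phi> zero_less_one] r0(1)
    by (auto simp: \<phi>_def)
  define pp where "pp u = 1 / \<psi> u" for u
  have \<psi>0: "\<psi> u \<noteq> 0" if "u \<in> ball 0 r - {0}" for u
    using inj_onD[OF \<psi>(3), of u 0] that \<psi>(1,4) by auto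
  have pp: "poly P (pp u) = 1 / u ^ n" if u: "u \<in> ball 0 r - {0}" for u
  proof -
    have "poly R (\<psi> u) = \<psi> u ^ n * poly P (pp u)"
      using poly_reflect_poly_nz[OF \<psi>0[OF u], of P] by (simp add: R_def n_def pp_def divide_inverse)
    moreover have "u ^ n * poly R (\<psi> u) = \<psi> u ^ n"
      using \<phi>n[of "\<psi> u"] \<psi>(5)[of u] u r0(2)[of "\<psi> u"] by auto
    ultimately show ?thesis using \<psi>0[OF u] u by (auto simp: field_simps)
  qed
  \<comment> \<open>\<open>M'\<close> exceeds all irregular values in modulus. Since
    \<open>norm u \<le> 1\<close> gives \<open>norm u ^ n \<le> norm u\<close>, the radius
    \<open>1 / (M' + 1)\<close> keeps \<open>1 / u ^ n\<close> beyond them.\<close>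
  define M' where "M' = Max (insert \<bar>M\<bar> (norm ` {t. \<not> regular t}))"
  have M': "\<bar>M\<bar> \<le> M'" "\<And>t. \<not> regular t \<Longrightarrow> norm t \<le> M'"
    unfolding M'_def using finite_irregular by (auto intro!: Max_ge)
  define \<rho> where "\<rho> = min (min r 1) (1 / (M' + 1))"
  have \<rho>: "0 < \<rho>" "\<rho> \<le> r" using M'(1) \<psi>(1) by (auto simp: \<rho>_def)
  have big: "M' < norm (1 / u ^ n)" if u: "u \<in> ball 0 \<rho> - {0}" for u :: complex
  proof -
    have u1: "0 < norm u" "norm u \<le> 1" "norm u < 1 / (M' + 1)" using u by (auto simp: \<rho>_def)
    have "norm u ^ n \<le> norm u ^ 1" using u1 n by (intro power_decreasing) auto
    then have "norm u ^ n < 1 / (M' + 1)" using u1(3) by simp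
    then have "norm u ^ n * (M' + 1) < 1"
      using M'(1) by (subst (asm) pos_less_divide_eq) auto
    moreover have "0 < norm u ^ n" using u1(1) by simp
    ultimately have "M' + 1 < 1 / norm u ^ n" by (subst pos_less_divide_eq) (auto simp: mult.commute)
    then show ?thesis by (simp add: norm_divide norm_power)
  qed
  define \<omega> where "\<omega> = root1 n"
  have nj: "norm (\<omega> ^ j * u) = norm u" for j u
    by (simp add: \<omega>_def norm_mult norm_power norm_exp_eq_Re)
  have mem: "\<omega> ^ j * u \<in> ball 0 r - {0}" if "u \<in> ball 0 \<rho> - {0}" for j u
    using that \<rho> nj[of j u] by (auto simp: \<omega>_def)
  have \<omega>n: "(\<omega> ^ j) ^ n = 1" for j
    unfolding \<omega>_def by (metis root1_power_self[OF n] mult.commute power_mult power_one)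
  have ch: "chart (ball 0 \<rho> - {0}) (\<lambda>u. 1 / u ^ n) {..<n} (\<lambda>j u. pp (\<omega> ^ j * u))"
    unfolding chart_def
  proof (intro conjI ballI)
    show "open (ball 0 \<rho> - {0} :: complex set)" by (simp add: open_delete)
    show "connected (ball 0 \<rho> - {0} :: complex set)"
      by (rule connected_open_delete) auto
    show "(\<lambda>u. 1 / u ^ n) holomorphic_on ball 0 \<rho> - {0}" by (auto intro!: holomorphic_intros)
    show "(\<lambda>u. pp (\<omega> ^ j * u)) holomorphic_on ball 0 \<rho> - {0}" for j
    proof -
      have "(\<lambda>u. \<psi> (\<omega> ^ j * u)) holomorphic_on ball 0 \<rho> - {0}"
      proof (rule holomorphic_on_compose_gen[where g = \<psi> and t = "ball 0 r", unfolded o_def])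
        show "(\<lambda>u. \<omega> ^ j * u) ` (ball 0 \<rho> - {0}) \<subseteq> ball 0 r" using mem by blast
      qed (intro holomorphic_intros \<psi>(2))+
      then show ?thesis unfolding pp_def using \<psi>0 mem by (auto intro!: holomorphic_intros)
    qed
    fix u assume u: "u \<in> ball 0 \<rho> - {0 :: complex}"
    show reg: "regular (1 / u ^ n)" using big[OF u] M'(2) by (meson not_le)
    have inj: "inj_on (\<lambda>j. pp (\<omega> ^ j * u)) {..<n}"
    proof (rule inj_onI)
      fix j k assume jk: "j \<in> {..<n}" "k \<in> {..<n}" "pp (\<omega> ^ j * u) = pp (\<omega> ^ k * u)"
      then have "\<psi> (\<omega> ^ j * u) = \<psi> (\<omega> ^ k * u)" using \<psi>0 mem[OF u] by (auto simp: pp_def)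
      then have "\<omega> ^ j * u = \<omega> ^ k * u" using inj_onD[OF \<psi>(3)] mem[OF u] by blast
      then have "\<omega> ^ j = \<omega> ^ k" using u by auto
      then show "j = k" using inj_onD[OF inj_on_root1_powers[OF n]] jk by (simp add: \<omega>_def)
    qed
    moreover have "(\<lambda>j. pp (\<omega> ^ j * u)) ` {..<n} = fiber (1 / u ^ n)"
    proof (rule card_subset_eq[OF finite_fiber])
      show "(\<lambda>j. pp (\<omega> ^ j * u)) ` {..<n} \<subseteq> fiber (1 / u ^ n)"
        using pp mem[OF u] \<omega>n by (auto simp: fiber_def power_mult_distrib)
      show "card ((\<lambda>j. pp (\<omega> ^ j * u)) ` {..<n}) = card (fiber (1 / u ^ n))"
        using card_image[OF inj] card_fiber_regular[OF reg] by (simp add: n_def)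
    qed
    ultimately show "bij_betw (\<lambda>j. pp (\<omega> ^ j * u)) {..<n} (fiber (1 / u ^ n))"
      by (simp add: bij_betw_def)
  qed
  have bigM: "M < norm (1 / u ^ n)" if "u \<in> ball 0 \<rho> - {0}" for u :: complex
    using big[OF that] M'(1) by linarith
  show ?thesis by (rule that[OF \<rho>(1) ch[unfolded n_def \<omega>_def] bigM[unfolded n_def]])
qed

end

section \<open>Vanishing sums of roots of unity of prime power order\<close>

abbreviation ipoly :: "int poly \<Rightarrow> complex \<Rightarrow> complex" where
  "ipoly f x \<equiv> poly (map_poly of_int f) x"

lemma ipoly_pCons: "ipoly (pCons a f) x = of_int a + x * ipoly f x"
  by (simp add: map_poly_pCons)

lemma ipoly_add: "ipoly (f + g) x = ipoly f x + ipoly g x"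
proof -
  have "map_poly of_int (f + g) = (map_poly of_int f + map_poly of_int g :: complex poly)"
    by (rule poly_eqI) (simp add: coeff_map_poly)
  then show ?thesis by simp
qed

lemma ipoly_smult: "ipoly (smult c f) x = of_int c * ipoly f x"
proof -
  have "map_poly of_int (smult c f) = (smult (of_int c) (map_poly of_int f) :: complex poly)"
    by (rule poly_eqI) (simp add: coeff_map_poly)
  then show ?thesis by simp
qed

lemma ipoly_mult: "ipoly (f * g) x = ipoly f x * ipoly g x"
  by (induction f) (simp_all add: ipoly_pCons ipoly_add ipoly_smult algebra_simps)

lemma ipoly_sum: "ipoly (\<Sum>i\<in>A. f i) x = (\<Sum>i\<in>A. ipoly (f i) x)"
  by (induction A rule: infinite_finite_induct) (simp_all add: ipoly_add)

lemma ipoly_monom: "ipoly (monom a n) x = of_int a * x ^ n"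
  by (simp add: map_poly_monom poly_monom)

text \<open>If \<open>p\<close> divides the constant coefficient of \<open>g\<close>, it cannot
  divide that of \<open>h\<close>. The lowest coefficient of \<open>g\<close> prime to
  \<open>p\<close> then yields a coefficient of \<open>f\<close> prime to \<open>p\<close>, which
  must be the leading one, so \<open>h\<close> is constant; as \<open>f\<close> is monic, a constant
  factor is a unit.\<close>

lemma eisenstein:
  fixes f :: "int poly"
  assumes p: "prime p" and lc: "lead_coeff f = 1" and dvd: "\<And>i. i < degree f \<Longrightarrow> p dvd coeff f i"
    and f0: "\<not> p\<^sup>2 dvd coeff f 0" and deg: "degree f > 0"
  shows "irreducible f"
proof (rule irreducibleI)
  have key: "degree h = 0" if gh: "f = g * h" and g0: "p dvd coeff g 0" for g h
  proof -
    have f0: "coeff f 0 = coeff g 0 * coeff h 0" using gh by (simp add: coeff_mult)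
    then have h0: "\<not> p dvd coeff h 0"
      using \<open>\<not> p\<^sup>2 dvd coeff f 0\<close> g0 by (auto simp: power2_eq_square intro: mult_dvd_mono)
    have lgh: "lead_coeff g * lead_coeff h = 1" using lc gh by (simp add: lead_coeff_mult)
    then have "\<not> p dvd lead_coeff g"
      using p by (metis dvd_mult2 not_prime_unit)
    then have ex: "\<exists>i. \<not> p dvd coeff g i" by blast
    define i where "i = (LEAST i. \<not> p dvd coeff g i)"
    have i: "\<not> p dvd coeff g i" using LeastI_ex[OF ex] by (simp add: i_def)
    have less: "p dvd coeff g j" if "j < i" for j using not_less_Least that by (auto simp: i_def)
    have "coeff f i = (\<Sum>j\<le>i. coeff g j * coeff h (i - j))" using gh by (simp add: coeff_mult)
    also have "{..i} = insert i {..<i}" by auto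
    also have "(\<Sum>j\<in>insert i {..<i}. coeff g j * coeff h (i - j))
        = coeff g i * coeff h 0 + (\<Sum>j<i. coeff g j * coeff h (i - j))" by simp
    finally have fi: "coeff f i = \<dots>" .
    have "p dvd (\<Sum>j<i. coeff g j * coeff h (i - j))"
      by (rule dvd_sum) (use less in auto)
    moreover have "\<not> p dvd coeff g i * coeff h 0"
      using i h0 p by (simp add: prime_dvd_mult_iff)
    ultimately have "\<not> p dvd coeff f i" unfolding fi by (simp add: dvd_add_left_iff)
    then have "degree f \<le> i" using dvd by (meson not_le)
    moreover have "i \<le> degree g" using i by (intro le_degree) auto
    moreover have "degree f = degree g + degree h"
      using gh deg by (metis degree_0 degree_mult_eq less_irrefl mult_eq_0_iff)
    ultimately show ?thesis by simp
  qed
  show "f \<noteq> 0" using deg by auto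
  show "\<not> f dvd 1" using deg by (metis degree_pCons_0 is_unit_poly_iff less_irrefl)
  fix g h assume gh: "f = g * h"
  have "coeff f 0 = coeff g 0 * coeff h 0" using gh by (simp add: coeff_mult)
  then have "p dvd coeff g 0 \<or> p dvd coeff h 0"
    using dvd[of 0] deg p by (simp add: prime_dvd_mult_iff)
  then have "degree g = 0 \<or> degree h = 0" using key[OF gh] key[of h g] gh by (auto simp: mult.commute)
  moreover have "lead_coeff g * lead_coeff h = 1" using lc gh by (simp add: lead_coeff_mult)
  then have "lead_coeff g dvd 1" "lead_coeff h dvd 1" by (metis dvd_triv_left, metis dvd_triv_right)
  ultimately show "g dvd 1 \<or> h dvd 1"
    by (elim disjE degree_eq_zeroE) (auto simp: is_unit_poly_iff)
qed

text \<open>A substitute for the minimal polynomial that stays in the integers: \<open>h\<close> has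
  least degree among the nonzero integer polynomials with root \<open>x\<close>, and pseudo-division
  shows that it divides a constant multiple of each of them. Constants are cancelled because
  \<open>f\<close> is a prime element of positive degree and so divides none of them.\<close>

lemma irreducible_dvd_of_common_root:
  fixes f g :: "int poly"
  assumes f: "irreducible f" "degree f > 0" "ipoly f x = 0" and g: "ipoly g x = 0"
  shows "f dvd g"
proof (cases "g = 0")
  case False
  have ex: "\<exists>d h. h \<noteq> 0 \<and> degree h = d \<and> ipoly h x = 0" using g False by blast
  define d where "d = (LEAST d. \<exists>h. h \<noteq> 0 \<and> degree h = d \<and> ipoly h x = 0)"
  obtain h where h: "h \<noteq> 0" "degree h = d" "ipoly h x = 0"
    using LeastI_ex[OF ex] by (auto simp: d_def)
  have dmin: "k = 0" if "ipoly k x = 0" "k = 0 \<or> degree k < degree h" for k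
  proof (rule ccontr)
    assume "k \<noteq> 0"
    then have "d \<le> degree k" unfolding d_def using that(1) by (intro Least_le) blast
    with that \<open>k \<noteq> 0\<close> h(2) show False by simp
  qed
  have dh: "degree h > 0"
  proof (rule ccontr)
    assume "\<not> ?thesis"
    then obtain c where "h = [:c:]" using degree_eq_zeroE by blast
    then show False using h by (simp add: ipoly_pCons)
  qed
  have pm: "\<exists>c q. c \<noteq> 0 \<and> smult c k = h * q" if "ipoly k x = 0" for k
  proof -
    have c: "\<exists>a q. a \<noteq> 0 \<and> smult a k = h * q + pseudo_mod k h"
      and r: "pseudo_mod k h = 0 \<or> degree (pseudo_mod k h) < degree h"
      using pseudo_mod[OF h(1), of k] by auto
    then obtain a q where aq: "a \<noteq> 0" "smult a k = h * q + pseudo_mod k h" by blast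
    have "ipoly (smult a k) x = 0" using that by (simp add: ipoly_smult)
    then have "ipoly (pseudo_mod k h) x = 0" using h(3) by (simp add: aq(2) ipoly_add ipoly_mult)
    then have "pseudo_mod k h = 0" using dmin r by blast
    then show ?thesis using aq by auto
  qed
  have prime: "prime_elem f" using f(1) by (rule irreducible_imp_prime_elem)
  have nc: "\<not> f dvd [:c:]" if "c \<noteq> 0" for c
    using dvd_imp_degree_le[of f "[:c:]"] f(2) that by auto
  have fh: "f dvd h"
  proof -
    obtain c q where cq: "c \<noteq> 0" "smult c f = h * q" using pm[OF f(3)] by blast
    then have "f dvd h * q" by (metis dvd_refl dvd_smult)
    then consider "f dvd h" | "f dvd q" using prime prime_elem_dvd_mult_iff by blast
    then show ?thesis
    proof cases
      case 2
      then obtain q' where q': "q = f * q'" by blast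
      have "f * [:c:] = f * (h * q')" using cq(2) q' by (simp add: mult_ac)
      then have "[:c:] = h * q'" using f(2) by (metis degree_0 less_irrefl mult_cancel_left)
      then have "degree (h * q') = 0" by (metis degree_pCons_0)
      moreover have "q' \<noteq> 0" using \<open>[:c:] = h * q'\<close> cq(1) by auto
      ultimately show ?thesis using dh h(1) by (simp add: degree_mult_eq)
    qed
  qed
  obtain c q where cq: "c \<noteq> 0" "smult c g = h * q" using pm[OF g] by blast
  then have "[:c:] * g = h * q" by simp
  then have "f dvd [:c:] * g" using fh by (metis dvd_mult2)
  then show ?thesis using prime nc[OF cq(1)] prime_elem_dvd_mult_iff by blast
qed auto

section \<open>Cyclotomic polynomials of prime power order\<close>

lemma ipoly_pcompose: "ipoly (pcompose f g) x = ipoly f (ipoly g x)"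
  by (induction f) (simp_all add: ipoly_pCons pcompose_pCons ipoly_add ipoly_mult)

lemma pcompose_power: "pcompose (f ^ n) g = pcompose f g ^ n"
  for f g :: "'a::comm_semiring_1 poly"
  by (induction n) (simp_all add: pcompose_mult pcompose_1)

lemma ipoly_power: "ipoly (f ^ n) x = ipoly f x ^ n"
  by (induction n) (simp_all add: ipoly_mult)

lemma freshmans_dream_poly:
  fixes Y :: "int poly" and p :: nat
  assumes p: "prime p"
  shows "[:int p:] dvd (1 + Y) ^ p - (1 + Y ^ p)"
proof -
  have p1: "p > 1" using p by (rule prime_gt_1_nat)
  have "(Y + 1) ^ p = (\<Sum>k\<le>p. of_nat (p choose k) * Y ^ k)"
    by (subst binomial_ring) simp
  also have "{..p} = insert 0 (insert p {1..<p})" using p1 by auto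
  also have "(\<Sum>k\<in>insert 0 (insert p {1..<p}). of_nat (p choose k) * Y ^ k)
      = 1 + Y ^ p + (\<Sum>k\<in>{1..<p}. of_nat (p choose k) * Y ^ k)"
    using p1 by simp
  finally have "(1 + Y) ^ p - (1 + Y ^ p) = (\<Sum>k\<in>{1..<p}. of_nat (p choose k) * Y ^ k)"
    by (simp add: add.commute)
  moreover have "[:int p:] dvd (\<Sum>k\<in>{1..<p}. of_nat (p choose k) * Y ^ k)"
  proof (rule dvd_sum)
    fix k assume "k \<in> {1..<p}"
    then have "p dvd p choose k" using p by (intro dvd_choose_prime) auto
    then obtain c where "p choose k = p * c" by blast
    then have "of_nat (p choose k) * Y ^ k = [:int p:] * (of_nat c * Y ^ k)"
      by (simp add: of_nat_poly mult.commute)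
    then show "[:int p:] dvd of_nat (p choose k) * Y ^ k" by (rule dvdI)
  qed
  ultimately show ?thesis by simp
qed

lemma dvd_diff_power:
  fixes a b c :: "'a::comm_ring_1"
  assumes "c dvd a - b"
  shows "c dvd a ^ n - b ^ n"
  using assms by (metis dvd_mult2 power_diff_sumr2)

lemma freshmans_dream_poly_iterated:
  fixes p :: nat
  assumes p: "prime p"
  shows "[:int p:] dvd [:1, 1:] ^ (p ^ k) - (1 + [:0, 1:] ^ (p ^ k))"
proof (induction k)
  case (Suc k)
  let ?X = "[:0, 1 :: int:] ^ (p ^ k)"
  have "[:int p:] dvd ([:1, 1:] ^ (p ^ k)) ^ p - (1 + ?X) ^ p"
    using Suc by (rule dvd_diff_power)
  from dvd_add[OF this freshmans_dream_poly[OF p, of ?X]]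
  have "[:int p:] dvd ([:1, 1:] ^ (p ^ k)) ^ p - (1 + ?X ^ p)" by (simp add: algebra_simps)
  then show ?case by (simp add: power_mult[symmetric] mult.commute)
qed (simp add: one_pCons)

text \<open>The prime-power cyclotomic polynomial, shifted by one to become an Eisenstein polynomial.\<close>

lemma irreducible_shifted_cyclotomic:
  fixes p k :: nat
  assumes p: "prime p"
  defines "F \<equiv> \<Sum>i<p. ([:1, 1 :: int:] ^ (p ^ k)) ^ i"
  shows "irreducible F" "degree F = p ^ k * (p - 1)"
proof -
  have p1: "p > 1" using p by (rule prime_gt_1_nat)
  define q where "q = p ^ k"
  have q: "q > 0" using p1 by (simp add: q_def)
  let ?c = "[:int p:]" and ?X = "[:0, 1 :: int:] ^ q"
  have dF: "degree ([:1, 1 :: int:] ^ n) = n" for n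
    by (simp add: degree_power_eq)
  have F': "F = (\<Sum>i<p - 1. ([:1, 1:] ^ q) ^ i) + ([:1, 1:] ^ q) ^ (p - 1)"
    using p1 sum.lessThan_Suc[of "\<lambda>i. ([:1, 1 :: int:] ^ q) ^ i" "p - 1"] by (simp add: F_def q_def)
  have "degree (\<Sum>i<p - 1. ([:1, 1 :: int:] ^ q) ^ i) \<le> q * (p - 2)"
    by (rule degree_sum_le) (auto simp: dF power_mult[symmetric])
  also have "\<dots> < q * (p - 1)" using q p1 by simp
  finally have less: "degree (\<Sum>i<p - 1. ([:1, 1 :: int:] ^ q) ^ i) < degree (([:1, 1 :: int:] ^ q) ^ (p - 1))"
    by (simp add: dF power_mult[symmetric])
  then have deg: "degree F = q * (p - 1)"
    unfolding F' by (subst degree_add_eq_right) (simp_all add: dF power_mult[symmetric])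
  then show "degree F = p ^ k * (p - 1)" by (simp add: q_def)
  have lc: "lead_coeff F = 1"
    unfolding F' using less by (subst lead_coeff_add_le) (simp_all add: lead_coeff_power)
  \<comment> \<open>Modulo \<open>p\<close>, \<open>F\<close> is the geometric sum of powers of
    \<open>1 + X ^ q\<close>. Times \<open>X ^ q\<close> it becomes
    \<open>(1 + X ^ q) ^ p - 1\<close>, hence \<open>X ^ (q * p)\<close>. So \<open>F\<close> is
    congruent to \<open>X ^ (q * (p - 1))\<close>; the factor \<open>X ^ q\<close> is removed by
    comparing coefficients shifted by \<open>q\<close>.\<close>
  have "?c dvd F - (\<Sum>i<p. (1 + ?X) ^ i)"
    unfolding F_def sum_subtractf[symmetric] q_def
    by (intro dvd_sum dvd_diff_power freshmans_dream_poly_iterated p)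
  then have "?c dvd ?X * (F - (\<Sum>i<p. (1 + ?X) ^ i))" by (rule dvd_mult)
  moreover have "?X * (\<Sum>i<p. (1 + ?X) ^ i) = (1 + ?X) ^ p - 1"
    by (subst power_diff_1_eq) simp
  moreover have "?c dvd (1 + ?X) ^ p - (1 + ?X ^ p)"
    using p by (rule freshmans_dream_poly)
  ultimately have "?c dvd (?X * F - ((1 + ?X) ^ p - 1)) + ((1 + ?X) ^ p - (1 + ?X ^ p))"
    by (intro dvd_add) (simp_all add: right_diff_distrib)
  then have "?c dvd ?X * F - ?X ^ p" by simp
  also have "?X ^ p = ?X * [:0, 1:] ^ (q * (p - 1))"
    using p1 by (simp add: power_mult[symmetric] power_add[symmetric] algebra_simps flip: power_mult)
  finally have dv: "?c dvd ?X * (F - [:0, 1:] ^ (q * (p - 1)))" by (simp add: right_diff_distrib)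
  have X: "[:0, 1 :: int:] ^ n = monom 1 n" for n by (simp add: monom_altdef)
  have dvd: "int p dvd coeff F i" if "i < degree F" for i
  proof -
    have "int p dvd coeff (?X * (F - [:0, 1:] ^ (q * (p - 1)))) (i + q)"
      using dv by (simp add: const_poly_dvd_iff)
    also have "coeff (?X * (F - [:0, 1:] ^ (q * (p - 1)))) (i + q) = coeff F i"
      using that deg by (simp add: X coeff_monom_mult)
    finally show ?thesis .
  qed
  have "coeff F 0 = int p"
    by (simp add: F_def poly_sum flip: poly_0_coeff_0)
  then have "\<not> (int p)\<^sup>2 dvd coeff F 0"
    using p1 by (auto simp: power2_eq_square)
  then show "irreducible F"
    using p lc dvd deg q p1 by (intro eisenstein[of "int p"]) auto
qed

text \<open>The polynomial with coefficients \<open>f\<close> is a multiple of the cyclotomic polynomial, whence the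
  periodicity.\<close>

lemma vanishing_sum_prime_power_root_of_unity:
  fixes f :: "nat \<Rightarrow> int" and p k :: nat and \<omega> :: complex
  assumes p: "prime p" and \<omega>: "\<omega> ^ (p ^ Suc k) = 1" "\<omega> ^ (p ^ k) \<noteq> 1"
    and sum: "(\<Sum>j<p ^ Suc k. of_int (f j) * \<omega> ^ j) = 0"
    and j: "i < p ^ Suc k" "j < p ^ Suc k" "i mod p ^ k = j mod p ^ k"
  shows "f i = f j"
proof -
  have p1: "p > 1" using p by (rule prime_gt_1_nat)
  define q where "q = p ^ k"
  have q: "q > 0" using p1 by (simp add: q_def)
  define F where "F = (\<Sum>i<p. ([:1, 1 :: int:] ^ q) ^ i)"
  define \<Phi> where "\<Phi> = (\<Sum>i<p. monom (1 :: int) (q * i))"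
  define g where "g = (\<Sum>j<p * q. monom (f j) j)"
  \<comment> \<open>The argument is \<open>\<omega> - 1\<close> because \<open>F\<close> is the
    shifted polynomial. Here \<open>\<omega> ^ q\<close> is a \<open>p\<close>-th root of unity
    other than 1, so its geometric sum vanishes.\<close>
  have "ipoly F (\<omega> - 1) = (\<Sum>i<p. (\<omega> ^ q) ^ i)"
    by (simp add: F_def ipoly_sum ipoly_power ipoly_pCons)
  also have "\<dots> = 0"
    using \<omega> geometric_sum[of "\<omega> ^ q" p] by (simp add: q_def power_mult[symmetric] mult.commute)
  finally have F0: "ipoly F (\<omega> - 1) = 0" .
  have "ipoly g \<omega> = 0"
    using sum by (simp add: g_def ipoly_sum ipoly_monom q_def)
  then have "ipoly (pcompose g [:1, 1:]) (\<omega> - 1) = 0"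
    by (simp add: ipoly_pcompose ipoly_pCons)
  moreover have "irreducible F" "degree F > 0"
    using irreducible_shifted_cyclotomic[OF p, of k] p1 by (simp_all add: F_def q_def)
  ultimately have "F dvd pcompose g [:1, 1:]"
    using irreducible_dvd_of_common_root F0 by blast
  then obtain h where "pcompose g [:1, 1:] = F * h" by blast
  then have "pcompose (pcompose g [:1, 1:]) [:-1, 1:] = pcompose F [:-1, 1:] * pcompose h [:-1, 1:]"
    by (simp add: pcompose_mult)
  moreover have "pcompose (pcompose g [:1, 1:]) [:-1, 1:] = g"
    by (simp add: pcompose_assoc[symmetric] pcompose_pCons)
  moreover have "pcompose F [:-1, 1:] = \<Phi>"
    by (simp add: F_def \<Phi>_def pcompose_sum pcompose_power pcompose_pCons monom_altdef power_mult)
  ultimately obtain h where gh: "g = \<Phi> * h" by metis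
  have cg: "coeff g j = (if j < p * q then f j else 0)" for j
    by (simp add: g_def coeff_sum)
  have deg\<Phi>: "degree \<Phi> = q * (p - 1)"
  proof (rule antisym)
    show "degree \<Phi> \<le> q * (p - 1)"
      unfolding \<Phi>_def by (rule degree_sum_le) (auto simp: degree_monom_eq)
    have "coeff \<Phi> (q * (p - 1)) = 1"
      using q p1 by (simp add: \<Phi>_def coeff_sum)
    then show "q * (p - 1) \<le> degree \<Phi>" by (intro le_degree) simp
  qed
  \<comment> \<open>This is where periodicity comes from: a cofactor of degree below
    \<open>q\<close>, multiplied by the sum of the \<open>X ^ (q * i)\<close>, has its coefficients
    repeated in \<open>p\<close> consecutive blocks that do not overlap.\<close>
  have hq: "degree h < q \<or> h = 0"
  proof (cases "g = 0")
    case False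
    then have "degree g = q * (p - 1) + degree h"
      using gh deg\<Phi> by (metis degree_mult_eq mult_eq_0_iff)
    moreover have "degree g < p * q"
      using cg False by (metis leading_coeff_0_iff)
    moreover have "p * q = q * (p - 1) + q" using p1 by (simp add: algebra_simps)
    ultimately show ?thesis by simp
  next
    case True
    have "\<Phi> \<noteq> 0" using deg\<Phi> q p1 by auto
    then show ?thesis using gh True by simp
  qed
  have "f j = coeff h (j mod q)" if j: "j < p * q" for j
  proof -
    have "f j = (\<Sum>i<p. coeff (monom 1 (q * i) * h) j)"
      using cg[of j] j by (simp add: gh \<Phi>_def sum_distrib_right coeff_sum)
    also have "\<dots> = (\<Sum>i<p. if i = j div q then coeff h (j mod q) else 0)"
    proof (rule sum.cong)
      fix i assume "i \<in> {..<p}"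
      consider "i = j div q" | "i < j div q" | "j div q < i" by linarith
      then show "coeff (monom 1 (q * i) * h) j = (if i = j div q then coeff h (j mod q) else 0)"
      proof cases
        case 1
        then show ?thesis
          using times_div_less_eq_dividend[of q j]
          by (simp add: coeff_monom_mult minus_mult_div_eq_mod not_less[symmetric])
      next
        case 2
        then have "q * (i + 1) \<le> q * (j div q)" by (intro mult_le_mono2) simp
        from le_trans[OF this times_div_less_eq_dividend] have "q * i + q \<le> j" by simp
        then have "coeff h (j - q * i) = 0" using hq by (cases "h = 0") (auto intro!: coeff_eq_0)
        then show ?thesis using 2 by (simp add: coeff_monom_mult)
      next
        case 3
        then have "q * (j div q + 1) \<le> q * i" by (intro mult_le_mono2) simp
        then have "j < q * i" using q dividend_less_times_div[of q j] by (simp add: algebra_simps)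
        then show ?thesis using 3 by (simp add: coeff_monom_mult)
      qed
    qed simp
    also have "\<dots> = coeff h (j mod q)"
      using j q by (simp add: less_mult_imp_div_less)
    finally show ?thesis .
  qed
  then show ?thesis using j by (simp add: q_def)
qed

section \<open>The dichotomy at infinity\<close>

context branched
begin

declare dt.simps(2) [simp del]

text \<open>At regular points this says that the two branches of \<open>Q\<close> as a function of
  \<open>t\<close> have the same Taylor expansion. Order 0 is included, so the values of
  \<open>Q\<close> agree as well and not only its derivatives.\<close>

definition same_jet :: "complex \<Rightarrow> complex \<Rightarrow> bool" where
  "same_jet z w \<longleftrightarrow> poly P z = poly P w \<and> (\<forall>k. dt k z = dt k w)"

text \<open>Order 0 is left out because the relations come from logarithmic terms whose factors are
  the derivatives \<open>dt (Suc k)\<close>.\<close>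

definition is_relation :: "complex \<Rightarrow> (complex \<Rightarrow> int) \<Rightarrow> bool" where
  "is_relation t f \<longleftrightarrow> (\<forall>k\<ge>1. (\<Sum>v\<in>fiber t. of_int (f v) * dt k v) = 0)"

definition same_coeff :: "complex \<Rightarrow> complex \<Rightarrow> bool" where
  "same_coeff z w \<longleftrightarrow> poly P z = poly P w \<and> (\<forall>f. is_relation (poly P z) f \<longrightarrow> f z = f w)"

text \<open>Both alternatives are realised by the same two branches, those numbered 0 and
  \<open>n / p\<close>. As \<open>n\<close> is a power of \<open>p\<close>, a frequency
  \<open>m\<close> is prime to \<open>p\<close> exactly if \<open>\<omega> ^ m\<close> is a
  primitive \<open>n\<close>-th root of unity; the cases differ in whether some such frequency
  occurs in \<open>dt 1\<close>.\<close>

lemma dichotomy_at_infinity: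
  assumes p: "prime p" and deg: "degree P = p ^ Suc k"
  obtains z w where "z \<noteq> w" "regular (poly P z)" "same_jet z w \<or> same_coeff z w"
proof -
  define n where "n = degree P"
  define q where "q = p ^ k"
  have p1: "p > 1" using p by (rule prime_gt_1_nat)
  have nq: "n = p * q" "q > 0" "q < n" "n > 0" using p1 deg by (auto simp: n_def q_def)
  define \<omega> where "\<omega> = root1 n"
  have \<omega>1: "\<omega> ^ j = 1 \<longleftrightarrow> n dvd j" for j
    unfolding \<omega>_def by (rule root1_power_eq_1_iff[OF nq(4)])
  have \<omega>0: "\<omega> \<noteq> 0" by (simp add: \<omega>_def)
  have \<omega>n: "\<omega> ^ (i + n) = \<omega> ^ i" for i using \<omega>1[of n] by (simp add: power_add)
  obtain \<rho> pp where \<rho>: "0 < \<rho>"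
    and ch: "chart (ball 0 \<rho> - {0}) (\<lambda>u. 1 / u ^ n) {..<n} (\<lambda>j u. pp (\<omega> ^ j * u))"
    using infinity_chart unfolding n_def \<omega>_def by metis
  define C where "C = ball 0 \<rho> - {0 :: complex}"
  define \<tau> where "\<tau> = (\<lambda>u :: complex. 1 / u ^ n)"
  define g where "g = (\<lambda>j u. pp (\<omega> ^ j * u))"
  have ch: "chart C \<tau> {..<n} g" using ch by (simp add: C_def \<tau>_def g_def)
  note chD = chartD[OF ch]
  have rot: "\<omega> ^ j * u \<in> C" if "u \<in> C" for j u
    using that by (auto simp: C_def norm_mult norm_power \<omega>_def norm_exp_eq_Re)
  have \<tau>rot: "\<tau> (\<omega> ^ j * u) = \<tau> u" for j u
  proof -
    have "(\<omega> ^ j) ^ n = 1" using \<omega>1[of "j * n"] by (simp add: power_mult)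
    then show ?thesis by (simp add: \<tau>_def power_mult_distrib)
  qed
  have d\<tau>: "deriv \<tau> u \<noteq> 0" if "u \<in> C" for u
  proof -
    have "u \<noteq> 0" using that by (auto simp: C_def)
    then have "(\<tau> has_field_derivative - (of_nat n * u ^ (n - 1)) / (u ^ n) ^ 2) (at u)"
      unfolding \<tau>_def by (auto intro!: derivative_eq_intros simp: power2_eq_square)
    then show ?thesis using \<open>u \<noteq> 0\<close> nq(4) by (simp add: DERIV_imp_deriv)
  qed
  obtain u0 where u0: "u0 \<in> C"
    using \<rho> that[of "of_real (\<rho> / 2)"] by (auto simp: C_def)
  have gn: "g (j + n) u = g j u" for j u by (simp add: g_def \<omega>n)
  have gr: "g i (\<omega> ^ j * u) = g (i + j) u" for i j u by (simp add: g_def power_add mult.assoc)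
  \<comment> \<open>Finite Fourier transform of \<open>dt 1\<close> over the cyclically ordered
    branches; by \<open>shift\<close>, rotating the branches by \<open>j\<close> steps divides it by
    \<open>\<omega> ^ (j * m)\<close>.\<close>
  define T where "T m u = (\<Sum>j<n. \<omega> ^ (j * m) * dt 1 (g j u))" for m u
  have shift: "(\<Sum>i<n. \<omega> ^ (i * m) * dt 1 (g (i + j) u)) * \<omega> ^ (j * m) = T m u" for m j u
  proof -
    define H where "H i = \<omega> ^ (i * m) * dt 1 (g i u)" for i
    have "\<omega> ^ (n * m) = 1" using \<omega>1 by simp
    then have "H (i + n) = H i" for i by (simp add: H_def gn add_mult_distrib power_add)
    then have "(\<Sum>i<n. H (i + j)) = T m u" unfolding T_def H_def[symmetric] by (rule periodic_sum_shift)
    moreover have "(\<Sum>i<n. \<omega> ^ (i * m) * dt 1 (g (i + j) u)) * \<omega> ^ (j * m) = (\<Sum>i<n. H (i + j))"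
      unfolding sum_distrib_right H_def add_mult_distrib power_add
      by (rule sum.cong) (simp_all only: mult_ac)
    ultimately show ?thesis by simp
  qed
  have distinct: "g 0 u \<noteq> g q u" if "u \<in> C" for u
    using inj_onD[OF chD(9)[OF that], of 0 q] nq by auto
  have reg: "regular (poly P (g 0 u))" "poly P (g 0 u) = \<tau> u" "poly P (g q u) = \<tau> u" if "u \<in> C" for u
    using chD(5,7)[OF that] nq by auto
  show ?thesis
  proof (cases "\<forall>m u. u \<in> C \<longrightarrow> \<not> p dvd m \<longrightarrow> T m u = 0")
    case True
    have inv: "dt 1 (g j u) = (\<Sum>m<n. T m (\<omega> ^ j * u)) / of_nat n" for u j
    proof -
      have geo: "(\<Sum>m<n. \<omega> ^ (i * m)) = (if i = 0 then of_nat n else 0)" if "i < n" for i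
      proof (cases "i = 0")
        case False
        have "(\<Sum>m<n. (\<omega> ^ i) ^ m) = ((\<omega> ^ i) ^ n - 1) / (\<omega> ^ i - 1)"
          by (rule geometric_sum) (use \<omega>1[of i] that False in \<open>auto dest: dvd_imp_le\<close>)
        then show ?thesis using \<omega>1[of "i * n"] False by (simp add: power_mult)
      qed simp
      have "(\<Sum>m<n. T m (\<omega> ^ j * u)) = (\<Sum>i<n. \<Sum>m<n. \<omega> ^ (i * m) * dt 1 (g (i + j) u))"
        unfolding T_def gr by (rule sum.swap)
      also have "\<dots> = (\<Sum>i<n. if i = 0 then of_nat n * dt 1 (g j u) else 0)"
        by (rule sum.cong) (auto simp: geo simp flip: sum_distrib_right)
      also have "\<dots> = of_nat n * dt 1 (g j u)" using nq(4) by simp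
      finally show ?thesis using nq(4) by simp
    qed
    \<comment> \<open>Rotation by \<open>q\<close> steps divides \<open>T m\<close> by
      \<open>\<omega> ^ (q * m)\<close>, which is 1 if \<open>p\<close> divides \<open>m\<close>,
      because \<open>n = p * q\<close>; the remaining \<open>T m\<close> vanish by
      assumption.\<close>
    have Tq: "T m (\<omega> ^ q * u) = T m u" if "u \<in> C" for m u
    proof (cases "p dvd m")
      case True
      then have "\<omega> ^ (q * m) = 1" using \<omega>1 nq(1) by (auto simp: mult_ac)
      then show ?thesis using shift[of m q u] by (simp add: T_def gr)
    next
      case False
      then show ?thesis using True that rot by simp
    qed
    have G1: "dt 1 (g q u) = dt 1 (g 0 u)" if "u \<in> C" for u
      unfolding inv using Tq[OF that] by simp
    have derD: "((\<lambda>u. dt i (g q u) - dt i (g 0 u)) has_field_derivative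
        deriv \<tau> u * (dt (Suc i) (g q u) - dt (Suc i) (g 0 u))) (at u)" if "u \<in> C" for i u
      using DERIV_diff[OF chart_dt_derivative[OF ch that] chart_dt_derivative[OF ch that], of q 0 i i] nq
      by (simp add: right_diff_distrib)
    have Gk: "dt (Suc i) (g q u) = dt (Suc i) (g 0 u)" if "u \<in> C" for i u
      using that
    proof (induction i arbitrary: u)
      case 0
      then show ?case using G1 by simp
    next
      case (Suc i)
      have "((\<lambda>u. dt (Suc i) (g q u) - dt (Suc i) (g 0 u)) has_field_derivative 0) (at u)"
        by (rule has_field_derivative_transform_within_open[OF DERIV_const[of 0] chD(1) Suc.prems])
           (simp add: Suc.IH)
      from DERIV_unique[OF this derD[OF Suc.prems]] d\<tau>[OF Suc.prems] show ?case by simp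
    qed
    have cont: "continuous_on C (\<lambda>u. dt 0 (g q u) - dt 0 (g 0 u))"
      by (intro continuous_at_imp_continuous_on ballI DERIV_isCont[OF derD])
    have der0: "((\<lambda>u. dt 0 (g q u) - dt 0 (g 0 u)) has_field_derivative 0) (at u)" if "u \<in> C" for u
      using derD[OF that, of 0] Gk[OF that, of 0] by simp
    obtain c where c: "\<And>u. u \<in> C \<Longrightarrow> dt 0 (g q u) - dt 0 (g 0 u) = c"
      by (rule DERIV_zero_connected_constant[OF chD(2,1) finite.emptyI cont]) (use der0 in auto)
    \<comment> \<open>Equal derivatives only give that \<open>Q\<close> changes by a constant
      \<open>c\<close> under the rotation. After \<open>p\<close> rotations by \<open>q\<close>
      steps one is back at the first branch, so \<open>p\<close> times \<open>c\<close> is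
      0.\<close>
    have tele: "dt 0 (g (i * q) u0) - dt 0 (g 0 u0) = of_nat i * c" for i
    proof (induction i)
      case (Suc i)
      have "dt 0 (g (q + i * q) u0) - dt 0 (g (i * q) u0) = c"
        using c[OF rot[OF u0], of "i * q"] by (simp only: gr add_0)
      then show ?case using Suc by (simp add: algebra_simps)
    qed simp
    have "c = 0" using tele[of p] gn[of 0 u0] nq p1 by simp
    then have "dt i (g 0 u0) = dt i (g q u0)" for i
      using c[OF u0] Gk[OF u0] by (cases i) (auto simp del: dt.simps)
    then have "same_jet (g 0 u0) (g q u0)"
      unfolding same_jet_def using reg[OF u0] by metis
    then show ?thesis using that distinct[OF u0] reg[OF u0] by blast
  next
    case False
    then obtain m u2 where m: "u2 \<in> C" "\<not> p dvd m" "T m u2 \<noteq> 0" by blast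
    have "f (g 0 u0) = f (g q u0)" if f: "is_relation (\<tau> u0) f" for f
    proof -
      define F where "F j = f (g j u0)" for j
      have "(\<Sum>j<n. of_int (F j) * dt i (g j u0)) = 0" if "1 \<le> i" for i
        using f that unfolding is_relation_def chart_sum[OF ch u0] F_def by blast
      then have rel: "(\<Sum>j<n. of_int (F j) * dt 1 (g j y)) = 0" if "y \<in> C" for y
        using chart_relation_transport[OF ch u0 that, of 1 "\<lambda>j. of_int (F j)" 1] by blast
      \<comment> \<open>The relation, taken at all rotated points and summed with weights
        \<open>\<omega> ^ (i * m)\<close>, is a convolution. Its transform factors into
        \<open>T m u2\<close>, which is not 0, and the polynomial with coefficients \<open>F\<close>
        at \<open>1 / \<omega> ^ m\<close>.\<close>
      have "0 = (\<Sum>i<n. \<omega> ^ (i * m) * (\<Sum>j<n. of_int (F j) * dt 1 (g (j + i) u2)))"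
        using rel[OF rot[OF m(1)]] by (simp only: gr mult_zero_right sum.neutral_const)
      also have "\<dots> = (\<Sum>i<n. \<Sum>j<n. of_int (F j) * (\<omega> ^ (i * m) * dt 1 (g (i + j) u2)))"
        by (simp add: sum_distrib_left mult_ac add.commute)
      also have "\<dots> = (\<Sum>j<n. of_int (F j) * (\<Sum>i<n. \<omega> ^ (i * m) * dt 1 (g (i + j) u2)))"
        by (subst sum.swap) (simp add: sum_distrib_left)
      also have "\<dots> = (\<Sum>j<n. of_int (F j) * (T m u2 / \<omega> ^ (j * m)))"
      proof (rule sum.cong[OF refl])
        fix j
        have "(\<Sum>i<n. \<omega> ^ (i * m) * dt 1 (g (i + j) u2)) = T m u2 / \<omega> ^ (j * m)"
          by (subst nonzero_eq_divide_eq) (use \<omega>0 shift[of m j u2] in auto)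
        then show "of_int (F j) * (\<Sum>i<n. \<omega> ^ (i * m) * dt 1 (g (i + j) u2))
            = of_int (F j) * (T m u2 / \<omega> ^ (j * m))" by simp
      qed
      also have "\<dots> = T m u2 * (\<Sum>j<n. of_int (F j) * (1 / \<omega> ^ m) ^ j)"
        by (simp add: sum_distrib_left power_divide power_mult[symmetric] mult_ac)
      finally have "(\<Sum>j<n. of_int (F j) * (1 / \<omega> ^ m) ^ j) = 0" using m(3) by simp
      moreover have "(1 / \<omega> ^ m) ^ n = 1"
        using \<omega>1[of "m * n"] by (simp add: power_divide power_mult)
      moreover have "(1 / \<omega> ^ m) ^ q \<noteq> 1"
        using \<omega>1[of "m * q"] nq m(2) by (simp add: power_divide power_mult)
      ultimately have "F 0 = F q"
        using vanishing_sum_prime_power_root_of_unity[OF p, of "1 / \<omega> ^ m" k F 0 q] nq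
        by (simp add: q_def)
      then show ?thesis by (simp add: F_def)
    qed
    then have "same_coeff (g 0 u0) (g q u0)"
      unfolding same_coeff_def using reg[OF u0] by simp
    then show ?thesis using that distinct[OF u0] reg[OF u0] by blast
  qed
qed

end

section \<open>Flat equivalence relations on the fibres\<close>

lemma removable_finite_singularities:
  fixes f :: "complex \<Rightarrow> complex"
  assumes "finite K" "f holomorphic_on - K"
    and "\<And>\<kappa>. \<kappa> \<in> K \<Longrightarrow> \<exists>B. eventually (\<lambda>z. norm (f z) \<le> B) (at \<kappa>)"
  shows "\<exists>g. g holomorphic_on UNIV \<and> (\<forall>z\<in>- K. g z = f z)"
  using assms
proof (induction K arbitrary: f rule: finite_induct)
  case empty
  then show ?case by auto
next
  case (insert \<kappa> K)
  have op: "open (- K)" using insert.hyps(1) by (simp add: finite_imp_closed open_Compl)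
  have "f holomorphic_on (- K) - {\<kappa>}"
    using insert.prems(1) by (rule holomorphic_on_subset) auto
  moreover have "\<kappa> \<in> interior (- K)" using op insert.hyps(2) by (simp add: interior_open)
  ultimately obtain g where g: "g holomorphic_on - K" "\<And>z. z \<in> - K - {\<kappa>} \<Longrightarrow> g z = f z"
    using holomorphic_on_extend_bounded[of f "- K" \<kappa>] insert.prems(2)[of \<kappa>] by blast
  have "\<exists>B. eventually (\<lambda>z. norm (g z) \<le> B) (at \<kappa>')" if \<kappa>': "\<kappa>' \<in> K" for \<kappa>'
  proof -
    obtain B where B: "eventually (\<lambda>z. norm (f z) \<le> B) (at \<kappa>')" using insert.prems(2) \<kappa>' by blast
    have "eventually (\<lambda>z. z \<in> - insert \<kappa> K) (at \<kappa>')"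
    proof -
      have "open (- (insert \<kappa> K - {\<kappa>'}))"
        by (intro open_Compl finite_imp_closed finite_Diff finite.insertI insert.hyps(1))
      moreover have "\<kappa>' \<in> - (insert \<kappa> K - {\<kappa>'})" by simp
      ultimately have "eventually (\<lambda>z. z \<in> - (insert \<kappa> K - {\<kappa>'})) (at \<kappa>')"
        by (rule eventually_at_in_open')
      then show ?thesis using eventually_neq_at_within[of \<kappa>'] by eventually_elim auto
    qed
    with B have "eventually (\<lambda>z. norm (g z) \<le> B) (at \<kappa>')"
      by eventually_elim (use g(2) in auto)
    then show ?thesis by blast
  qed
  then obtain h where "h holomorphic_on UNIV" "\<forall>z\<in>- K. h z = g z"
    using insert.IH[OF g(1)] by blast
  then show ?case using g(2) by (intro exI[of _ h]) auto
qed

lemma prod_linear_factors_dvd: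
  fixes D :: "'a::idom poly"
  assumes "finite S" "\<And>w. w \<in> S \<Longrightarrow> poly D w = 0"
  shows "(\<Prod>w\<in>S. [:-w, 1:]) dvd D"
  using assms
proof (induction S arbitrary: D rule: finite_induct)
  case (insert w S)
  have "poly D w = 0" using insert.prems by simp
  then obtain D' where D': "D = [:-w, 1:] * D'" by (metis dvdE poly_eq_0_iff_dvd)
  have "poly D' v = 0" if "v \<in> S" for v
    using insert.prems[of v] insert.hyps(2) that by (auto simp: D')
  then have "(\<Prod>w\<in>S. [:-w, 1:]) dvd D'" by (rule insert.IH)
  then have "[:-w, 1:] * (\<Prod>w\<in>S. [:-w, 1:]) dvd D" unfolding D' by (rule mult_dvd_mono[OF dvd_refl])
  then show ?case using insert.hyps by simp
qed simp

lemma poly_eq_prod_linear_factors: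
  fixes D :: "'a::idom poly"
  assumes S: "finite S" "\<And>w. w \<in> S \<Longrightarrow> poly D w = 0" and D: "D \<noteq> 0" "degree D \<le> card S"
  shows "D = smult (lead_coeff D) (\<Prod>w\<in>S. [:-w, 1:])" "degree D = card S"
proof -
  define R where "R = (\<Prod>w\<in>S. [:-w, 1:])"
  have R: "degree R = card S" "lead_coeff R = 1"
    unfolding R_def lead_coeff_prod by (simp_all add: degree_prod_sum_eq)
  obtain h where h: "D = R * h" using prod_linear_factors_dvd[OF S] by (auto simp: R_def)
  have "degree D = card S + degree h"
    using h D R by (metis degree_mult_eq mult_eq_0_iff)
  with D(2) show "degree D = card S" by simp
  with \<open>degree D = card S + degree h\<close> have "degree h = 0" by simp
  then obtain c where "h = [:c:]" by (auto elim: degree_eq_zeroE)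
  then have "D = smult c R" using h by simp
  then show "D = smult (lead_coeff D) (\<Prod>w\<in>S. [:-w, 1:])" using R(2) by (simp add: R_def)
qed

context branched
begin

text \<open>Local constancy in the \<open>t\<close>-plane, tested only on charts with
  \<open>\<tau>\<close> the identity. The index sets are fixed as sets of complex numbers since a
  definition cannot quantify over types; the ball charts, indexed by a fibre, are of this
  kind.\<close>

definition flat :: "(complex \<Rightarrow> complex \<Rightarrow> bool) \<Rightarrow> bool" where
  "flat E \<longleftrightarrow> equivp E \<and> (\<forall>z w. E z w \<longrightarrow> poly P z = poly P w) \<and>
    (\<forall>C (J :: complex set) g x y i j. chart C (\<lambda>t. t) J g \<longrightarrow> x \<in> C \<longrightarrow> y \<in> C \<longrightarrow> i \<in> J \<longrightarrow> j \<in> J \<longrightarrow>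
      E (g i x) (g j x) \<longrightarrow> E (g i y) (g j y))"

lemma flatI:
  assumes "equivp E" "\<And>z w. E z w \<Longrightarrow> poly P z = poly P w"
    "\<And>C (J :: complex set) g x y i j. chart C (\<lambda>t. t) J g \<Longrightarrow> x \<in> C \<Longrightarrow> y \<in> C \<Longrightarrow> i \<in> J \<Longrightarrow> j \<in> J \<Longrightarrow>
      E (g i x) (g j x) \<Longrightarrow> E (g i y) (g j y)"
  shows "flat E"
  unfolding flat_def by (intro conjI allI impI; fact assms)

lemma flat_same_jet: "flat same_jet"
proof (rule flatI)
  show "same_jet (g i y) (g j y)"
    if c: "chart C (\<lambda>t. t) J g" and xy: "x \<in> C" "y \<in> C" and ij: "i \<in> J" "j \<in> J"
      and E: "same_jet (g i x) (g j x)" for C and J :: "complex set" and g x y i j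
  proof -
    define F where "F k x = dt k (g i x) - dt k (g j x)" for k x
    have "F k y = 0" for k
    proof (rule jet_vanishing[where F = F and C = C and \<tau> = "\<lambda>t. t" and ?x0.0 = x])
      show "(F k has_field_derivative deriv (\<lambda>t. t) z * F (Suc k) z) (at z)" if "z \<in> C" for k z
        unfolding F_def right_diff_distrib
        by (intro DERIV_diff chart_dt_derivative[OF c that] ij)
    qed (use chartD[OF c] xy E in \<open>auto simp: F_def same_jet_def\<close>)
    then show ?thesis using chartD(7)[OF c] xy ij by (simp add: same_jet_def F_def)
  qed
  show "equivp same_jet"
    by (rule equivpI) (auto simp: reflp_def symp_def transp_def same_jet_def)
qed (simp add: same_jet_def)

text \<open>Relabelling coefficients along the branches carries a relation on the fibre over
  \<open>y\<close> to one on the fibre over \<open>x\<close>, so any relation separating two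
  branches at \<open>y\<close> already separates them at \<open>x\<close>.\<close>

lemma flat_same_coeff: "flat same_coeff"
proof (rule flatI)
  show "same_coeff (g i y) (g j y)"
    if c: "chart C (\<lambda>t. t) J g" and xy: "x \<in> C" "y \<in> C" and ij: "i \<in> J" "j \<in> J"
      and E: "same_coeff (g i x) (g j x)" for C and J :: "complex set" and g x y i j
  proof -
    note cD = chartD[OF c]
    have "f (g i y) = f (g j y)" if f: "is_relation y f" for f
    proof -
      define f' where "f' v = f (g (the_inv_into J (\<lambda>j. g j x) v) y)" for v
      have f': "f' (g j x) = f (g j y)" if "j \<in> J" for j
        unfolding f'_def using the_inv_into_f_f[OF cD(9)[OF xy(1)] that] by simp
      have "(\<Sum>j\<in>J. of_int (f (g j y)) * dt k (g j y)) = 0" if "1 \<le> k" for k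
        using f that unfolding is_relation_def chart_sum[OF c xy(2)] by blast
      then have "(\<Sum>j\<in>J. of_int (f (g j y)) * dt k (g j x)) = 0" if "1 \<le> k" for k
        using chart_relation_transport[OF c xy(2,1), of 1 "\<lambda>j. of_int (f (g j y))" k] that by blast
      then have "is_relation x f'"
        unfolding is_relation_def chart_sum[OF c xy(1)] by (simp add: f')
      then have "f' (g i x) = f' (g j x)"
        using E cD(7)[OF xy(1) ij(1)] by (simp add: same_coeff_def)
      then show ?thesis using f' ij by simp
    qed
    then show ?thesis using cD(7)[OF xy(2)] ij by (simp add: same_coeff_def)
  qed
  show "equivp same_coeff"
    by (rule equivpI) (auto simp: reflp_def symp_def transp_def same_coeff_def)
qed (simp add: same_coeff_def)

section \<open>Size of the points of a fibre\<close>

lemma norm_poly_bounds: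
  obtains R where "0 < R"
    "\<And>z. R \<le> norm z \<Longrightarrow> norm (lead_coeff P) / 2 * norm z ^ degree P \<le> norm (poly P z)"
    "\<And>z. R \<le> norm z \<Longrightarrow> norm (poly P z) \<le> 2 * norm (lead_coeff P) * norm z ^ degree P"
proof -
  let ?l = "norm (lead_coeff P)"
  have l: "?l > 0" using P_nonzero by simp
  have "isCont (\<lambda>x. norm (poly (reflect_poly P) x)) 0" by (intro continuous_intros)
  then have "((\<lambda>x. norm (poly (reflect_poly P) x)) \<longlongrightarrow> ?l) (at 0)" by (simp add: isCont_def)
  from tendstoD[OF this half_gt_zero[OF l]]
  have "eventually (\<lambda>x. dist (norm (poly (reflect_poly P) x)) ?l < ?l / 2) (at 0)" .
  then obtain d where d: "d > 0"
    "\<And>x. x \<noteq> 0 \<Longrightarrow> norm x < d \<Longrightarrow> dist (norm (poly (reflect_poly P) x)) ?l < ?l / 2"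
    unfolding eventually_at by auto
  have key: "?l / 2 * norm z ^ degree P \<le> norm (poly P z) \<and> norm (poly P z) \<le> 2 * ?l * norm z ^ degree P"
    if z: "2 / d \<le> norm z" for z
  proof -
    have z0: "z \<noteq> 0" using z d(1) by (metis norm_zero not_le zero_less_divide_iff zero_less_numeral)
    have "norm (inverse z) < d"
    proof -
      have "2 \<le> norm z * d" using z d(1) by (simp add: pos_divide_le_eq)
      then have "1 < norm z * d" by simp
      then show ?thesis
        using z0 by (simp add: norm_inverse inverse_eq_divide pos_divide_less_eq norm_divide mult.commute)
    qed
    with d(2)[of "inverse z"] z0 have "dist (norm (poly (reflect_poly P) (inverse z))) ?l < ?l / 2" by simp
    then have b: "?l / 2 \<le> norm (poly (reflect_poly P) (inverse z))" "norm (poly (reflect_poly P) (inverse z)) \<le> 2 * ?l"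
      using l unfolding dist_real_def by linarith+
    have "poly P z = z ^ degree P * poly (reflect_poly P) (inverse z)"
      using poly_reflect_poly_nz[of "inverse z" P] z0 by (simp add: power_inverse)
    then have "norm (poly P z) = norm z ^ degree P * norm (poly (reflect_poly P) (inverse z))"
      by (simp add: norm_mult norm_power)
    then show ?thesis using mult_left_mono[OF b(1), of "norm z ^ degree P"] mult_left_mono[OF b(2), of "norm z ^ degree P"]
      by (simp add: mult_ac)
  qed
  have "0 < 2 / d" using d(1) by simp
  then show ?thesis using key by (intro that[of "2 / d"]) auto
qed

text \<open>Far out, all points of a fibre have comparable modulus; this gives the polynomial growth
  of functions built from a class. The factor 4 is the quotient of the two bounds for
  \<open>norm (poly P z)\<close>, and \<open>4 \<le> 4 ^ n\<close> lets it pass through the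
  \<open>n\<close>-th root.\<close>

lemma fiber_growth:
  obtains R where "0 < R" "\<And>z w. R \<le> norm z \<Longrightarrow> poly P w = poly P z \<Longrightarrow> norm w \<le> 4 * norm z"
proof -
  let ?l = "norm (lead_coeff P)" and ?n = "degree P"
  have l: "?l > 0" using P_nonzero by simp
  obtain R where R: "0 < R"
    "\<And>z. R \<le> norm z \<Longrightarrow> ?l / 2 * norm z ^ ?n \<le> norm (poly P z)"
    "\<And>z. R \<le> norm z \<Longrightarrow> norm (poly P z) \<le> 2 * ?l * norm z ^ ?n"
    by (rule norm_poly_bounds) (rule that)
  have "norm w \<le> 4 * norm z" if z: "R \<le> norm z" "poly P w = poly P z" for z w
  proof (cases "R \<le> norm w")
    case True
    have "?l / 2 * norm w ^ ?n \<le> 2 * ?l * norm z ^ ?n"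
      using R(2)[OF True] R(3)[OF z(1)] z(2) by simp
    then have "norm w ^ ?n \<le> 4 * norm z ^ ?n" using l by (simp add: field_simps)
    also have "\<dots> \<le> 4 ^ ?n * norm z ^ ?n"
      using degP self_le_power[of "4 :: real" ?n] by (intro mult_right_mono) auto
    finally have "norm w ^ ?n \<le> (4 * norm z) ^ ?n" by (simp add: power_mult_distrib)
    then show ?thesis using degP by (subst (asm) power_mono_iff) auto
  qed (use z norm_ge_zero[of z] in linarith)
  with R(1) that show ?thesis by blast
qed

lemma fiber_bounded:
  obtains R where "1 \<le> R" "\<And>w. norm (poly P w) \<le> B \<Longrightarrow> norm w \<le> R"
proof -
  obtain R where R: "0 < R"
    "\<And>z. R \<le> norm z \<Longrightarrow> norm (lead_coeff P) / 2 * norm z ^ degree P \<le> norm (poly P z)"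
    by (rule norm_poly_bounds) (rule that)
  let ?l = "norm (lead_coeff P)"
  have l: "?l > 0" using P_nonzero by simp
  define R' where "R' = max 1 (max R (2 * \<bar>B\<bar> / ?l + 1))"
  have "norm w \<le> R'" if w: "norm (poly P w) \<le> B" for w
  proof (rule ccontr)
    assume "\<not> ?thesis"
    then have w': "1 \<le> norm w" "R \<le> norm w" "2 * \<bar>B\<bar> / ?l < norm w" by (auto simp: R'_def)
    have "norm w ^ 1 \<le> norm w ^ degree P" using w'(1) degP by (intro power_increasing) auto
    then have "?l / 2 * norm w \<le> ?l / 2 * norm w ^ degree P" using l by (intro mult_left_mono) auto
    then have "?l / 2 * norm w \<le> B" using R(2)[OF w'(2)] w by linarith
    moreover have "\<bar>B\<bar> < ?l / 2 * norm w" using w'(3) l by (simp add: field_simps)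
    ultimately show False by linarith
  qed
  then show ?thesis using that[of R'] by (auto simp: R'_def)
qed

section \<open>The polynomial whose fibres are the classes\<close>

text \<open>The product of a class is holomorphic off finitely many points, bounded near them and of
  order \<open>norm z ^ m\<close> at infinity, where \<open>m\<close> is the common size of the
  classes; by Liouville it is a polynomial of degree at most \<open>m\<close>. It takes one value on
  the \<open>m\<close> elements of a class, and it is not constant, so its degree is
  \<open>m\<close> and its generic fibres are the classes. The product is preferred to other
  symmetric functions because it visibly tends to infinity.\<close>

lemma flat_class_polynomial:
  assumes E: "flat E" and z1: "regular (poly P z1)" "z1 \<noteq> w1" "E z1 w1"
  obtains W where "degree W \<ge> 2"
    "\<And>z. regular (poly P z) \<Longrightarrow> W - [:poly W z:] = smult (lead_coeff W) (\<Prod>w\<in>{w. E z w}. [:-w, 1:])"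
proof -
  have eq: "equivp E" and EP: "\<And>z w. E z w \<Longrightarrow> poly P z = poly P w"
    using E by (auto simp: flat_def)
  have tr: "E (g i y) (g j y)"
    if "chart C (\<lambda>t. t) J g" "x \<in> C" "y \<in> C" "i \<in> J" "j \<in> J" "E (g i x) (g j x)"
    for C and J :: "complex set" and g x y i j
    using E that unfolding flat_def by blast
  define cls where "cls z = {w. E z w}" for z
  have cls_fiber: "cls z \<subseteq> fiber (poly P z)" for z using EP by (auto simp: cls_def fiber_def)
  have fin: "finite (cls z)" for z using cls_fiber finite_fiber finite_subset by blast
  have self: "z \<in> cls z" for z using eq by (simp add: cls_def equivp_reflp)
  have cls_eq: "cls w = cls z" if "w \<in> cls z" for z w
    using that eq unfolding cls_def by (metis mem_Collect_eq equivp_def)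
  define K where "K = {z. \<not> regular (poly P z)}"
  have "K = (\<Union>t\<in>{t. \<not> regular t}. fiber t)" by (auto simp: K_def fiber_def)
  then have K: "finite K" using finite_irregular finite_fiber by simp
  have opK: "open (- K)" using K by (simp add: finite_imp_closed open_Compl)
  have conK: "connected (- K)"
    using connected_open_delete_finite[OF open_UNIV connected_UNIV _ K] by (simp add: Compl_eq_Diff_UNIV)
  define W0 where "W0 z = \<Prod>(cls z)" for z
  have loc: "\<exists>N. open N \<and> z0 \<in> N \<and> (\<forall>z\<in>N. card (cls z) = card (cls z0)) \<and> W0 holomorphic_on N"
    if z0: "z0 \<in> - K" for z0
  proof -
    define t0 where "t0 = poly P z0"
    have reg: "regular t0" using z0 by (simp add: K_def t0_def)
    obtain \<epsilon> g where \<epsilon>: "0 < \<epsilon>" and c: "chart (ball t0 \<epsilon>) (\<lambda>t. t) (fiber t0) g"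
      and g0: "\<And>z. z \<in> fiber t0 \<Longrightarrow> g z t0 = z"
      using ball_chart[OF reg] by blast
    note cD = chartD[OF c]
    have z0f: "z0 \<in> fiber t0" by (simp add: fiber_def t0_def)
    have "deriv (poly P) z0 \<noteq> 0"
      using reg z0f by (auto simp: regular_def fiber_def DERIV_imp_deriv[OF poly_DERIV])
    moreover have "poly P holomorphic_on UNIV" by (intro holomorphic_intros)
    ultimately obtain r where r: "r > 0" "inj_on (poly P) (ball z0 r)"
      using has_complex_derivative_locally_injective[OF _ UNIV_I open_UNIV] by metis
    define V where "V = poly P -` ball t0 \<epsilon>"
    have V: "open V" unfolding V_def by (intro open_vimage continuous_intros open_ball)
    have hol: "(\<lambda>z. g j (poly P z)) holomorphic_on V" if "j \<in> fiber t0" for j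
      by (rule holomorphic_on_compose_gen[OF _ cD(4)[OF that], unfolded o_def])
         (auto simp: V_def intro: holomorphic_intros)
    \<comment> \<open>On \<open>N\<close> the branch that starts in \<open>z0\<close> returns the
      point itself, \<open>g z0 (poly P z) = z\<close>, since both sides lie in a ball on which
      \<open>P\<close> is injective. So the class of \<open>z\<close> consists of the continued
      elements of the class of \<open>z0\<close>.\<close>
    define N where "N = V \<inter> (\<lambda>z. g z0 (poly P z)) -` ball z0 r \<inter> ball z0 r"
    have "open N"
      unfolding N_def
      by (intro open_Int open_ball continuous_open_preimage holomorphic_on_imp_continuous_on hol V z0f)
    moreover have "z0 \<in> N"
      using \<epsilon> r(1) g0[OF z0f] by (simp add: N_def V_def t0_def)
    moreover have clsN: "cls z = (\<lambda>j. g j (poly P z)) ` cls z0 \<and> inj_on (\<lambda>j. g j (poly P z)) (cls z0)"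
      if z: "z \<in> N" for z
    proof -
      have Pz: "poly P z \<in> ball t0 \<epsilon>" using z by (simp add: N_def V_def)
      have t0m: "t0 \<in> ball t0 \<epsilon>" using \<epsilon> by simp
      have zg: "g z0 (poly P z) = z"
        using inj_onD[OF r(2), of "g z0 (poly P z)" z] cD(7)[OF Pz z0f] z by (auto simp: N_def)
      have cls0: "cls z0 \<subseteq> fiber t0" using cls_fiber t0_def by blast
      have "w \<in> cls z \<longleftrightarrow> w \<in> (\<lambda>j. g j (poly P z)) ` cls z0" for w
      proof
        assume w: "w \<in> cls z"
        then have "w \<in> fiber (poly P z)" using cls_fiber by blast
        then obtain j where j: "j \<in> fiber t0" "w = g j (poly P z)"
          using cD(6)[OF Pz] by (auto simp: bij_betw_def)
        have "E (g z0 (poly P z)) (g j (poly P z))" using w zg j by (simp add: cls_def)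
        from tr[OF c Pz t0m z0f j(1) this] have "j \<in> cls z0" using g0 z0f j by (simp add: cls_def)
        then show "w \<in> (\<lambda>j. g j (poly P z)) ` cls z0" using j by blast
      next
        assume "w \<in> (\<lambda>j. g j (poly P z)) ` cls z0"
        then obtain j where j: "j \<in> cls z0" "w = g j (poly P z)" by blast
        then have jf: "j \<in> fiber t0" using cls0 by blast
        have "E (g z0 t0) (g j t0)" using j g0 z0f jf by (simp add: cls_def)
        from tr[OF c t0m Pz z0f jf this] show "w \<in> cls z" using zg j by (simp add: cls_def)
      qed
      moreover have "inj_on (\<lambda>j. g j (poly P z)) (cls z0)"
        using cD(9)[OF Pz] cls0 inj_on_subset by blast
      ultimately show ?thesis by blast
    qed
    moreover have "W0 holomorphic_on N"
    proof (rule holomorphic_transform)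
      show "(\<lambda>z. \<Prod>j\<in>cls z0. g j (poly P z)) holomorphic_on N"
      proof (intro holomorphic_on_prod)
        fix j assume "j \<in> cls z0"
        then have "j \<in> fiber t0" using cls_fiber t0_def by blast
        from hol[OF this] show "(\<lambda>z. g j (poly P z)) holomorphic_on N"
          by (rule holomorphic_on_subset) (auto simp: N_def)
      qed
      show "(\<Prod>j\<in>cls z0. g j (poly P z)) = W0 z" if "z \<in> N" for z
        using clsN[OF that] by (simp add: W0_def prod.reindex)
    qed
    moreover have "card (cls z) = card (cls z0)" if "z \<in> N" for z
      using clsN[OF that] card_image by metis
    ultimately show ?thesis by blast
  qed
  define m where "m = card (cls z1)"
  have z1K: "z1 \<in> - K" using z1(1) by (simp add: K_def)
  have "card {z1, w1} \<le> m"
    unfolding m_def using z1(3) self by (intro card_mono fin) (auto simp: cls_def)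
  then have m2: "m \<ge> 2" using z1(2) by simp
  have "(\<lambda>z. card (cls z)) constant_on - K"
  proof (rule locally_constant_imp_constant[OF conK])
    fix z0 assume z0: "z0 \<in> - K"
    then obtain N where N: "open N" "z0 \<in> N" "\<forall>z\<in>N. card (cls z) = card (cls z0)" using loc by blast
    then have "openin (top_of_set (- K)) (- K \<inter> N)" by (simp add: openin_open_Int)
    then show "\<exists>T. openin (top_of_set (- K)) T \<and> z0 \<in> T \<and> (\<forall>x\<in>T. card (cls x) = card (cls z0))"
      using N z0 by blast
  qed
  then have card: "card (cls z) = m" if "z \<in> - K" for z
    using that z1K unfolding constant_on_def m_def by metis
  have W0hol: "W0 holomorphic_on - K"
    unfolding holomorphic_on_open[OF opK]
  proof
    fix z assume "z \<in> - K"
    then obtain N where "open N" "z \<in> N" "W0 holomorphic_on N" using loc by blast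
    then show "\<exists>f'. (W0 has_field_derivative f') (at z)" using holomorphic_derivI by blast
  qed
  have normW0: "norm (W0 z) \<le> R ^ m" if "z \<in> - K" "\<And>w. w \<in> cls z \<Longrightarrow> norm w \<le> R" for z R
  proof -
    have "norm (W0 z) \<le> (\<Prod>w\<in>cls z. R)"
      unfolding W0_def norm_prod_le using that(2)
      by (subst prod_norm[symmetric]) (intro prod_mono conjI norm_ge_zero)
    then show ?thesis using card[OF that(1)] by simp
  qed
  have "\<exists>B. eventually (\<lambda>z. norm (W0 z) \<le> B) (at \<kappa>)" if "\<kappa> \<in> K" for \<kappa>
  proof -
    obtain R where R: "1 \<le> R" "\<And>w. norm (poly P w) \<le> norm (poly P \<kappa>) + 1 \<Longrightarrow> norm w \<le> R"
      using fiber_bounded[of "norm (poly P \<kappa>) + 1"] by metis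
    have "isCont (\<lambda>z. norm (poly P z)) \<kappa>" by (intro continuous_intros)
    then have "eventually (\<lambda>z. norm (poly P z) < norm (poly P \<kappa>) + 1) (at \<kappa>)"
      unfolding isCont_def by (rule order_tendstoD) simp
    moreover have "eventually (\<lambda>z. z \<in> - K) (at \<kappa>)"
    proof -
      have "open (- (K - {\<kappa>}))" by (intro open_Compl finite_imp_closed finite_Diff K)
      then have "eventually (\<lambda>z. z \<in> - (K - {\<kappa>})) (at \<kappa>)" by (rule eventually_at_in_open') simp
      then show ?thesis using eventually_neq_at_within[of \<kappa>] by eventually_elim auto
    qed
    ultimately have "eventually (\<lambda>z. norm (W0 z) \<le> R ^ m) (at \<kappa>)"
    proof eventually_elim
      case (elim z)
      have "norm w \<le> R" if "w \<in> cls z" for w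
      proof -
        have "poly P w = poly P z" using cls_fiber that by (auto simp: fiber_def)
        then show ?thesis using R(2)[of w] elim(1) by simp
      qed
      then show ?case using normW0 elim(2) by blast
    qed
    then show ?thesis by blast
  qed
  then obtain h where h: "h holomorphic_on UNIV" "\<And>z. z \<in> - K \<Longrightarrow> h z = W0 z"
    using removable_finite_singularities[OF K W0hol] by blast
  obtain R1 where R1: "0 < R1" "\<And>z w. R1 \<le> norm z \<Longrightarrow> poly P w = poly P z \<Longrightarrow> norm w \<le> 4 * norm z"
    by (rule fiber_growth) (rule that)
  obtain R2 where R2: "\<And>z. z \<in> K \<Longrightarrow> norm z < R2"
    using finite_imp_bounded[OF K] unfolding bounded_pos_less by blast
  have gr: "norm (h z) \<le> 4 ^ m * norm z ^ m" if z: "max R1 R2 \<le> norm z" for z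
  proof -
    have zK: "z \<in> - K" using R2[of z] z by auto
    have "norm w \<le> 4 * norm z" if "w \<in> cls z" for w
    proof -
      have "poly P w = poly P z" using cls_fiber that by (auto simp: fiber_def)
      then show ?thesis using R1(2)[of z w] z by simp
    qed
    from normW0[OF zK this] show ?thesis by (simp add: h(2)[OF zK] power_mult_distrib)
  qed
  define W where "W = (\<Sum>k\<le>m. monom ((deriv ^^ k) h 0 / fact k) k)"
  have "degree W \<le> m" unfolding W_def
    by (intro degree_sum_le) (auto intro: order_trans[OF degree_monom_le])
  have Wh: "poly W z = h z" for z
  proof -
    have "h z = (\<Sum>k\<le>m. (deriv ^^ k) h 0 / fact k * z ^ k)"
      by (rule Liouville_polynomial[where A = "max R1 R2" and B = "4 ^ m", OF h(1)]) (rule gr)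
    then show ?thesis by (simp add: W_def poly_sum poly_monom)
  qed
  have WW0: "poly W z = W0 z" if "z \<in> - K" for z using Wh h(2) that by simp
  \<comment> \<open>For large \<open>z\<close> every element of its fibre has modulus at least
    \<open>M = norm d + 2 > 1\<close>, so the product of a nonempty class is larger than
    \<open>norm d\<close>.\<close>
  have Wnc: "W \<noteq> [:d:]" for d
  proof
    assume Wd: "W = [:d:]"
    define M where "M = norm d + 2"
    have "compact (cball 0 M :: complex set)" by simp
    then have "bounded (poly P ` cball 0 M)"
      by (intro compact_imp_bounded compact_continuous_image continuous_intros)
    then obtain B where "\<forall>x\<in>poly P ` cball 0 M. norm x \<le> B" unfolding bounded_iff by blast
    then have B: "norm (poly P w) \<le> B" if "norm w \<le> M" for w using that by simp
    obtain R3 where R3: "1 \<le> R3" "\<And>w. norm (poly P w) \<le> B \<Longrightarrow> norm w \<le> R3"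
      using fiber_bounded[of B] by metis
    define z where "z = complex_of_real (max R2 (R3 + 1))"
    have "norm z = max R2 (R3 + 1)" unfolding z_def norm_of_real using R3(1) by (intro abs_of_nonneg) simp
    then have "R2 \<le> norm z" "R3 < norm z" by simp_all
    have zK: "z \<in> - K" using R2[of z] \<open>R2 \<le> norm z\<close> by auto
    have "M \<le> norm w" if "w \<in> cls z" for w
    proof (rule ccontr)
      assume "\<not> ?thesis"
      then have "norm (poly P w) \<le> B" using B by simp
      moreover have "poly P w = poly P z" using cls_fiber that by (auto simp: fiber_def)
      ultimately show False using R3(2)[of z] \<open>R3 < norm z\<close> by simp
    qed
    then have "(\<Prod>w\<in>cls z. M) \<le> norm (W0 z)"
      unfolding W0_def by (subst prod_norm[symmetric]) (intro prod_mono conjI, auto simp: M_def)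
    then have "M ^ m \<le> norm d" using WW0[OF zK] Wd card[OF zK] by simp
    moreover have "M ^ 1 \<le> M ^ m" using m2 by (intro power_increasing) (auto simp: M_def)
    ultimately show False by (simp add: M_def)
  qed
  have fact: "W - [:poly W z:] = smult (lead_coeff W) (\<Prod>w\<in>cls z. [:-w, 1:]) \<and> degree W = m"
    if z: "z \<in> - K" for z
  proof -
    define D where "D = W - [:poly W z:]"
    have degW: "degree W > 0" using Wnc degree_eq_zeroE by (metis gr0I)
    have D': "D = W + [:- poly W z:]"
      unfolding D_def by (metis diff_conv_add_uminus minus_pCons minus_zero)
    have degD: "degree D = degree W" unfolding D' by (rule degree_add_eq_left) (use degW in simp)
    have "coeff [:- poly W z:] (degree W) = 0" by (rule coeff_eq_0) (use degW in simp)
    then have lcD: "lead_coeff D = lead_coeff W" unfolding degD by (simp add: D')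
    have van: "poly D w = 0" if w: "w \<in> cls z" for w
    proof -
      have "poly P w = poly P z" using w cls_fiber by (auto simp: fiber_def)
      then have "w \<in> - K" using z by (simp add: K_def)
      then show ?thesis using WW0 z cls_eq[OF w] by (simp add: D_def W0_def)
    qed
    have ne: "D \<noteq> 0" using degD degW by auto
    have le: "degree D \<le> card (cls z)" using degD \<open>degree W \<le> m\<close> card[OF z] by simp
    have "D = smult (lead_coeff W) (\<Prod>w\<in>cls z. [:-w, 1:])"
      using poly_eq_prod_linear_factors(1)[OF fin van ne le] unfolding lcD .
    moreover have "degree W = m"
      using poly_eq_prod_linear_factors(2)[OF fin van ne le] degD card[OF z] by simp
    ultimately show ?thesis by (simp add: D_def)
  qed
  have d2: "2 \<le> degree W" using conjunct2[OF fact[OF z1K]] m2 by simp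
  have eqn: "W - [:poly W z:] = smult (lead_coeff W) (\<Prod>w\<in>{w. E z w}. [:-w, 1:])"
    if "regular (poly P z)" for z
  proof -
    have "z \<in> - K" using that by (simp add: K_def)
    from conjunct1[OF fact[OF this]] show ?thesis unfolding cls_def .
  qed
  show ?thesis by (rule that[OF d2 eqn])
qed

end

section \<open>The logarithmic relation\<close>

lemma holomorphic_log_on_ball:
  assumes f: "f holomorphic_on ball c e" "\<And>x. x \<in> ball c e \<Longrightarrow> f x \<noteq> 0"
  shows "\<exists>l. l holomorphic_on ball c e \<and> (\<forall>x\<in>ball c e. exp (l x) = f x)"
proof (cases "0 < e")
  case True
  then have "c \<in> ball c e" by simp
  then show ?thesis using holomorphic_logarithm_exists[OF convex_ball open_ball f] by metis
next
  case False
  then have emp: "ball c e = {}" by simp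
  show ?thesis unfolding emp by (intro exI[of _ f]) (simp add: holomorphic_on_empty)
qed

context branched
begin

text \<open>The \<open>t\<close>-derivative of \<open>log ((w - b) / (w - a))\<close> along a
  branch, so independent of the choice of the logarithm.\<close>

definition dlog :: "complex \<Rightarrow> complex \<Rightarrow> complex \<Rightarrow> complex" where
  "dlog a b w = (1 / (w - b) - 1 / (w - a)) / poly (pderiv P) w"

text \<open>With \<open>L\<close> a branch of \<open>log ((w - b) / (w - a))\<close>, the \<open>k\<close>-th \<open>t\<close>-derivative of
  \<open>dt 1 w * L\<close> along \<open>poly P w = t\<close> is \<open>dt (k + 1) w * L + dt_log_rest a b k w\<close>.\<close>

primrec dt_log_rest :: "complex \<Rightarrow> complex \<Rightarrow> nat \<Rightarrow> complex \<Rightarrow> complex" where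
  "dt_log_rest a b 0 = (\<lambda>w. 0)"
| "dt_log_rest a b (Suc k) = (\<lambda>w. dt (Suc k) w * dlog a b w + deriv (dt_log_rest a b k) w / poly (pderiv P) w)"

declare dt_log_rest.simps(2) [simp del]

text \<open>The logarithms are existentially quantified for each \<open>t\<close> separately, so the
  statement does not depend on branches and can return to its starting point without bookkeeping.
  All derivatives are included to make it propagate.\<close>

definition log_relation :: "complex \<Rightarrow> complex \<Rightarrow> complex poly \<Rightarrow> complex \<Rightarrow> bool" where
  "log_relation a b A t \<longleftrightarrow> (\<exists>L. (\<forall>w\<in>fiber t. exp (L w) = (w - b) / (w - a)) \<and>
     (\<forall>k. poly ((pderiv ^^ k) A) t + (\<Sum>w\<in>fiber t. dt (Suc k) w * L w + dt_log_rest a b k w) = 0))"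

lemma open_log_domain: "open {w. poly (pderiv P) w \<noteq> 0 \<and> w \<noteq> a \<and> w \<noteq> b}"
  by (intro open_Collect_conj open_Collect_neq continuous_intros)

lemma dt_log_rest_holomorphic:
  "dt_log_rest a b k holomorphic_on {w. poly (pderiv P) w \<noteq> 0 \<and> w \<noteq> a \<and> w \<noteq> b}"
proof (induction k)
  case (Suc k)
  have "dt (Suc k) holomorphic_on {w. poly (pderiv P) w \<noteq> 0 \<and> w \<noteq> a \<and> w \<noteq> b}"
    using dt_holomorphic by (rule holomorphic_on_subset) auto
  with Suc show ?case
    unfolding dt_log_rest.simps dlog_def
    by (intro holomorphic_intros holomorphic_deriv open_log_domain) auto
qed simp

definition logs_on ::
  "complex \<Rightarrow> complex \<Rightarrow> complex set \<Rightarrow> 'j set \<Rightarrow> ('j \<Rightarrow> complex \<Rightarrow> complex) \<Rightarrow> ('j \<Rightarrow> complex \<Rightarrow> complex) \<Rightarrow> bool"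
  where
  "logs_on a b C J g L \<longleftrightarrow> (\<forall>j\<in>J. L j holomorphic_on C \<and>
    (\<forall>x\<in>C. g j x \<noteq> a \<and> g j x \<noteq> b \<and> exp (L j x) = (g j x - b) / (g j x - a)))"

definition log_jet where
  "log_jet a b A \<tau> J g L k x =
    poly ((pderiv ^^ k) A) (\<tau> x) + (\<Sum>j\<in>J. dt (Suc k) (g j x) * L j x + dt_log_rest a b k (g j x))"

lemma log_jet_derivative:
  assumes c: "chart C \<tau> J g" and L: "logs_on a b C J g L" and x: "x \<in> C"
  shows "(log_jet a b A \<tau> J g L k has_field_derivative deriv \<tau> x * log_jet a b A \<tau> J g L (Suc k) x) (at x)"
proof -
  note cD = chartD[OF c]
  have d\<tau>: "(\<tau> has_field_derivative deriv \<tau> x) (at x)"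
    using cD(1,3) x by (meson holomorphic_derivI)
  have dL: "(L j has_field_derivative deriv \<tau> x * dlog a b (g j x)) (at x)" if j: "j \<in> J" for j
  proof -
    have ne: "g j x \<noteq> a" "g j x \<noteq> b" and Lj: "L j holomorphic_on C"
      and ex: "\<And>y. y \<in> C \<Longrightarrow> exp (L j y) = (g j y - b) / (g j y - a)"
      using L x j by (auto simp: logs_on_def)
    have d: "(L j has_field_derivative deriv (L j) x) (at x)"
      using Lj cD(1) x by (meson holomorphic_derivI)
    define g' where "g' = deriv \<tau> x / poly (pderiv P) (g j x)"
    have dg: "(g j has_field_derivative g') (at x)"
      unfolding g'_def by (rule chart_derivative[OF c x j])
    have "((\<lambda>y. exp (L j y)) has_field_derivative exp (L j x) * deriv (L j) x) (at x)"
      by (rule DERIV_chain2[OF DERIV_exp d])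
    moreover have "((\<lambda>y. exp (L j y)) has_field_derivative
        (g' * (g j x - a) - (g j x - b) * g') / ((g j x - a) * (g j x - a))) (at x)"
    proof (rule has_field_derivative_transform_within_open[OF _ cD(1) x ex[symmetric]])
      show "((\<lambda>y. (g j y - b) / (g j y - a)) has_field_derivative
        (g' * (g j x - a) - (g j x - b) * g') / ((g j x - a) * (g j x - a))) (at x)"
        using ne by (auto intro!: derivative_eq_intros dg)
    qed
    ultimately have "exp (L j x) * deriv (L j) x
        = (g' * (g j x - a) - (g j x - b) * g') / ((g j x - a) * (g j x - a))"
      by (rule DERIV_unique)
    then have "(g j x - b) / (g j x - a) * deriv (L j) x
        = (g' * (g j x - a) - (g j x - b) * g') / ((g j x - a) * (g j x - a))"
      by (simp only: ex[OF x])
    moreover have "l = g' * (1 / v - 1 / u)"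
      if "v / u * l = (g' * u - v * g') / (u * u)" "u \<noteq> 0" "v \<noteq> 0" for l u v :: complex
    proof -
      have "l = (v / u * l) * (u / v)" using that(2,3) by simp
      also have "\<dots> = g' * (1 / v - 1 / u)" unfolding that(1) using that(2,3) by (simp add: field_simps)
      finally show ?thesis .
    qed
    ultimately have "deriv (L j) x = g' * (1 / (g j x - b) - 1 / (g j x - a))"
      using ne by simp
    then show ?thesis using d by (simp add: g'_def dlog_def)
  qed
  have 1: "((\<lambda>y. poly ((pderiv ^^ k) A) (\<tau> y)) has_field_derivative
      deriv \<tau> x * poly ((pderiv ^^ Suc k) A) (\<tau> x)) (at x)"
    using DERIV_chain2[OF poly_DERIV d\<tau>] by (simp add: mult.commute)
  have 2: "((\<lambda>y. dt (Suc k) (g j y) * L j y + dt_log_rest a b k (g j y)) has_field_derivative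
      deriv \<tau> x * (dt (Suc (Suc k)) (g j x) * L j x + dt_log_rest a b (Suc k) (g j x))) (at x)"
    if j: "j \<in> J" for j
  proof -
    have m: "g j x \<in> {w. poly (pderiv P) w \<noteq> 0 \<and> w \<noteq> a \<and> w \<noteq> b}"
      using L x j cD(8) by (auto simp: logs_on_def)
    from DERIV_add[OF DERIV_mult[OF chart_dt_derivative[OF c x j] dL[OF j]]
        chart_derivative_compose[OF c x j dt_log_rest_holomorphic open_log_domain m]]
    have "((\<lambda>y. dt (Suc k) (g j y) * L j y + dt_log_rest a b k (g j y)) has_field_derivative
      deriv \<tau> x * dt (Suc (Suc k)) (g j x) * L j x + deriv \<tau> x * dlog a b (g j x) * dt (Suc k) (g j x)
      + deriv \<tau> x * (deriv (dt_log_rest a b k) (g j x) / poly (pderiv P) (g j x))) (at x)" .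
    then show ?thesis by (rule DERIV_cong) (simp add: dt_log_rest.simps algebra_simps)
  qed
  have eq: "log_jet a b A \<tau> J g L k = (\<lambda>y. poly ((pderiv ^^ k) A) (\<tau> y) +
      (\<Sum>j\<in>J. dt (Suc k) (g j y) * L j y + dt_log_rest a b k (g j y)))"
    by (intro ext) (simp add: log_jet_def)
  show ?thesis
    unfolding eq log_jet_def distrib_left sum_distrib_left
    by (intro DERIV_add[OF 1[unfolded distrib_left]] DERIV_sum 2[unfolded distrib_left])
qed

text \<open>The logarithms of the relation at \<open>x\<close> and the given holomorphic ones differ
  by periods of the exponential, constants that can be added on the whole chart. After this
  correction the jet vanishes at \<open>x\<close>, hence everywhere.\<close>

lemma log_relation_on_chart:
  assumes c: "chart C \<tau> J g" and L: "logs_on a b C J g L" and x: "x \<in> C"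
    and rel: "log_relation a b A (\<tau> x)"
  obtains c where "logs_on a b C J g (\<lambda>j y. L j y + c j)"
    "\<And>k y. y \<in> C \<Longrightarrow> log_jet a b A \<tau> J g (\<lambda>j y. L j y + c j) k y = 0"
proof -
  note cD = chartD[OF c]
  obtain L0 where L0: "\<And>w. w \<in> fiber (\<tau> x) \<Longrightarrow> exp (L0 w) = (w - b) / (w - a)"
    "\<And>k. poly ((pderiv ^^ k) A) (\<tau> x) + (\<Sum>w\<in>fiber (\<tau> x). dt (Suc k) w * L0 w + dt_log_rest a b k w) = 0"
    using rel unfolding log_relation_def by blast
  define s where "s j = L0 (g j x) - L j x" for j
  have s1: "exp (s j) = 1" if j: "j \<in> J" for j
  proof -
    have "g j x \<in> fiber (\<tau> x)" using cD(7)[OF x j] by (simp add: fiber_def)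
    then have "exp (L0 (g j x)) = exp (L j x)" using L0(1) L x j by (simp add: logs_on_def)
    then show ?thesis by (simp add: s_def exp_diff)
  qed
  have Ls: "logs_on a b C J g (\<lambda>j y. L j y + s j)"
    unfolding logs_on_def
  proof (intro ballI conjI)
    fix j assume j: "j \<in> J"
    show "(\<lambda>y. L j y + s j) holomorphic_on C"
      using L j by (intro holomorphic_intros) (auto simp: logs_on_def)
    fix y assume "y \<in> C"
    then show "g j y \<noteq> a" "g j y \<noteq> b" "exp (L j y + s j) = (g j y - b) / (g j y - a)"
      using L j s1[OF j] by (auto simp: logs_on_def exp_add)
  qed
  have "log_jet a b A \<tau> J g (\<lambda>j y. L j y + s j) k x = 0" for k
    using L0(2)[of k] unfolding log_jet_def chart_sum[OF c x] by (simp add: s_def)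
  then have "log_jet a b A \<tau> J g (\<lambda>j y. L j y + s j) k y = 0" if "y \<in> C" for k y
    using jet_vanishing[where F = "log_jet a b A \<tau> J g (\<lambda>j y. L j y + s j)", OF cD(1,2) x cD(3)
        log_jet_derivative[OF c Ls]] that by blast
  with Ls that show ?thesis by blast
qed

lemma log_relation_of_log_jet:
  assumes c: "chart C \<tau> J g" and L: "logs_on a b C J g L" and x: "x \<in> C"
    and 0: "\<And>k. log_jet a b A \<tau> J g L k x = 0"
  shows "log_relation a b A (\<tau> x)"
proof -
  note cD = chartD[OF c]
  define L0 where "L0 w = L (the_inv_into J (\<lambda>j. g j x) w) x" for w
  have L0: "L0 (g j x) = L j x" if "j \<in> J" for j
    using the_inv_into_f_f[OF cD(9)[OF x] that] by (simp add: L0_def)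
  have "exp (L0 w) = (w - b) / (w - a)" if w: "w \<in> fiber (\<tau> x)" for w
  proof -
    obtain j where "j \<in> J" "w = g j x" using w cD(6)[OF x] by (auto simp: bij_betw_def)
    then show ?thesis using L0 L x by (simp add: logs_on_def)
  qed
  moreover have "poly ((pderiv ^^ k) A) (\<tau> x)
      + (\<Sum>w\<in>fiber (\<tau> x). dt (Suc k) w * L0 w + dt_log_rest a b k w) = 0" for k
    using 0[of k] unfolding chart_sum[OF c x] log_jet_def by (simp add: L0)
  ultimately show ?thesis unfolding log_relation_def by blast
qed

text \<open>Removing finitely many values leaves a connected set, and on small discs in it all
  logarithms exist, so validity at one point of a disc is validity at all of them.\<close>

lemma log_relation_everywhere:
  assumes t1: "regular t1" "t1 \<noteq> poly P a" "t1 \<noteq> poly P b" "log_relation a b A t1"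
    and t2: "regular t2" "t2 \<noteq> poly P a" "t2 \<noteq> poly P b"
  shows "log_relation a b A t2"
proof -
  define K where "K = {t. \<not> regular t} \<union> {poly P a, poly P b}"
  have K: "finite K" using finite_irregular by (simp add: K_def)
  have opK: "open (- K)" using K by (simp add: finite_imp_closed open_Compl)
  have conK: "connected (- K)"
    using connected_open_delete_finite[OF open_UNIV connected_UNIV _ K] by (simp add: Compl_eq_Diff_UNIV)
  show ?thesis
  proof (rule connected_induction_simple[OF conK, where P = "log_relation a b A" and a = t1])
    show "t1 \<in> - K" "t2 \<in> - K" "log_relation a b A t1" using t1 t2 by (auto simp: K_def)
    fix t0 assume t0: "t0 \<in> - K"
    then have "regular t0" by (simp add: K_def)
    then obtain \<epsilon>0 g where e0: "0 < \<epsilon>0" and c0: "chart (ball t0 \<epsilon>0) (\<lambda>t. t) (fiber t0) g"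
      using ball_chart by metis
    obtain e1 where e1: "0 < e1" "ball t0 e1 \<subseteq> - K" using opK t0 by (meson open_contains_ball)
    define \<epsilon> where "\<epsilon> = min \<epsilon>0 e1"
    have e: "0 < \<epsilon>" "ball t0 \<epsilon> \<subseteq> - K" using e0 e1 by (auto simp: \<epsilon>_def)
    have c: "chart (ball t0 \<epsilon>) (\<lambda>t. t) (fiber t0) g"
      by (rule chart_subset[OF c0]) (auto simp: \<epsilon>_def)
    note cD = chartD[OF c]
    have ne: "g j x \<noteq> a \<and> g j x \<noteq> b" if "j \<in> fiber t0" "x \<in> ball t0 \<epsilon>" for j x
      using cD(7)[OF that(2,1)] e(2) that(2) by (auto simp: K_def)
    have ex: "\<exists>l. l holomorphic_on ball t0 \<epsilon> \<and> (\<forall>x\<in>ball t0 \<epsilon>. exp (l x) = (g j x - b) / (g j x - a))"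
      if j: "j \<in> fiber t0" for j
    proof -
      have hol: "(\<lambda>x. (g j x - b) / (g j x - a)) holomorphic_on ball t0 \<epsilon>"
        using ne[OF j] by (intro holomorphic_intros cD(4)[OF j]) auto
      have nz: "(g j x - b) / (g j x - a) \<noteq> 0" if "x \<in> ball t0 \<epsilon>" for x
        using ne[OF j that] by simp
      show ?thesis using holomorphic_log_on_ball[OF hol nz] .
    qed
    define L where "L j = (SOME l. l holomorphic_on ball t0 \<epsilon> \<and>
        (\<forall>x\<in>ball t0 \<epsilon>. exp (l x) = (g j x - b) / (g j x - a)))" for j
    have "L j holomorphic_on ball t0 \<epsilon> \<and> (\<forall>x\<in>ball t0 \<epsilon>. exp (L j x) = (g j x - b) / (g j x - a))"
      if "j \<in> fiber t0" for j
      unfolding L_def by (rule someI_ex[OF ex[OF that]])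
    then have L: "logs_on a b (ball t0 \<epsilon>) (fiber t0) g L"
      using ne by (simp add: logs_on_def)
    have "log_relation a b A y" if x: "x \<in> ball t0 \<epsilon>" and y: "y \<in> ball t0 \<epsilon>" and r: "log_relation a b A x" for x y
    proof -
      obtain s where s: "logs_on a b (ball t0 \<epsilon>) (fiber t0) g (\<lambda>j y. L j y + s j)"
        "\<And>k y. y \<in> ball t0 \<epsilon> \<Longrightarrow> log_jet a b A (\<lambda>t. t) (fiber t0) g (\<lambda>j y. L j y + s j) k y = 0"
        by (rule log_relation_on_chart[OF c L x r]) (rule that)
      show ?thesis by (rule log_relation_of_log_jet[OF c s(1) y s(2)[OF y]])
    qed
    then have "\<forall>x\<in>ball t0 \<epsilon>. \<forall>y\<in>ball t0 \<epsilon>. log_relation a b A x \<longrightarrow> log_relation a b A y" by blast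
    moreover have "openin (top_of_set (- K)) (ball t0 \<epsilon>)"
      using e(2) opK by (simp add: openin_open_eq)
    moreover have "t0 \<in> ball t0 \<epsilon>" using e by simp
    ultimately show "\<exists>T. openin (top_of_set (- K)) T \<and> t0 \<in> T \<and>
        (\<forall>x\<in>T. \<forall>y\<in>T. log_relation a b A x \<longrightarrow> log_relation a b A y)"
      by (intro exI[of _ "ball t0 \<epsilon>"] conjI)
  qed
qed


section \<open>Partial fractions and the Cauchy transform\<close>

lemma regular_factorization:
  assumes t: "regular t"
  shows "P - [:t:] = smult (lead_coeff P) (\<Prod>w\<in>fiber t. [:-w, 1:])"
    and "w \<in> fiber t \<Longrightarrow> poly (pderiv P) w = lead_coeff P * (\<Prod>v\<in>fiber t - {w}. w - v)"
proof -
  have D: "P - [:t:] = P + [:-t:]" by (metis diff_conv_add_uminus minus_pCons minus_zero)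
  have deg: "degree (P - [:t:]) = degree P"
    unfolding D by (rule degree_add_eq_left) (use degP in simp)
  have "coeff [:-t:] (degree P) = 0" by (rule coeff_eq_0) (use degP in simp)
  then have lc: "lead_coeff (P - [:t:]) = lead_coeff P" unfolding deg by (simp add: D)
  have ne: "P - [:t:] \<noteq> 0" using deg degP by auto
  show eq: "P - [:t:] = smult (lead_coeff P) (\<Prod>w\<in>fiber t. [:-w, 1:])"
    using poly_eq_prod_linear_factors(1)[OF finite_fiber, of t "P - [:t:]"] ne deg
      card_fiber_regular[OF t]
    unfolding lc by (simp add: fiber_def)
  show "poly (pderiv P) w = lead_coeff P * (\<Prod>v\<in>fiber t - {w}. w - v)" if w: "w \<in> fiber t"
  proof -
    let ?R = "\<Prod>v\<in>fiber t - {w}. [:-v, 1:]"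
    have "P - [:t:] = smult (lead_coeff P) ([:-w, 1:] * ?R)"
      unfolding eq by (subst prod.remove[OF finite_fiber w]) simp
    then have "pderiv (P - [:t:]) = pderiv (smult (lead_coeff P) ([:-w, 1:] * ?R))" by simp
    then have "pderiv P = smult (lead_coeff P) (pderiv ([:-w, 1:] * ?R))"
      by (simp add: pderiv_diff pderiv_smult pderiv_pCons)
    then have "poly (pderiv P) w = lead_coeff P * poly ?R w"
      by (simp only: poly_smult pderiv_mult) (simp add: pderiv_pCons)
    then show ?thesis by (simp add: poly_prod)
  qed
qed

text \<open>Lagrange interpolation: \<open>S\<close> and \<open>q\<close> agree on the
  \<open>degree P\<close> points of the fibre and both have smaller degree, so they
  coincide.\<close>

lemma partial_fractions:
  assumes t: "regular t" and q: "degree q < degree P" and z: "poly P z \<noteq> t"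
  shows "poly q z / (poly P z - t) = (\<Sum>w\<in>fiber t. poly q w / poly (pderiv P) w / (z - w))"
proof -
  let ?l = "lead_coeff P"
  have l: "?l \<noteq> 0" using P_nonzero by simp
  define R where "R w = (\<Prod>v\<in>fiber t - {w}. [:-v, 1:])" for w
  have Rw: "?l * poly (R w) w = poly (pderiv P) w" if "w \<in> fiber t" for w
    using regular_factorization(2)[OF t that] by (simp add: R_def poly_prod)
  have Rv: "poly (R w) v = 0" if "w \<noteq> v" "v \<in> fiber t" for w v
    using that finite_fiber by (auto simp: R_def poly_prod)
  have dP: "poly (pderiv P) w \<noteq> 0" if "w \<in> fiber t" for w
    using t that by (auto simp: regular_def fiber_def)
  define S where "S = (\<Sum>w\<in>fiber t. smult (poly q w / poly (pderiv P) w * ?l) (R w))"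
  have "degree (R w) < degree P" if "w \<in> fiber t" for w
  proof -
    have "degree (R w) = card (fiber t - {w})" by (simp add: R_def degree_prod_sum_eq)
    also have "\<dots> < degree P"
      using card_Diff1_less[OF finite_fiber that] card_fiber_regular[OF t] by simp
    finally show ?thesis .
  qed
  then have "degree S < degree P"
    unfolding S_def by (intro degree_sum_less degP) (meson degree_smult_le le_less_trans)
  then have deg: "degree (q - S) < degree P" using q by (intro degree_diff_less)
  have Sw: "poly S w = poly q w" if w: "w \<in> fiber t" for w
  proof -
    have "poly S w = (\<Sum>v\<in>fiber t. if v = w then poly q w else 0)"
      unfolding S_def poly_sum
    proof (rule sum.cong)
      fix v assume v: "v \<in> fiber t"
      show "poly (smult (poly q v / poly (pderiv P) v * ?l) (R v)) w = (if v = w then poly q w else 0)"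
      proof (cases "v = w")
        case True
        then show ?thesis using Rw[OF w] dP[OF w] by (simp add: mult.assoc)
      qed (simp add: Rv[OF _ w])
    qed simp
    then show ?thesis using w finite_fiber by simp
  qed
  have "q - S = 0"
  proof (rule ccontr)
    assume "q - S \<noteq> 0"
    with poly_eq_prod_linear_factors(2)[OF finite_fiber _ this, of t] deg Sw card_fiber_regular[OF t]
    show False by simp
  qed
  then have qS: "q = S" by simp
  have zw: "z \<noteq> w" if "w \<in> fiber t" for w using z that by (auto simp: fiber_def)
  have PR: "poly P z - t = ?l * ((z - w) * poly (R w) z)" if w: "w \<in> fiber t" for w
  proof -
    have "poly (P - [:t:]) z = ?l * poly (\<Prod>w\<in>fiber t. [:-w, 1:]) z"
      unfolding regular_factorization(1)[OF t] by simp
    also have "(\<Prod>w\<in>fiber t. [:-w, 1:]) = [:-w, 1:] * R w"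
      unfolding R_def by (rule prod.remove[OF finite_fiber w])
    finally show ?thesis by (simp add: left_diff_distrib)
  qed
  have "poly q z / (poly P z - t) = (\<Sum>w\<in>fiber t. poly q w / poly (pderiv P) w * ?l * poly (R w) z / (poly P z - t))"
    by (subst qS) (simp add: S_def poly_sum sum_divide_distrib)
  also have "\<dots> = (\<Sum>w\<in>fiber t. poly q w / poly (pderiv P) w / (z - w))"
  proof (rule sum.cong[OF refl])
    fix w assume w: "w \<in> fiber t"
    have "poly (R w) z \<noteq> 0" using PR[OF w] z by auto
    then show "poly q w / poly (pderiv P) w * ?l * poly (R w) z / (poly P z - t)
        = poly q w / poly (pderiv P) w / (z - w)"
      unfolding PR[OF w] using l zw[OF w] dP[OF w] by (simp add: field_simps)
  qed
  finally show ?thesis .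
qed

text \<open>The degree of \<open>q\<close> is lowered by division by \<open>P\<close>: for
  \<open>q = q0 + P * q1\<close>, the integrand \<open>q / (P - t)\<close> is
  \<open>q1 + q0 / (P - t) + t * q1 / (P - t)\<close>. The quotients are collected in the polynomial
  \<open>A\<close>, which is the same for all \<open>t\<close>.\<close>

lemma Cauchy_transform_expansion:
  fixes q :: "complex poly"
  shows "\<exists>A. \<forall>t. regular t \<longrightarrow> (\<forall>z\<in>closed_segment a b. poly P z \<noteq> t) \<longrightarrow>
    contour_integral (linepath a b) (\<lambda>z. poly q z / (poly P z - t)) =
    poly A t + (\<Sum>w\<in>fiber t. poly q w / poly (pderiv P) w * contour_integral (linepath a b) (\<lambda>z. 1 / (z - w)))"
proof (induction "degree q" arbitrary: q rule: less_induct)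
  case less
  let ?I = "contour_integral (linepath a b)"
  have ci: "(\<lambda>z. poly q z / (poly P z - t)) contour_integrable_on linepath a b"
    if "\<forall>z\<in>closed_segment a b. poly P z \<noteq> t" for t and q :: "complex poly"
    using that by (intro contour_integrable_continuous_linepath continuous_intros) auto
  have cw: "(\<lambda>z. 1 / (z - w)) contour_integrable_on linepath a b"
    if "\<forall>z\<in>closed_segment a b. poly P z \<noteq> t" "w \<in> fiber t" for t w
    using that by (intro contour_integrable_continuous_linepath continuous_intros) (auto simp: fiber_def)
  have low: "?I (\<lambda>z. poly q z / (poly P z - t)) = (\<Sum>w\<in>fiber t. poly q w / poly (pderiv P) w * ?I (\<lambda>z. 1 / (z - w)))"
    if t: "regular t" "\<forall>z\<in>closed_segment a b. poly P z \<noteq> t" and q: "degree q < degree P" for t and q :: "complex poly"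
  proof -
    have "?I (\<lambda>z. poly q z / (poly P z - t))
        = ?I (\<lambda>z. \<Sum>w\<in>fiber t. poly q w / poly (pderiv P) w * (1 / (z - w)))"
      by (rule contour_integral_cong) (use t partial_fractions[OF t(1) q] in auto)
    also have "\<dots> = (\<Sum>w\<in>fiber t. ?I (\<lambda>z. poly q w / poly (pderiv P) w * (1 / (z - w))))"
      by (rule contour_integral_sum[OF finite_fiber]) (intro contour_integrable_lmul cw[OF t(2)])
    also have "\<dots> = (\<Sum>w\<in>fiber t. poly q w / poly (pderiv P) w * ?I (\<lambda>z. 1 / (z - w)))"
      by (intro sum.cong refl contour_integral_lmul cw[OF t(2)])
    finally show ?thesis .
  qed
  show ?case
  proof (cases "degree q < degree P")
    case True
    then show ?thesis using low by (intro exI[of _ 0]) auto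
  next
    case False
    define q0 q1 where "q0 = q mod P" and "q1 = q div P"
    have q: "q = q0 + P * q1" by (simp add: q0_def q1_def)
    have q0: "degree q0 < degree P"
      unfolding q0_def using degree_mod_less'[OF P_nonzero] degP by (metis degree_0)
    have "degree q1 < degree q"
    proof (cases "q1 = 0")
      case True
      then show ?thesis using q q0 False by simp
    next
      case q1: False
      have d: "degree (P * q1) = degree P + degree q1" using q1 P_nonzero by (rule degree_mult_eq[rotated])
      then have "degree q = degree P + degree q1" unfolding q using q0 by (subst degree_add_eq_right) auto
      then show ?thesis using degP by simp
    qed
    from less[OF this] obtain A where A: "\<And>t. regular t \<Longrightarrow> (\<forall>z\<in>closed_segment a b. poly P z \<noteq> t) \<Longrightarrow>
      ?I (\<lambda>z. poly q1 z / (poly P z - t)) =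
      poly A t + (\<Sum>w\<in>fiber t. poly q1 w / poly (pderiv P) w * ?I (\<lambda>z. 1 / (z - w)))" by blast
    have "?I (\<lambda>z. poly q z / (poly P z - t)) = poly ([:?I (poly q1):] + [:0, 1:] * A) t +
        (\<Sum>w\<in>fiber t. poly q w / poly (pderiv P) w * ?I (\<lambda>z. 1 / (z - w)))"
      if t: "regular t" "\<forall>z\<in>closed_segment a b. poly P z \<noteq> t" for t
    proof -
      have ci1: "poly q1 contour_integrable_on linepath a b"
        by (intro contour_integrable_continuous_linepath continuous_intros)
      note i0 = ci[OF t(2), of q0] and i1 = ci[OF t(2), of q1]
      have "?I (\<lambda>z. poly q z / (poly P z - t))
          = ?I (\<lambda>z. poly q1 z + (poly q0 z / (poly P z - t) + t * (poly q1 z / (poly P z - t))))"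
      proof (rule contour_integral_cong)
        fix z assume "z \<in> path_image (linepath a b)"
        then have D: "poly P z - t \<noteq> 0" using t(2) by auto
        define D where "D = poly P z - t"
        have "poly q z = poly q0 z + (D + t) * poly q1 z" by (simp add: q D_def)
        with D show "poly q z / (poly P z - t)
            = poly q1 z + (poly q0 z / (poly P z - t) + t * (poly q1 z / (poly P z - t)))"
          unfolding D_def[symmetric] by (simp add: field_simps)
      qed simp
      also have "\<dots> = ?I (poly q1) + (?I (\<lambda>z. poly q0 z / (poly P z - t)) + t * ?I (\<lambda>z. poly q1 z / (poly P z - t)))"
        unfolding contour_integral_add[OF ci1 contour_integrable_add[OF i0 contour_integrable_lmul[OF i1]]]
          contour_integral_add[OF i0 contour_integrable_lmul[OF i1]] contour_integral_lmul[OF i1] ..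
      also have "\<dots> = poly ([:?I (poly q1):] + [:0, 1:] * A) t
          + (\<Sum>w\<in>fiber t. (poly q0 w + t * poly q1 w) / poly (pderiv P) w * ?I (\<lambda>z. 1 / (z - w)))"
        unfolding low[OF t q0] A[OF t]
        by (simp add: algebra_simps sum.distrib sum_distrib_left add_divide_distrib)
      also have "(\<Sum>w\<in>fiber t. (poly q0 w + t * poly q1 w) / poly (pderiv P) w * ?I (\<lambda>z. 1 / (z - w)))
          = (\<Sum>w\<in>fiber t. poly q w / poly (pderiv P) w * ?I (\<lambda>z. 1 / (z - w)))"
        by (rule sum.cong) (auto simp: q fiber_def)
      finally show ?thesis .
    qed
    then show ?thesis by blast
  qed
qed

text \<open>Multiplying the integrand by \<open>P / t\<close> changes it by a multiple of a moment
  integrand, hence leaves the integral unchanged. After \<open>N\<close> repetitions it is bounded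
  by a multiple of \<open>(M / norm t) ^ N\<close>, and no series has to be integrated term by
  term.\<close>

lemma Cauchy_transform_vanishes:
  assumes mom: "\<And>i. contour_integral (linepath a b) (\<lambda>z. poly P z ^ i * poly q z) = 0"
    and M: "\<And>z. z \<in> closed_segment a b \<Longrightarrow> norm (poly P z) \<le> M" and t: "M < norm t"
  shows "contour_integral (linepath a b) (\<lambda>z. poly q z / (poly P z - t)) = 0"
proof -
  let ?I = "contour_integral (linepath a b)"
  have M0: "0 \<le> M" using M[of a] by (meson ends_in_segment(1) norm_ge_zero order_trans)
  then have t0: "t \<noteq> 0" using t by auto
  have ne: "poly P z - t \<noteq> 0" if "z \<in> closed_segment a b" for z using M[OF that] t by auto
  have cont: "continuous_on (closed_segment a b) (\<lambda>z. poly q z / (poly P z - t))"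
    using ne by (intro continuous_intros) auto
  have "bounded ((\<lambda>z. poly q z / (poly P z - t)) ` closed_segment a b)"
    by (intro compact_imp_bounded compact_continuous_image cont compact_segment)
  then obtain B where "\<forall>x\<in>(\<lambda>z. poly q z / (poly P z - t)) ` closed_segment a b. norm x \<le> B"
    unfolding bounded_iff by blast
  then have B: "norm (poly q z / (poly P z - t)) \<le> B" if "z \<in> closed_segment a b" for z using that by blast
  have B0: "0 \<le> B" using B[of a] by (meson ends_in_segment(1) norm_ge_zero order_trans)
  have cN: "(\<lambda>z. (poly P z / t) ^ N * (poly q z / (poly P z - t))) contour_integrable_on linepath a b" for N
    using t0 by (intro contour_integrable_continuous_linepath continuous_intros cont) auto
  have step: "?I (\<lambda>z. poly q z / (poly P z - t)) = ?I (\<lambda>z. (poly P z / t) ^ N * (poly q z / (poly P z - t)))" for N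
  proof (induction N)
    case (Suc N)
    have cm: "(\<lambda>z. poly P z ^ N * poly q z) contour_integrable_on linepath a b"
      by (intro contour_integrable_continuous_linepath continuous_intros)
    have "?I (\<lambda>z. (poly P z / t) ^ Suc N * (poly q z / (poly P z - t)))
        = ?I (\<lambda>z. (poly P z / t) ^ N * (poly q z / (poly P z - t)) + (1 / t ^ Suc N) * (poly P z ^ N * poly q z))"
    proof (rule contour_integral_cong)
      fix z assume "z \<in> path_image (linepath a b)"
      then have "poly P z - t \<noteq> 0" using ne by auto
      then have "poly P z / t * (poly q z / (poly P z - t)) = poly q z / (poly P z - t) + poly q z / t"
        using t0 by (simp add: field_simps)
      then have "(poly P z / t) ^ Suc N * (poly q z / (poly P z - t))
          = (poly P z / t) ^ N * (poly q z / (poly P z - t) + poly q z / t)"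
        by (simp only: power_Suc2 mult.assoc)
      then show "(poly P z / t) ^ Suc N * (poly q z / (poly P z - t))
          = (poly P z / t) ^ N * (poly q z / (poly P z - t)) + (1 / t ^ Suc N) * (poly P z ^ N * poly q z)"
        by (simp add: distrib_left power_divide mult.commute)
    qed simp
    also have "\<dots> = ?I (\<lambda>z. (poly P z / t) ^ N * (poly q z / (poly P z - t))) + (1 / t ^ Suc N) * ?I (\<lambda>z. poly P z ^ N * poly q z)"
      by (subst contour_integral_add[OF cN contour_integrable_lmul[OF cm]]) (simp only: contour_integral_lmul[OF cm])
    finally show ?case using Suc mom by simp
  qed simp
  have bnd: "norm (?I (\<lambda>z. poly q z / (poly P z - t))) \<le> (M / norm t) ^ N * (B * norm (b - a))" for N
  proof -
    have "norm (?I (\<lambda>z. (poly P z / t) ^ N * (poly q z / (poly P z - t)))) \<le> ((M / norm t) ^ N * B) * norm (b - a)"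
    proof (rule contour_integral_bound_linepath[OF cN])
      show "0 \<le> (M / norm t) ^ N * B" using M0 B0 by simp
      fix z assume z: "z \<in> closed_segment a b"
      have "norm ((poly P z / t) ^ N) \<le> (M / norm t) ^ N"
        unfolding norm_power norm_divide using M[OF z] by (intro power_mono divide_right_mono) auto
      then show "norm ((poly P z / t) ^ N * (poly q z / (poly P z - t))) \<le> (M / norm t) ^ N * B"
        unfolding norm_mult[of "(poly P z / t) ^ N"] using B[OF z] M0 by (intro mult_mono) auto
    qed
    then show ?thesis using step[of N] by (simp add: mult.assoc)
  qed
  have lim: "(\<lambda>N. (M / norm t) ^ N * (B * norm (b - a))) \<longlonglongrightarrow> 0 * (B * norm (b - a))"
    using M0 t by (intro tendsto_intros LIMSEQ_realpow_zero) (auto simp: divide_less_eq)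
  have "norm (?I (\<lambda>z. poly q z / (poly P z - t))) \<le> 0 * (B * norm (b - a))"
    by (rule LIMSEQ_le_const[OF lim]) (use bnd in blast)
  then show ?thesis by simp
qed

end

section \<open>From vanishing moments to a logarithmic relation\<close>

lemma contour_integral_inverse_linepath:
  fixes w :: complex
  assumes w: "norm a < norm w" "norm b < norm w"
  shows "contour_integral (linepath a b) (\<lambda>z. 1 / (z - w)) = Ln (1 - b / w) - Ln (1 - a / w)"
proof -
  have w0: "w \<noteq> 0" using w by auto
  have sub: "closed_segment a b \<subseteq> ball 0 (norm w)"
    using w by (intro closed_segment_subset) auto
  have "((\<lambda>z. 1 / (z - w)) has_contour_integral
      (Ln (1 - pathfinish (linepath a b) / w) - Ln (1 - pathstart (linepath a b) / w))) (linepath a b)"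
  proof (rule contour_integral_primitive)
    fix z :: complex assume "z \<in> ball 0 (norm w)"
    then have zw: "norm (z / w) < 1" using w0 by (simp add: norm_divide)
    then have "Re (1 - z / w) > 0" using complex_Re_le_cmod[of "z / w"] by simp
    then have "1 - z / w \<notin> \<real>\<^sub>\<le>\<^sub>0" using complex_nonpos_Reals_iff by auto
    moreover have "z \<noteq> w" using zw w0 by auto
    ultimately show "((\<lambda>z. Ln (1 - z / w)) has_field_derivative 1 / (z - w)) (at z within ball 0 (norm w))"
      using w0 by (auto intro!: derivative_eq_intros simp: field_simps)
  qed (use sub in auto)
  then show ?thesis by (simp add: contour_integral_unique)
qed

context branched
begin

text \<open>For large \<open>t\<close> all points of the fibre lie outside a disc containing
  \<open>a\<close> and \<open>b\<close>. There \<open>Ln (1 - b / w) - Ln (1 - a / w)\<close> is at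
  once the integral of \<open>1 / (z - w)\<close> over the segment and a holomorphic logarithm of
  \<open>(w - b) / (w - a)\<close>.\<close>

lemma log_relation_exists:
  assumes mom: "\<And>i. contour_integral (linepath a b) (\<lambda>z. poly P z ^ i * poly (pderiv Q) z) = 0"
  obtains A t where "regular t" "t \<noteq> poly P a" "t \<noteq> poly P b" "log_relation a b A t"
proof -
  have "bounded (poly P ` cball 0 (max (norm a) (norm b)))"
    by (intro compact_imp_bounded compact_continuous_image continuous_intros compact_cball)
  then obtain M0 where "\<forall>x\<in>poly P ` cball 0 (max (norm a) (norm b)). norm x \<le> M0"
    unfolding bounded_iff by blast
  then have M0: "norm (poly P w) \<le> M0" if "norm w \<le> max (norm a) (norm b)" for w
    using that by simp
  define M where "M = Max (insert M0 (norm ` {t. \<not> regular t}))"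
  have M: "M0 \<le> M" "\<And>t. \<not> regular t \<Longrightarrow> norm t \<le> M"
    unfolding M_def using finite_irregular by (auto intro!: Max_ge)
  have seg: "norm (poly P z) \<le> M" if "z \<in> closed_segment a b" for z
  proof -
    have "closed_segment a b \<subseteq> cball 0 (max (norm a) (norm b))"
      by (intro closed_segment_subset) auto
    then have "norm z \<le> max (norm a) (norm b)" using that by auto
    then show ?thesis using M0[of z] M(1) by linarith
  qed
  obtain A where A: "\<And>t. regular t \<Longrightarrow> (\<forall>z\<in>closed_segment a b. poly P z \<noteq> t) \<Longrightarrow>
    contour_integral (linepath a b) (\<lambda>z. poly (pderiv Q) z / (poly P z - t)) =
    poly A t + (\<Sum>w\<in>fiber t. poly (pderiv Q) w / poly (pderiv P) w *
      contour_integral (linepath a b) (\<lambda>z. 1 / (z - w)))"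
    using Cauchy_transform_expansion[of a b "pderiv Q"] by blast
  have large: "norm a < norm w \<and> norm b < norm w" if "M < norm (poly P w)" for w
  proof (rule ccontr)
    assume "\<not> ?thesis"
    then have "norm w \<le> max (norm a) (norm b)" by auto
    then show False using M0[of w] M(1) that by linarith
  qed
  have rel: "poly A t + (\<Sum>w\<in>fiber t. dt 1 w * (Ln (1 - b / w) - Ln (1 - a / w))) = 0"
    if t: "M < norm t" for t
  proof -
    have reg: "regular t" using M(2)[of t] t by linarith
    have ne: "\<forall>z\<in>closed_segment a b. poly P z \<noteq> t"
    proof
      fix z assume "z \<in> closed_segment a b"
      then show "poly P z \<noteq> t" using seg[of z] t by auto
    qed
    have "0 = poly A t + (\<Sum>w\<in>fiber t. poly (pderiv Q) w / poly (pderiv P) w *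
        contour_integral (linepath a b) (\<lambda>z. 1 / (z - w)))"
      unfolding A[OF reg ne, symmetric] by (rule Cauchy_transform_vanishes[OF mom seg t, symmetric])
    also have "(\<Sum>w\<in>fiber t. poly (pderiv Q) w / poly (pderiv P) w *
        contour_integral (linepath a b) (\<lambda>z. 1 / (z - w)))
      = (\<Sum>w\<in>fiber t. dt 1 w * (Ln (1 - b / w) - Ln (1 - a / w)))"
    proof (rule sum.cong[OF refl])
      fix w assume "w \<in> fiber t"
      then have "norm a < norm w" "norm b < norm w" using large[of w] t by (auto simp: fiber_def)
      then show "poly (pderiv Q) w / poly (pderiv P) w * contour_integral (linepath a b) (\<lambda>z. 1 / (z - w))
          = dt 1 w * (Ln (1 - b / w) - Ln (1 - a / w))"
        by (simp add: contour_integral_inverse_linepath dt_1)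
    qed
    finally show ?thesis by simp
  qed
  \<comment> \<open>The summand 2 leaves room for a disc of radius 1 around \<open>t1\<close> on
    which all values still exceed \<open>M\<close> in modulus.\<close>
  define t1 where "t1 = complex_of_real (\<bar>M\<bar> + 2)"
  have t1: "norm t1 = \<bar>M\<bar> + 2" unfolding t1_def norm_of_real by simp
  have reg1: "regular t1" using M(2)[of t1] t1 by linarith
  obtain \<epsilon>0 g where e0: "0 < \<epsilon>0" and c0: "chart (ball t1 \<epsilon>0) (\<lambda>t. t) (fiber t1) g"
    using ball_chart[OF reg1] by metis
  define C where "C = ball t1 (min \<epsilon>0 1)"
  have c: "chart C (\<lambda>t. t) (fiber t1) g"
    by (rule chart_subset[OF c0]) (auto simp: C_def)
  note cD = chartD[OF c]
  have t1C: "t1 \<in> C" using e0 by (simp add: C_def)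
  have big: "M < norm x" if "x \<in> C" for x
  proof -
    have "norm t1 - norm x \<le> norm (t1 - x)" by (rule norm_triangle_ineq2)
    moreover have "norm (t1 - x) < 1" using that by (simp add: C_def dist_norm)
    ultimately show ?thesis using t1 by linarith
  qed
  define L where "L = (\<lambda>j x. Ln (1 - b / g j x) - Ln (1 - a / g j x))"
  have gbig: "norm a < norm (g j x) \<and> norm b < norm (g j x)" if "x \<in> C" "j \<in> fiber t1" for x j
    using large[of "g j x"] big[OF that(1)] cD(7)[OF that] by simp
  have slit: "1 - c / v \<notin> \<real>\<^sub>\<le>\<^sub>0" if "norm c < norm v" for c v :: complex
  proof -
    have "norm (c / v) < 1" using that by (simp add: norm_divide divide_less_eq)
    then have "Re (1 - c / v) > 0" using complex_Re_le_cmod[of "c / v"] by simp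
    then show ?thesis using complex_nonpos_Reals_iff by auto
  qed
  have logs: "logs_on a b C (fiber t1) g L"
    unfolding logs_on_def
  proof (intro ballI conjI)
    fix j assume j: "j \<in> fiber t1"
    have g0: "g j x \<noteq> 0" if "x \<in> C" for x using gbig[OF that j] by auto
    show "L j holomorphic_on C"
      unfolding L_def
      by (intro holomorphic_intros cD(4)[OF j] slit g0) (use gbig[OF _ j] in blast)+
    fix x assume x: "x \<in> C"
    show ne: "g j x \<noteq> a" "g j x \<noteq> b" using gbig[OF x j] by auto
    have "1 - b / g j x \<noteq> 0" "1 - a / g j x \<noteq> 0" using ne g0[OF x] by auto
    then show "exp (L j x) = (g j x - b) / (g j x - a)"
      using g0[OF x] ne by (simp add: L_def exp_diff field_simps)
  qed
  \<comment> \<open>The relation of order 0 holds on an open set, not just at \<open>t1\<close>, so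
    it may be differentiated there.\<close>
  have jet0: "log_jet a b A (\<lambda>t. t) (fiber t1) g L k x = 0" if "x \<in> C" for k x
    using that
  proof (induction k arbitrary: x)
    case 0
    have "(\<Sum>w\<in>fiber x. dt 1 w * (Ln (1 - b / w) - Ln (1 - a / w))) = (\<Sum>j\<in>fiber t1. dt 1 (g j x) * L j x)"
      unfolding L_def using chart_sum[OF c 0] by simp
    then show ?case using rel[OF big[OF 0]] by (simp add: log_jet_def)
  next
    case (Suc k)
    have "(log_jet a b A (\<lambda>t. t) (fiber t1) g L k has_field_derivative 0) (at x)"
      by (rule has_field_derivative_transform_within_open[OF DERIV_const[of 0] cD(1) Suc.prems])
         (simp add: Suc.IH)
    from DERIV_unique[OF this log_jet_derivative[OF c logs Suc.prems]] show ?case by simp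
  qed
  have "log_relation a b A t1" by (rule log_relation_of_log_jet[OF c logs t1C jet0[OF t1C]])
  moreover have "t1 \<noteq> poly P a" "t1 \<noteq> poly P b"
    using seg[of a] seg[of b] t1 by auto
  ultimately show ?thesis by (intro that[OF reg1])
qed

end

section \<open>The integer relation at an endpoint\<close>

text \<open>An injective function takes the value \<open>c\<close> at most once and to first order.
  So a logarithm of \<open>\<psi> s - c\<close> is a single-valued function of \<open>s\<close>,
  plus \<open>log s\<close> in case \<open>c\<close> is the centre; only this last term notices a
  turn around 0.\<close>

lemma injective_minus_point_factor:
  fixes \<psi> :: "complex \<Rightarrow> complex"
  assumes \<rho>: "0 < \<rho>" and \<psi>: "\<psi> holomorphic_on ball 0 \<rho>" "inj_on \<psi> (ball 0 \<rho>)"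
    and c: "\<psi> 0 = c \<or> c \<notin> \<psi> ` ball 0 \<rho>"
  shows "\<exists>l. l holomorphic_on ball 0 \<rho> \<and>
    (\<forall>s\<in>ball 0 \<rho>. \<psi> s - c = (if \<psi> 0 = c then s else 1) * exp (l s))"
proof (cases "\<psi> 0 = c")
  case True
  define h where "h s = (if s = 0 then deriv \<psi> 0 else (\<psi> s - \<psi> 0) / (s - 0))" for s
  have "(\<lambda>s. if s = 0 then deriv \<psi> 0 else (\<psi> s - \<psi> 0) / (s - 0)) holomorphic_on ball 0 \<rho>"
    by (rule pole_lemma[OF \<psi>(1)]) (use \<rho> in simp)
  then have hh: "h holomorphic_on ball 0 \<rho>" by (simp add: h_def[abs_def])
  have h0: "h s \<noteq> 0" if "s \<in> ball 0 \<rho>" for s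
  proof (cases "s = 0")
    case True
    then show ?thesis
      using holomorphic_injective_imp_regular[OF \<psi>(1) open_ball \<psi>(2), of 0] \<rho> by (simp add: h_def)
  next
    case False
    then have "\<psi> s \<noteq> \<psi> 0" using inj_onD[OF \<psi>(2), of s 0] that \<rho> by auto
    then show ?thesis using False by (simp add: h_def)
  qed
  obtain l where l: "l holomorphic_on ball 0 \<rho>" "\<forall>s\<in>ball 0 \<rho>. exp (l s) = h s"
    using holomorphic_log_on_ball[OF hh h0] by blast
  have "\<psi> s - c = s * exp (l s)" if "s \<in> ball 0 \<rho>" for s
    using l(2) that True by (auto simp: h_def)
  then show ?thesis using l(1) True by auto
next
  case False
  then have "\<psi> s - c \<noteq> 0" if "s \<in> ball 0 \<rho>" for s using c that by auto
  moreover have "(\<lambda>s. \<psi> s - c) holomorphic_on ball 0 \<rho>" by (intro holomorphic_intros \<psi>(1))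
  ultimately obtain l where "l holomorphic_on ball 0 \<rho>" "\<forall>s\<in>ball 0 \<rho>. exp (l s) = \<psi> s - c"
    using holomorphic_log_on_ball[of "\<lambda>s. \<psi> s - c"] by blast
  then show ?thesis using False by (intro exI[of _ l]) auto
qed

context branched
begin

text \<open>Continuing the logarithmic relation \<open>N\<close> times around \<open>poly P b\<close>, so that all branches
  return, changes only the logarithms of the branches ending in \<open>b\<close> or \<open>a\<close>; the difference of the
  two relations is an integer relation between the branches.\<close>

lemma endpoint_relation:
  assumes ab: "a \<noteq> b"
    and rel: "\<And>t. regular t \<Longrightarrow> t \<noteq> poly P a \<Longrightarrow> t \<noteq> poly P b \<Longrightarrow> log_relation a b A t"
    and \<delta>: "0 < \<delta>"
  obtains \<eta> where "0 < \<eta>"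
    "\<And>z. z \<noteq> b \<Longrightarrow> norm (z - b) < \<eta> \<Longrightarrow> \<exists>f. is_relation (poly P z) f \<and> 0 < f z \<and>
       (\<forall>w. poly P w = poly P z \<longrightarrow> 0 < f w \<longrightarrow> norm (w - b) < \<delta>)"
proof -
  define t0 where "t0 = poly P b"
  have bf: "b \<in> fiber t0" by (simp add: fiber_def t0_def)
  \<comment> \<open>\<open>\<delta>1\<close> keeps \<open>a\<close> out of the coordinate discs
    centred at other points of the fibre, whether or not \<open>a\<close> lies over
    \<open>poly P b\<close> too. For \<open>b\<close>, disjointness of the discs does the
    same.\<close>
  have "\<exists>d>0. \<forall>z\<in>fiber t0. z \<noteq> a \<longrightarrow> d \<le> dist a z"
    using finite_set_avoid[OF finite_fiber] by blast
  then obtain \<delta>1 where \<delta>1: "0 < \<delta>1" "\<And>z. z \<in> fiber t0 \<Longrightarrow> z \<noteq> a \<Longrightarrow> \<delta>1 \<le> dist a z"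
    by auto
  define \<delta>' where "\<delta>' = min \<delta> \<delta>1"
  have "0 < \<delta>'" using \<delta> \<delta>1 by (simp add: \<delta>'_def)
  then obtain \<rho> \<epsilon> d \<psi> where c: "coordinates_near t0 \<delta>' \<rho> \<epsilon> d \<psi>"
    using coordinates_near_exist by metis
  note cD = coordinates_nearD[OF c]
  define C where "C = {\<zeta>. Re \<zeta> < ln \<epsilon>}"
  define \<tau> where "\<tau> = (\<lambda>\<zeta>. t0 + exp \<zeta>)"
  define J where "J = (SIGMA z:fiber t0. {..<d z})"
  define \<sigma> where "\<sigma> j \<zeta> = exp ((\<zeta> + 2 * of_real pi * \<i> * of_nat (snd j)) / of_nat (d (fst j)))" for j :: "complex \<times> nat" and \<zeta>
  define g where "g = (\<lambda>j \<zeta>. \<psi> (fst j) (\<sigma> j \<zeta>))"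
  have "(\<lambda>(z, k) \<zeta>. \<psi> z (exp ((\<zeta> + 2 * of_real pi * \<i> * of_nat k) / of_nat (d z)))) = g"
    by (auto simp: g_def \<sigma>_def fun_eq_iff)
  with halfplane_chart[OF c] have ch: "chart C \<tau> J g"
    by (simp add: C_def \<tau>_def J_def)
  note chD = chartD[OF ch]
  have Jf: "fst j \<in> fiber t0" "0 < d (fst j)" if "j \<in> J" for j
    using that cD(3) by (auto simp: J_def)
  have \<sigma>0: "\<sigma> j \<zeta> \<noteq> 0" for j \<zeta> by (simp add: \<sigma>_def)
  have \<sigma>\<rho>: "\<sigma> j \<zeta> \<in> ball 0 \<rho>" if j: "j \<in> J" and \<zeta>: "\<zeta> \<in> C" for j \<zeta>
  proof (rule cD(10)[OF Jf(1)[OF j]])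
    have dj: "of_nat (d (fst j)) \<noteq> (0 :: complex)" using Jf(2)[OF j] by simp
    have "\<sigma> j \<zeta> ^ d (fst j) = exp (\<zeta> + 2 * of_real pi * \<i> * of_nat (snd j))"
      unfolding \<sigma>_def using dj by (simp flip: exp_of_nat_mult)
    then have "norm (\<sigma> j \<zeta>) ^ d (fst j) = exp (Re \<zeta>)"
      by (simp add: norm_exp_eq_Re flip: norm_power)
    also have "\<dots> < \<epsilon>" using \<zeta> cD(2) by (simp add: C_def) (metis exp_less_mono exp_ln)
    finally show "norm (\<sigma> j \<zeta>) ^ d (fst j) < \<epsilon>" .
  qed
  have avoid: "\<psi> z 0 = v \<or> v \<notin> \<psi> z ` ball 0 \<rho>" if z: "z \<in> fiber t0" and v: "v = a \<or> v = b" for z v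
  proof (cases "v = z")
    case True
    then show ?thesis using cD(6)[OF z] by simp
  next
    case False
    have "v \<notin> \<psi> z ` ball 0 \<rho>"
    proof
      assume "v \<in> \<psi> z ` ball 0 \<rho>"
      then obtain s where s: "s \<in> ball 0 \<rho>" "v = \<psi> z s" by blast
      show False
      proof (cases "v = b")
        case True
        then have "\<psi> z s = \<psi> b 0" using s cD(6)[OF bf] by simp
        then have "z = b" using cD(11)[OF z bf s(1), of 0] cD(1) by simp
        then show False using False True by simp
      next
        case vb: False
        then have "v = a" using v by simp
        then have "\<delta>1 \<le> dist a z" using \<delta>1(2)[OF z] False by simp
        moreover have "dist z a < \<delta>'" using cD(8)[OF z s(1)] s(2) \<open>v = a\<close> by simp
        ultimately show False by (simp add: \<delta>'_def dist_commute)
      qed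
    qed
    then show ?thesis ..
  qed
  define lg where "lg v z = (SOME l. l holomorphic_on ball 0 \<rho> \<and>
    (\<forall>s\<in>ball 0 \<rho>. \<psi> z s - v = (if \<psi> z 0 = v then s else 1) * exp (l s)))" for v z
  have lg: "lg v z holomorphic_on ball 0 \<rho> \<and>
      (\<forall>s\<in>ball 0 \<rho>. \<psi> z s - v = (if \<psi> z 0 = v then s else 1) * exp (lg v z s))"
    if "z \<in> fiber t0" "v = a \<or> v = b" for v z
    unfolding lg_def
    by (rule someI_ex[OF injective_minus_point_factor[OF cD(1) cD(4)[OF that(1)] cD(5)[OF that(1)] avoid[OF that]]])
  \<comment> \<open>The sign with which \<open>log s\<close> enters
    \<open>log ((w - b) / (w - a))\<close> in the disc around \<open>z\<close>. It is positive only
    for \<open>z = b\<close>, which is what the endpoint \<open>b\<close> will be recognised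
    by.\<close>
  define e where "e z = (if z = b then 1 else 0) - (if z = a then 1 else 0 :: int)" for z
  have exp_e: "exp (of_int (e z) * X) = (if z = b then exp X else 1) / (if z = a then exp X else 1)"
    for z X :: complex
    using ab by (auto simp: e_def exp_minus inverse_eq_divide)
  define L where "L = (\<lambda>j \<zeta>. of_int (e (fst j)) * ((\<zeta> + 2 * of_real pi * \<i> * of_nat (snd j)) / of_nat (d (fst j)))
      + (lg b (fst j) (\<sigma> j \<zeta>) - lg a (fst j) (\<sigma> j \<zeta>)))"
  have \<sigma>hol: "\<sigma> j holomorphic_on C" if "j \<in> J" for j
    unfolding \<sigma>_def[abs_def] using Jf(2)[OF that] by (intro holomorphic_intros) auto
  have logs: "logs_on a b C J g L"
    unfolding logs_on_def
  proof (intro ballI conjI)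
    fix j assume j: "j \<in> J"
    note z = Jf(1)[OF j]
    have "(\<lambda>\<zeta>. lg v (fst j) (\<sigma> j \<zeta>)) holomorphic_on C" if "v = a \<or> v = b" for v
      by (rule holomorphic_on_compose_gen[OF \<sigma>hol[OF j] conjunct1[OF lg[OF z that]], unfolded o_def])
         (use \<sigma>\<rho>[OF j] in auto)
    then show "L j holomorphic_on C"
      unfolding L_def using Jf(2)[OF j] by (intro holomorphic_intros) auto
    fix \<zeta> assume \<zeta>: "\<zeta> \<in> C"
    have f: "g j \<zeta> - v = (if fst j = v then \<sigma> j \<zeta> else 1) * exp (lg v (fst j) (\<sigma> j \<zeta>))"
      if "v = a \<or> v = b" for v
      using lg[OF z that] \<sigma>\<rho>[OF j \<zeta>] cD(6)[OF z] by (simp add: g_def)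
    show ne: "g j \<zeta> \<noteq> a" "g j \<zeta> \<noteq> b" using f[of a] f[of b] \<sigma>0[of j \<zeta>] by (auto split: if_splits)
    have "exp (L j \<zeta>) = exp (of_int (e (fst j)) * ((\<zeta> + 2 * of_real pi * \<i> * of_nat (snd j)) / of_nat (d (fst j))))
        * (exp (lg b (fst j) (\<sigma> j \<zeta>)) / exp (lg a (fst j) (\<sigma> j \<zeta>)))"
      by (simp add: L_def exp_add exp_diff)
    also have "exp (of_int (e (fst j)) * ((\<zeta> + 2 * of_real pi * \<i> * of_nat (snd j)) / of_nat (d (fst j))))
        = (if fst j = b then \<sigma> j \<zeta> else 1) / (if fst j = a then \<sigma> j \<zeta> else 1)"
      unfolding \<sigma>_def by (rule exp_e)
    finally show "exp (L j \<zeta>) = (g j \<zeta> - b) / (g j \<zeta> - a)" using f[of a] f[of b] by simp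
  qed
  \<comment> \<open>A common multiple of the ramification indices: after \<open>N\<close> turns of
    \<open>t\<close> every branch is back, while \<open>log s\<close> has gained 2 pi i times the
    integer \<open>N div d z\<close>.\<close>
  define N where "N = (\<Prod>z\<in>fiber t0. d z)"
  have dN: "d z dvd N" if "z \<in> fiber t0" for z unfolding N_def using finite_fiber that by (rule dvd_prodI)
  have N0: "0 < N" unfolding N_def using cD(3) finite_fiber by (simp add: prod_pos)
  define s where "s = 2 * of_real pi * \<i> * of_nat N"
  have sC: "\<zeta> + s \<in> C" if "\<zeta> \<in> C" for \<zeta> using that by (simp add: C_def s_def)
  have \<sigma>s: "\<sigma> j (\<zeta> + s) = \<sigma> j \<zeta>" if j: "j \<in> J" for j \<zeta>
  proof -
    obtain m where m: "N = d (fst j) * m" using dN[OF Jf(1)[OF j]] by blast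
    have "(\<zeta> + s + 2 * of_real pi * \<i> * of_nat (snd j)) / of_nat (d (fst j))
        = (\<zeta> + 2 * of_real pi * \<i> * of_nat (snd j)) / of_nat (d (fst j)) + of_real (of_int (2 * int m) * pi) * \<i>"
      using Jf(2)[OF j] by (simp add: s_def m field_simps)
    then show ?thesis unfolding \<sigma>_def exp_eq by blast
  qed
  have gs: "g j (\<zeta> + s) = g j \<zeta>" if "j \<in> J" for j \<zeta> using \<sigma>s[OF that] by (simp add: g_def)
  have \<tau>s: "\<tau> (\<zeta> + s) = \<tau> \<zeta>" for \<zeta>
  proof -
    have "exp (\<zeta> + s) = exp \<zeta>" unfolding exp_eq s_def by (rule exI[of _ "int N"]) simp
    then show ?thesis by (simp add: \<tau>_def)
  qed
  have Ls: "L j (\<zeta> + s) - L j \<zeta> = 2 * of_real pi * \<i> * of_int (e (fst j) * int (N div d (fst j)))"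
    if j: "j \<in> J" for j \<zeta>
  proof -
    obtain m where m: "N = d (fst j) * m" using dN[OF Jf(1)[OF j]] by blast
    have "L j (\<zeta> + s) - L j \<zeta> = of_int (e (fst j)) * (s / of_nat (d (fst j)))"
      by (simp add: L_def \<sigma>s[OF j] add_divide_distrib distrib_left)
    then show ?thesis using Jf(2)[OF j] by (simp add: s_def m)
  qed
  have C_ne: "of_real (ln \<epsilon> - 1) \<in> C" by (simp add: C_def)
  have reg: "log_relation a b A (\<tau> \<zeta>)" if \<zeta>: "\<zeta> \<in> C" for \<zeta>
  proof (rule rel[OF chD(5)[OF \<zeta>]])
    have *: "\<tau> \<zeta> \<noteq> poly P v" if v: "v = a \<or> v = b" for v
    proof
      assume "\<tau> \<zeta> = poly P v"
      then have "v \<in> fiber (\<tau> \<zeta>)" by (simp add: fiber_def)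
      then obtain j where "j \<in> J" "v = g j \<zeta>" using chD(6)[OF \<zeta>] unfolding bij_betw_def by (metis imageE)
      then show False using logs \<zeta> v by (auto simp: logs_on_def)
    qed
    then show "\<tau> \<zeta> \<noteq> poly P a" "\<tau> \<zeta> \<noteq> poly P b" by auto
  qed
  obtain h where h: "logs_on a b C J g (\<lambda>j y. L j y + h j)"
    "\<And>k y. y \<in> C \<Longrightarrow> log_jet a b A \<tau> J g (\<lambda>j y. L j y + h j) k y = 0"
    by (rule log_relation_on_chart[OF ch logs C_ne reg[OF C_ne]]) (rule that)
  have int_rel: "(\<Sum>j\<in>J. of_int (e (fst j) * int (N div d (fst j))) * dt (Suc k) (g j \<zeta>)) = 0"
    if \<zeta>: "\<zeta> \<in> C" for k \<zeta>
  proof -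
    have "0 = log_jet a b A \<tau> J g (\<lambda>j y. L j y + h j) k (\<zeta> + s) - log_jet a b A \<tau> J g (\<lambda>j y. L j y + h j) k \<zeta>"
      using h(2)[OF sC[OF \<zeta>]] h(2)[OF \<zeta>] by simp
    also have "\<dots> = (\<Sum>j\<in>J. dt (Suc k) (g j (\<zeta> + s)) * (L j (\<zeta> + s) + h j) + dt_log_rest a b k (g j (\<zeta> + s)))
        - (\<Sum>j\<in>J. dt (Suc k) (g j \<zeta>) * (L j \<zeta> + h j) + dt_log_rest a b k (g j \<zeta>))"
      by (simp add: log_jet_def \<tau>s)
    also have "\<dots> = (\<Sum>j\<in>J. dt (Suc k) (g j \<zeta>) * (L j (\<zeta> + s) - L j \<zeta>))"
      unfolding sum_subtractf[symmetric] by (rule sum.cong) (simp_all add: gs algebra_simps)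
    also have "\<dots> = (\<Sum>j\<in>J. 2 * of_real pi * \<i> * (of_int (e (fst j) * int (N div d (fst j))) * dt (Suc k) (g j \<zeta>)))"
      by (rule sum.cong) (simp_all add: Ls)
    also have "\<dots> = 2 * of_real pi * \<i> * (\<Sum>j\<in>J. of_int (e (fst j) * int (N div d (fst j))) * dt (Suc k) (g j \<zeta>))"
      by (rule sum_distrib_left[symmetric])
    finally show ?thesis by simp
  qed
  have "open (\<psi> b ` ball 0 \<rho>)"
    by (rule open_mapping_thm3[OF cD(4)[OF bf] open_ball cD(5)[OF bf]])
  moreover have "open (poly P -` ball t0 \<epsilon>)" by (intro open_vimage continuous_intros open_ball)
  moreover have "b \<in> \<psi> b ` ball 0 \<rho>" using cD(1,6) bf by (metis centre_in_ball imageI)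
  moreover have "b \<in> poly P -` ball t0 \<epsilon>" using cD(2) by (simp add: t0_def)
  ultimately obtain \<eta> where \<eta>: "0 < \<eta>" "ball b \<eta> \<subseteq> \<psi> b ` ball 0 \<rho> \<inter> poly P -` ball t0 \<epsilon>"
    by (meson IntI open_Int openE)
  show ?thesis
  proof (rule that[OF \<eta>(1)])
    fix z assume z: "z \<noteq> b" "norm (z - b) < \<eta>"
    then have zm: "z \<in> \<psi> b ` ball 0 \<rho>" "norm (poly P z - t0) < \<epsilon>"
      using \<eta>(2) by (auto simp: dist_norm norm_minus_commute subset_iff)
    then obtain s where s: "s \<in> ball 0 \<rho>" "z = \<psi> b s" by blast
    have s0: "s \<noteq> 0" using s(2) z(1) cD(6)[OF bf] by auto
    then obtain l where l: "s = exp l" by (metis exp_Ln)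
    \<comment> \<open>Chosen such that \<open>\<zeta> / d b\<close> is a logarithm of the coordinate
      \<open>s\<close> of \<open>z\<close>; thus \<open>z\<close> is the branch
      \<open>(b, 0)\<close> at \<open>\<zeta>\<close>.\<close>
    define \<zeta> where "\<zeta> = of_nat (d b) * l"
    have Ps: "poly P z = t0 + s ^ d b" using cD(9)[OF bf s(1)] s(2) by simp
    have exp\<zeta>: "exp \<zeta> = s ^ d b" by (simp add: \<zeta>_def l exp_of_nat_mult)
    then have \<tau>\<zeta>: "\<tau> \<zeta> = poly P z" using Ps by (simp add: \<tau>_def)
    have "exp (Re \<zeta>) < \<epsilon>" using zm(2) Ps exp\<zeta> by (metis add_diff_cancel_left' norm_exp_eq_Re)
    then have \<zeta>C: "\<zeta> \<in> C" using cD(2) by (simp add: C_def) (metis exp_less_cancel_iff exp_ln)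
    have j0: "(b, 0) \<in> J" using bf cD(3)[OF bf] by (simp add: J_def)
    have gj0: "g (b, 0) \<zeta> = z"
      using cD(3)[OF bf] by (simp add: g_def \<sigma>_def \<zeta>_def s(2) l)
    define f where "f w = (let j = the_inv_into J (\<lambda>j. g j \<zeta>) w in e (fst j) * int (N div d (fst j)))" for w
    have f: "f (g j \<zeta>) = e (fst j) * int (N div d (fst j))" if "j \<in> J" for j
      using the_inv_into_f_f[OF chD(9)[OF \<zeta>C] that] by (simp add: f_def)
    have "is_relation (\<tau> \<zeta>) f"
      unfolding is_relation_def chart_sum[OF ch \<zeta>C]
    proof (intro allI impI)
      fix k :: nat assume "1 \<le> k"
      then obtain k' where "k = Suc k'" by (cases k) auto
      then show "(\<Sum>j\<in>J. of_int (f (g j \<zeta>)) * dt k (g j \<zeta>)) = 0"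
        using int_rel[OF \<zeta>C, of k'] by (simp add: f)
    qed
    moreover have "0 < f z"
    proof -
      have "0 < N div d b" using dN[OF bf] N0 cD(3)[OF bf] by (auto elim: dvdE)
      then show ?thesis using f[OF j0] ab by (simp add: gj0 e_def)
    qed
    moreover have "norm (w - b) < \<delta>" if w: "poly P w = poly P z" "0 < f w" for w
    proof -
      have "w \<in> fiber (\<tau> \<zeta>)" using w(1) \<tau>\<zeta> by (simp add: fiber_def)
      then obtain j where j: "j \<in> J" "w = g j \<zeta>" using chD(6)[OF \<zeta>C] unfolding bij_betw_def by (metis imageE)
      have "0 < e (fst j) * int (N div d (fst j))" using f[OF j(1)] j(2) w(2) by simp
      then have "0 < e (fst j)" by (simp add: zero_less_mult_iff)
      then have "fst j = b" by (auto simp: e_def split: if_splits)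
      then have "w \<in> ball b \<delta>'" using cD(8)[OF bf] \<sigma>\<rho>[OF j(1) \<zeta>C] j(2) by (simp add: g_def)
      then show ?thesis by (simp add: \<delta>'_def dist_norm norm_minus_commute)
    qed
    ultimately show "\<exists>f. is_relation (poly P z) f \<and> 0 < f z \<and>
       (\<forall>w. poly P w = poly P z \<longrightarrow> 0 < f w \<longrightarrow> norm (w - b) < \<delta>)"
      unfolding \<tau>\<zeta> by blast
  qed
qed

end

section \<open>The theorem\<close>

lemma eventually_at_notin_finite:
  fixes c :: "'a::t1_space"
  assumes "finite F"
  shows "eventually (\<lambda>z. z \<notin> F) (at c)"
proof -
  have "open (- (F - {c}))" using assms by (intro open_Compl finite_imp_closed finite_Diff)
  then have "eventually (\<lambda>z. z \<in> - (F - {c})) (at c)" by (rule eventually_at_in_open') simp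
  then show ?thesis using eventually_neq_at_within[of c] by eventually_elim auto
qed

section \<open>Moments as differences of antiderivatives\<close>

lemma poly_antiderivative_exists:
  fixes p :: "'a::field_char_0 poly"
  shows "\<exists>S. pderiv S = p"
proof (intro exI poly_eqI)
  let ?S = "\<Sum>i\<le>degree p. monom (coeff p i / of_nat (Suc i)) (Suc i)"
  fix n
  have "coeff ?S (Suc n) = (\<Sum>i\<le>degree p. if i = n then coeff p n / of_nat (Suc n) else 0)"
    unfolding coeff_sum by (rule sum.cong) (auto simp: coeff_monom)
  also have "\<dots> = coeff p n / of_nat (Suc n)" by (auto simp: coeff_eq_0)
  finally show "coeff (pderiv ?S) n = coeff p n" unfolding coeff_pderiv
    by (simp del: of_nat_Suc)
qed

lemma contour_integral_linepath_pderiv: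
  "contour_integral (linepath a b) (poly (pderiv S)) = poly S b - poly S a"
proof -
  have "(poly (pderiv S) has_contour_integral
      (poly S (pathfinish (linepath a b)) - poly S (pathstart (linepath a b)))) (linepath a b)"
    by (rule contour_integral_primitive[where S = UNIV]) (auto intro: poly_DERIV DERIV_subset)
  then show ?thesis by (simp add: contour_integral_unique)
qed

text \<open>The form without integrals passes to composition factors: replacing \<open>a\<close> and
  \<open>b\<close> by their images under \<open>W\<close> requires no change of the path of
  integration.\<close>

lemma moments_vanish_iff:
  "(\<forall>i. contour_integral (linepath a b) (\<lambda>z. poly P z ^ i * poly (pderiv Q) z) = 0) \<longleftrightarrow>
   (\<forall>i S. pderiv S = P ^ i * pderiv Q \<longrightarrow> poly S a = poly S b)"
proof -
  have "contour_integral (linepath a b) (\<lambda>z. poly P z ^ i * poly (pderiv Q) z) = 0 \<longleftrightarrow>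
      (\<forall>S. pderiv S = P ^ i * pderiv Q \<longrightarrow> poly S a = poly S b)" for i
  proof -
    have eq: "contour_integral (linepath a b) (\<lambda>z. poly P z ^ i * poly (pderiv Q) z) = poly S b - poly S a"
      if "pderiv S = P ^ i * pderiv Q" for S
    proof -
      have "(\<lambda>z. poly P z ^ i * poly (pderiv Q) z) = poly (pderiv S)" by (auto simp: that)
      then show ?thesis by (simp add: contour_integral_linepath_pderiv)
    qed
    obtain S where "pderiv S = P ^ i * pderiv Q" using poly_antiderivative_exists by blast
    with eq show ?thesis by (metis eq_iff_diff_eq_0)
  qed
  then show ?thesis by simp
qed

lemma pderiv_composition_moment:
  "pderiv S = Pt ^ i * pderiv Qt \<Longrightarrow>
   pderiv (pcompose S W) = pcompose Pt W ^ i * pderiv (pcompose Qt W)"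
  by (simp add: pderiv_pcompose pcompose_mult pcompose_power mult.assoc)

lemma moments_vanish_of_composition:
  assumes "poly W a = poly W b"
  shows "contour_integral (linepath a b)
    (\<lambda>z. poly (pcompose Pt W) z ^ i * poly (pderiv (pcompose Qt W)) z) = 0"
proof -
  obtain S where "pderiv S = Pt ^ i * pderiv Qt" using poly_antiderivative_exists by blast
  from pderiv_composition_moment[OF this]
  have "(\<lambda>z. poly (pcompose Pt W) z ^ i * poly (pderiv (pcompose Qt W)) z) = poly (pderiv (pcompose S W))"
    by auto
  then show ?thesis using assms by (simp add: contour_integral_linepath_pderiv poly_pcompose)
qed

text \<open>With \<open>c\<close> as the only point over its value, \<open>W\<close> minus that
  value is a multiple of a power of \<open>x - c\<close>.\<close>

lemma totally_ramified_derivative: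
  fixes W :: "complex poly"
  assumes deg: "degree W > 0" and c: "\<And>x. poly W x = poly W c \<Longrightarrow> x = c"
  shows "poly (pderiv W) x = lead_coeff W * of_nat (degree W) * (x - c) ^ (degree W - 1)"
proof -
  define D where "D = W + [:- poly W c:]"
  have degD: "degree D = degree W" unfolding D_def by (rule degree_add_eq_left) (use deg in simp)
  have "coeff [:- poly W c:] (degree W) = 0" by (rule coeff_eq_0) (use deg in simp)
  then have lcD: "lead_coeff D = lead_coeff W" unfolding degD by (simp add: D_def)
  have roots: "{z. poly D z = 0} = {c}" using c by (auto simp: D_def)
  have dec: "D = smult (lead_coeff D) ([:-c, 1:] ^ order c D)"
    using complex_poly_decompose[of D] unfolding roots by simp
  have "lead_coeff D \<noteq> 0" unfolding lcD using deg by auto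
  then have "degree D = order c D"
    by (subst dec) (simp add: degree_power_eq)
  then have ord: "order c D = degree W" using degD by simp
  have "D = smult (lead_coeff W) ([:-c, 1:] ^ degree W)"
    using dec unfolding lcD ord .
  moreover have "pderiv W = pderiv D" by (simp add: D_def pderiv_add pderiv_pCons)
  ultimately have "pderiv W = smult (lead_coeff W) (pderiv ([:-c, 1:] ^ degree W))"
    by (simp add: pderiv_smult)
  then show ?thesis by (simp add: pderiv_power pderiv_pCons mult.assoc)
qed

context branched
begin

section \<open>Consequences for the class polynomial\<close>

lemma exists_regular_avoiding:
  assumes "finite F"
  obtains z where "regular (poly P z)" "poly P z \<notin> F"
proof -
  have "finite (\<Union>t\<in>F \<union> {t. \<not> regular t}. fiber t)"
    using assms finite_irregular finite_fiber by auto
  then obtain z where "z \<notin> (\<Union>t\<in>F \<union> {t. \<not> regular t}. fiber t)"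
    using ex_new_if_finite infinite_UNIV_char_0 by blast
  then show ?thesis using that[of z] by (auto simp: fiber_def)
qed

text \<open>Expansion in powers of \<open>W\<close> by repeated division:
  \<open>S - [:poly S z0:]\<close> vanishes on the class of \<open>z0\<close> and is divisible by
  \<open>W - [:poly W z0:]\<close>. The quotient is again constant on classes, except perhaps over
  \<open>poly P z0\<close>, where the divisor vanishes; the set \<open>F\<close> collects such
  exceptional values.\<close>

lemma descend_to_class_polynomial:
  assumes E: "flat E" and W: "degree W \<ge> 2"
    "\<And>z. regular (poly P z) \<Longrightarrow> W - [:poly W z:] = smult (lead_coeff W) (\<Prod>w\<in>{w. E z w}. [:-w, 1:])"
    and S: "finite F" "\<And>z w. regular (poly P z) \<Longrightarrow> poly P z \<notin> F \<Longrightarrow> E z w \<Longrightarrow> poly S w = poly S z"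
  shows "\<exists>T. S = pcompose T W"
  using S
proof (induction "degree S" arbitrary: S F rule: less_induct)
  case less
  have eq: "equivp E" and EP: "\<And>z w. E z w \<Longrightarrow> poly P z = poly P w"
    using E by (auto simp: flat_def)
  have fin: "finite {w. E z w}" for z
    by (rule finite_subset[OF _ finite_fiber[of "poly P z"]]) (use EP in \<open>auto simp: fiber_def\<close>)
  have l: "lead_coeff W \<noteq> 0" using W(1) by auto
  have Wroots: "poly W w = poly W z \<longleftrightarrow> E z w" if "regular (poly P z)" for z w
  proof -
    have "poly W w = poly W z \<longleftrightarrow> poly (W - [:poly W z:]) w = 0" by simp
    also have "\<dots> \<longleftrightarrow> (\<Prod>v\<in>{v. E z v}. w - v) = 0"
      unfolding W(2)[OF that] using l by (simp add: poly_prod)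
    also have "\<dots> \<longleftrightarrow> E z w" using fin[of z] by auto
    finally show ?thesis .
  qed
  show ?case
  proof (cases "degree S = 0")
    case True
    then obtain c where "S = [:c:]" by (auto elim: degree_eq_zeroE)
    then show ?thesis by (intro exI[of _ "[:c:]"]) simp
  next
    case False
    obtain z0 where z0: "regular (poly P z0)" "poly P z0 \<notin> F"
      using exists_regular_avoiding[OF less.prems(1)] by blast
    define D where "D = S - [:poly S z0:]"
    have "(\<Prod>w\<in>{w. E z0 w}. [:-w, 1:]) dvd D"
      by (rule prod_linear_factors_dvd[OF fin]) (use less.prems(2)[OF z0] in \<open>simp add: D_def\<close>)
    then have "W - [:poly W z0:] dvd D" unfolding W(2)[OF z0(1)] using l by (simp add: smult_dvd_iff)
    then obtain S1 where S1: "D = (W - [:poly W z0:]) * S1" by blast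
    have "D \<noteq> 0"
    proof
      assume "D = 0"
      then have "S = [:poly S z0:]" by (simp add: D_def)
      then show False using False by (metis degree_pCons_0)
    qed
    have "degree D \<le> degree S" unfolding D_def using degree_diff_le[of S "degree S" "[:poly S z0:]"] by simp
    moreover have "degree D = degree (W - [:poly W z0:]) + degree S1"
      using S1 \<open>D \<noteq> 0\<close> by (metis degree_mult_eq mult_eq_0_iff)
    moreover have "degree (W + [:-poly W z0:]) = degree W" by (rule degree_add_eq_left) (use W(1) in simp)
    then have "degree (W - [:poly W z0:]) = degree W"
      by (metis diff_conv_add_uminus minus_pCons minus_zero)
    ultimately have "degree S1 < degree S" using W(1) by simp
    moreover have "poly S1 w = poly S1 z"
      if z: "regular (poly P z)" "poly P z \<notin> insert (poly P z0) F" "E z w" for z w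
    proof -
      have "\<not> E z0 z" using EP z(2) by auto
      then have "poly W z - poly W z0 \<noteq> 0" using Wroots[OF z0(1)] by simp
      moreover have "poly W w = poly W z" using Wroots[OF z(1)] z(3) by simp
      moreover have "poly D w = poly D z" using less.prems(2)[OF z(1) _ z(3)] z(2) by (simp add: D_def)
      ultimately show ?thesis by (simp add: S1)
    qed
    ultimately obtain T where T: "S1 = pcompose T W"
      using less.hyps[of S1 "insert (poly P z0) F"] less.prems(1) by blast
    have "S = [:poly S z0:] + (W - [:poly W z0:]) * S1" using S1 by (simp add: D_def algebra_simps)
    also have "\<dots> = pcompose ([:poly S z0:] + [:- poly W z0, 1:] * T) W"
    proof -
      have "pcompose [:- poly W z0, 1:] W = W - [:poly W z0:]" by (simp add: pcompose_pCons)
      then show ?thesis by (simp only: T pcompose_add pcompose_mult pcompose_const)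
    qed
    finally show ?thesis by blast
  qed
qed

text \<open>For \<open>z\<close> near \<open>c\<close>, all elements of its class share the positive
  coefficient of \<open>z\<close> and therefore lie within \<open>\<delta>\<close> of
  \<open>c\<close>. If \<open>x\<close> is at distance \<open>2 * \<delta>\<close> from
  \<open>c\<close>, the factorisation of \<open>W - [:poly W z:]\<close> keeps
  \<open>poly W x - poly W z\<close> away from 0, although it tends to 0 as \<open>z\<close> tends
  to \<open>c\<close>.\<close>

lemma class_polynomial_totally_ramified:
  assumes W: "degree W \<ge> 2"
    "\<And>z. regular (poly P z) \<Longrightarrow> W - [:poly W z:] = smult (lead_coeff W) (\<Prod>w\<in>{w. same_coeff z w}. [:-w, 1:])"
    and near: "\<And>\<delta>. 0 < \<delta> \<Longrightarrow> \<exists>\<eta>>0. \<forall>z. z \<noteq> c \<longrightarrow> norm (z - c) < \<eta> \<longrightarrow>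
      (\<exists>f. is_relation (poly P z) f \<and> 0 < f z \<and> (\<forall>w. poly P w = poly P z \<longrightarrow> 0 < f w \<longrightarrow> norm (w - c) < \<delta>))"
    and x: "poly W x = poly W c"
  shows "x = c"
proof (rule ccontr)
  assume "x \<noteq> c"
  define \<delta> where "\<delta> = norm (x - c) / 2"
  have \<delta>: "0 < \<delta>" using \<open>x \<noteq> c\<close> by (simp add: \<delta>_def)
  obtain \<eta> where \<eta>: "0 < \<eta>" "\<And>z. z \<noteq> c \<Longrightarrow> norm (z - c) < \<eta> \<Longrightarrow>
      \<exists>f. is_relation (poly P z) f \<and> 0 < f z \<and> (\<forall>w. poly P w = poly P z \<longrightarrow> 0 < f w \<longrightarrow> norm (w - c) < \<delta>)"
    using near[OF \<delta>] by auto
  have l: "lead_coeff W \<noteq> 0" using W(1) by auto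
  define B where "B = norm (lead_coeff W) * \<delta> ^ degree W"
  have B: "0 < B" using l \<delta> by (simp add: B_def)
  have "finite (\<Union>t\<in>{t. \<not> regular t}. fiber t)" using finite_irregular finite_fiber by auto
  from eventually_at_notin_finite[OF this, of c]
  have e1: "eventually (\<lambda>z. regular (poly P z)) (at c)" by (simp add: fiber_def)
  have "isCont (poly W) c" by (intro continuous_intros)
  then have e2: "eventually (\<lambda>z. dist (poly W z) (poly W c) < B) (at c)"
    unfolding isCont_def using B by (rule tendstoD)
  have e3: "eventually (\<lambda>z. dist z c < \<eta>) (at c)"
    using \<eta>(1) by (auto simp: eventually_at)
  have "eventually (\<lambda>z. regular (poly P z) \<and> dist (poly W z) (poly W c) < B \<and> dist z c < \<eta> \<and> z \<noteq> c) (at c)"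
    using e1 e2 e3 eventually_neq_at_within[of c] by eventually_elim auto
  then obtain z where z: "regular (poly P z)" "dist (poly W z) (poly W c) < B" "dist z c < \<eta>" "z \<noteq> c"
    using eventually_happens'[OF at_neq_bot] by blast
  obtain f where f: "is_relation (poly P z) f" "0 < f z"
      "\<And>w. poly P w = poly P z \<Longrightarrow> 0 < f w \<Longrightarrow> norm (w - c) < \<delta>"
    using \<eta>(2)[of z] z by (auto simp: dist_norm)
  let ?C = "{w. same_coeff z w}"
  have close: "\<delta> \<le> norm (x - w)" if "w \<in> ?C" for w
  proof -
    have "poly P w = poly P z" "f w = f z" using that f(1) by (auto simp: same_coeff_def)
    then have "norm (w - c) < \<delta>" using f(2,3) by simp
    moreover have "norm (x - c) \<le> norm (x - w) + norm (w - c)"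
      using norm_triangle_ineq[of "x - w" "w - c"] by simp
    ultimately show ?thesis by (simp add: \<delta>_def)
  qed
  have "degree (W + [:-poly W z:]) = degree W" by (rule degree_add_eq_left) (use W(1) in simp)
  then have "degree (W - [:poly W z:]) = degree W"
    by (metis diff_conv_add_uminus minus_pCons minus_zero)
  then have card: "card ?C = degree W"
    unfolding W(2)[OF z(1)] using l by (simp add: degree_prod_sum_eq)
  have "poly (W - [:poly W z:]) x = lead_coeff W * (\<Prod>w\<in>?C. x - w)"
    unfolding W(2)[OF z(1)] by (simp add: poly_prod)
  then have "norm (poly W x - poly W z) = norm (lead_coeff W) * (\<Prod>w\<in>?C. norm (x - w))"
    by (simp add: norm_mult prod_norm)
  moreover have "(\<Prod>w\<in>?C. \<delta>) \<le> (\<Prod>w\<in>?C. norm (x - w))"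
    using close \<delta> by (intro prod_mono) auto
  ultimately have "B \<le> norm (poly W x - poly W z)"
    using l by (simp add: B_def card mult_left_mono)
  then show False using z(2) x by (simp add: dist_norm norm_minus_commute)
qed

end

section \<open>Induction on the exponent of the degree\<close>

theorem moments_vanish_imp_composition:
  fixes P Q :: "complex poly"
  assumes p: "prime p" and deg: "degree P = p ^ k" and q: "pderiv Q \<noteq> 0" and ab: "a \<noteq> b"
    and mom: "\<And>i S. pderiv S = P ^ i * pderiv Q \<Longrightarrow> poly S a = poly S b"
  shows "\<exists>Pt Qt W. P = pcompose Pt W \<and> Q = pcompose Qt W \<and> poly W a = poly W b"
  using deg q ab mom
proof (induction k arbitrary: P Q a b rule: less_induct)
  case (less k)
  have p1: "p > 1" using p by (rule prime_gt_1_nat)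
  interpret branched P Q by unfold_locales (use less.prems(1) p1 in simp)
  \<comment> \<open>Reversing the segment preserves vanishing moments, so the endpoint relation is
    available at \<open>a\<close> as well as at \<open>b\<close>.\<close>
  have near: "\<exists>\<eta>>0. \<forall>z. z \<noteq> d \<longrightarrow> norm (z - d) < \<eta> \<longrightarrow>
      (\<exists>f. is_relation (poly P z) f \<and> 0 < f z \<and> (\<forall>w. poly P w = poly P z \<longrightarrow> 0 < f w \<longrightarrow> norm (w - d) < \<delta>))"
    if cd: "(c = a \<and> d = b) \<or> (c = b \<and> d = a)" and \<delta>: "0 < \<delta>" for c d \<delta>
  proof -
    have "contour_integral (linepath c d) (\<lambda>z. poly P z ^ i * poly (pderiv Q) z) = 0" for i
      using moments_vanish_iff[of c d P Q] less.prems(4) cd by metis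
    then obtain A t where t: "regular t" "t \<noteq> poly P c" "t \<noteq> poly P d" "log_relation c d A t"
      by (rule log_relation_exists) (rule that)
    have "c \<noteq> d" using cd less.prems(3) by auto
    then show ?thesis
      by (rule endpoint_relation[OF _ log_relation_everywhere[OF t] \<delta>]) blast+
  qed
  show ?case
  proof (cases k)
    case 0
    have "\<exists>\<eta>>0. \<forall>z. z \<noteq> b \<longrightarrow> norm (z - b) < \<eta> \<longrightarrow> (\<exists>f. is_relation (poly P z) f \<and> 0 < f z)"
      using near[of a b 1] by (simp, blast)
    then obtain \<eta> where \<eta>: "0 < \<eta>" "\<And>z. z \<noteq> b \<Longrightarrow> norm (z - b) < \<eta> \<Longrightarrow> \<exists>f. is_relation (poly P z) f \<and> 0 < f z"
      by auto
    have e1: "eventually (\<lambda>z. z \<notin> {z. poly (pderiv Q) z = 0}) (at b)"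
      by (rule eventually_at_notin_finite[OF poly_roots_finite[OF less.prems(2)]])
    have e2: "eventually (\<lambda>z. dist z b < \<eta>) (at b)" using \<eta>(1) by (auto simp: eventually_at)
    have "eventually (\<lambda>z. poly (pderiv Q) z \<noteq> 0 \<and> dist z b < \<eta> \<and> z \<noteq> b) (at b)"
      using e1 e2 eventually_neq_at_within[of b] by eventually_elim auto
    then obtain z where z: "poly (pderiv Q) z \<noteq> 0" "dist z b < \<eta>" "z \<noteq> b"
      using eventually_happens'[OF at_neq_bot] by blast
    then obtain f where f: "is_relation (poly P z) f" "0 < f z" using \<eta>(2)[of z] by (auto simp: dist_norm)
    have "degree P = 1" using less.prems(1) 0 by simp
    then obtain u v where P: "P = [:u, v:]" "v \<noteq> 0" by (metis degree1_coeffs)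
    have "fiber (poly P z) = {z}" unfolding fiber_def using P(2) by (auto simp: P(1))
    moreover have "(\<Sum>v\<in>fiber (poly P z). of_int (f v) * dt 1 v) = 0"
      using f(1) unfolding is_relation_def by blast
    ultimately have "dt 1 z = 0" using f(2) by simp
    then have "poly (pderiv Q) z / poly (pderiv P) z = 0" by (simp add: dt_1)
    then show ?thesis using z(1) P by (simp add: pderiv_pCons)
  next
    case (Suc k')
    obtain z1 w1 where z1: "z1 \<noteq> w1" "regular (poly P z1)" "same_jet z1 w1 \<or> same_coeff z1 w1"
      using dichotomy_at_infinity[OF p] less.prems(1) Suc by metis
    from z1(3) show ?thesis
    proof
      assume E: "same_jet z1 w1"
      obtain W where W: "degree W \<ge> 2"
        "\<And>z. regular (poly P z) \<Longrightarrow> W - [:poly W z:] = smult (lead_coeff W) (\<Prod>w\<in>{w. same_jet z w}. [:-w, 1:])"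
        by (rule flat_class_polynomial[OF flat_same_jet z1(2,1) E]) (rule that)
      have descend: "\<exists>T. S = pcompose T W" if "\<And>z w. same_jet z w \<Longrightarrow> poly S w = poly S z" for S
        by (rule descend_to_class_polynomial[OF flat_same_jet W(1) _ finite.emptyI])
           (rule W(2), assumption, rule that)
      have "\<exists>T. P = pcompose T W" by (rule descend) (simp add: same_jet_def)
      then obtain Pt where Pt: "P = pcompose Pt W" by blast
      have jet0: "poly Q w = poly Q z" if "same_jet z w" for z w
      proof -
        have "dt 0 z = dt 0 w" using that unfolding same_jet_def by blast
        then show ?thesis by simp
      qed
      have "\<exists>T. Q = pcompose T W" by (rule descend) (rule jet0)
      then obtain Qt where Qt: "Q = pcompose Qt W" by blast
      show ?thesis
      proof (cases "poly W a = poly W b")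
        case True
        then show ?thesis using Pt Qt by blast
      next
        case False
        \<comment> \<open>Since \<open>W\<close> separates \<open>a\<close> and \<open>b\<close>,
          the problem moves to \<open>Pt\<close>, \<open>Qt\<close> and the points
          \<open>poly W a\<close>, \<open>poly W b\<close>, which are again distinct. The exponent
          drops because \<open>W\<close> has degree at least 2.\<close>
        have dP: "p ^ k = degree Pt * degree W"
          using less.prems(1) degree_pcompose[of Pt W] Pt by simp
        then have "degree Pt dvd p ^ k" by simp
        then obtain j where j: "degree Pt = p ^ j" "j \<le> k" using divides_primepow_nat[OF p] by blast
        have "j \<noteq> k" using dP j(1) W(1) p1 by auto
        then have "j < k" using j(2) by simp
        moreover have "pderiv Qt \<noteq> 0"
          using less.prems(2) by (auto simp: Qt pderiv_pcompose)
        moreover have "poly S (poly W a) = poly S (poly W b)" if "pderiv S = Pt ^ i * pderiv Qt" for i S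
          using less.prems(4)[of "pcompose S W" i] pderiv_composition_moment[OF that, of W]
          by (simp add: poly_pcompose flip: Pt Qt)
        ultimately obtain P' Q' V where V: "Pt = pcompose P' V" "Qt = pcompose Q' V"
            "poly V (poly W a) = poly V (poly W b)"
          using less.IH[of j Pt Qt "poly W a" "poly W b"] j(1) False by metis
        then have "P = pcompose P' (pcompose V W)" "Q = pcompose Q' (pcompose V W)"
            "poly (pcompose V W) a = poly (pcompose V W) b"
          by (simp_all add: Pt Qt pcompose_assoc poly_pcompose)
        then show ?thesis by blast
      qed
    next
      assume E: "same_coeff z1 w1"
      obtain W where W: "degree W \<ge> 2"
        "\<And>z. regular (poly P z) \<Longrightarrow> W - [:poly W z:] = smult (lead_coeff W) (\<Prod>w\<in>{w. same_coeff z w}. [:-w, 1:])"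
        by (rule flat_class_polynomial[OF flat_same_coeff z1(2,1) E]) (rule that)
      have d: "degree W > 0" and l: "lead_coeff W \<noteq> 0" using W(1) by auto
      \<comment> \<open>Total ramification at \<open>b\<close> makes the derivative of
        \<open>W\<close> nonzero at \<open>a\<close>, whereas total ramification at \<open>a\<close>
        makes it zero there, the degree being at least 2.\<close>
      have "poly W x = poly W b \<Longrightarrow> x = b" for x
        by (rule class_polynomial_totally_ramified[OF W near[OF disjI1[OF conjI[OF refl refl]]]])
      from totally_ramified_derivative[OF d this, of a]
      have "poly (pderiv W) a \<noteq> 0" using W(1) l less.prems(3) by simp
      have "poly W x = poly W a \<Longrightarrow> x = a" for x
        by (rule class_polynomial_totally_ramified[OF W near[OF disjI2[OF conjI[OF refl refl]]]])
      from totally_ramified_derivative[OF d this, of a]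
      have "poly (pderiv W) a = 0" using W(1) by (simp add: power_0_left)
      with \<open>poly (pderiv W) a \<noteq> 0\<close> show ?thesis by blast
    qed
  qed
qed

theorem theorem5p2:
  fixes P q Q :: "complex poly" and a b :: complex and p r :: nat
  assumes "q \<noteq> 0"
    and "a \<noteq> b"
    and "pderiv Q = q"
    and "prime p"
    and "r \<ge> 1"
    and "degree P = p ^ r"
  shows "(\<forall>i::nat. contour_integral (linepath a b) (\<lambda>z. poly P z ^ i * poly q z) = 0)
    \<longleftrightarrow> (\<exists>Pt Qt W :: complex poly.
          P = pcompose Pt W \<and> Q = pcompose Qt W \<and> poly W a = poly W b)"
proof
  assume "\<forall>i. contour_integral (linepath a b) (\<lambda>z. poly P z ^ i * poly q z) = 0"
  then have "\<forall>i S. pderiv S = P ^ i * pderiv Q \<longrightarrow> poly S a = poly S b"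
    unfolding assms(3) moments_vanish_iff[of a b P Q, unfolded assms(3)] .
  then have mom: "poly S a = poly S b" if "pderiv S = P ^ i * pderiv Q" for i S
    using that by blast
  have "pderiv Q \<noteq> 0" using assms(1,3) by simp
  from moments_vanish_imp_composition[OF assms(4,6) this assms(2) mom]
  show "\<exists>Pt Qt W. P = pcompose Pt W \<and> Q = pcompose Qt W \<and> poly W a = poly W b" .
next
  assume "\<exists>Pt Qt W. P = pcompose Pt W \<and> Q = pcompose Qt W \<and> poly W a = poly W b"
  then obtain Pt Qt W where "P = pcompose Pt W" "Q = pcompose Qt W" "poly W a = poly W b" by blast
  then show "\<forall>i. contour_integral (linepath a b) (\<lambda>z. poly P z ^ i * poly q z) = 0"
    using moments_vanish_of_composition[of W a b Pt _ Qt] assms(3) by simp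
qed

end
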